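(* Fix $T>0$. Let $w\in C([0,T];L^2(\mathbb{R}^3_x\times\mathbb{R}^3_v))$ be a mild solution of the Wigner-Poisson equation with initial value $w_0$ such that $\|w(t)\|_2=\|w_0\|_2$ for $t\in[0,T]$, and assume that for some $\omega\in[0,1)$ $$\Big\|\int_{\mathbb{R}^3} w_0(x-tv,v)\,dv\Big\|_{L^{6/5}(\mathbb{R}^3_x)}\le C_T\,t^{-\omega},\qquad\forall\,t\in(0,T].$$ Then the two parts $E_0,E_1$ of the self-consistent field $\nabla_xV[w]=E_0+E_1$ satisfy, for all $t\in(0,T]$, $$\|E_0(t)\|_{2}\le C\Big\|\int w_0(x-tv,v)\,dv\Big\|_{L^{6/5}(\mathbb{R}^3_x)}\le C\,C_T\,t^{-\omega},$$ $$\|E_1(t)\|_{2}\le C\Big(\|w_0\|_2,\ \sup_{s\in(0,T]}\Big\{s^\omega\Big\|\int w_0(x-sv,v)\,dv\Big\|_{L^{6/5}}\Big\},\ T\Big)\,t^{\frac12-\omega},$$ where the constant in the second estimate depends only on the displayed quantities (and $\omega$), and its dependence on $T\in\mathbb{R}^+$ is continuous.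
   Context: The Wigner-Poisson (WP) equation is $w_t+v\cdot\nabla_xw-\Theta[V]w=0$ on $\mathbb{R}^3_x\times\mathbb{R}^3_v$, with $-\Delta_xV=n[w]=\int w\,dv$ (Newton potential), where $\Theta[V]u:=\mathcal{F}^{-1}_{\eta\to v}\big(i[V(x+\tfrac\eta2)-V(x-\tfrac\eta2)]\mathcal{F}_{v\to\eta}u\big)$ and $\mathcal{F}_{v\to\eta}u(x,\eta)=(2\pi)^{-3/2}\int u(x,v)e^{-iv\cdot\eta}dv$. A mild solution satisfies $w(x,v,t)=w_0(x-tv,v)+\int_0^t(\Theta[V[w]]w)(x-sv,v,t-s)\,ds$. For a vector field $E$ on $\mathbb{R}^3$, $\Gamma[E]u:=\mathcal{F}^{-1}_{\eta\to v}\big(W(x,\eta)\mathcal{F}_{v\to\eta}u(x,\eta)\big)$ with $W(x,\eta)=\int_{-1/2}^{1/2}E(x-r\eta)\,dr$, components $\Gamma_k$; one has $\Theta[V]u=\mathrm{div}_v(\Gamma[\nabla V]u)$. For $s>0$ the bilinear map $(E,u)\mapsto\int(\Gamma[E]u)(x-sv,v)\,dv$ extends continuously from smooth compactly supported $E,u$ to $L^2(\mathbb{R}^3)\times L^2(\mathbb{R}^6)\to L^2(\mathbb{R}^3_x)$ with norm at most $Cs^{-3/2}$, and expressions of this form are understood through this extension. For $\omega'\in\mathbb{R}$, $V_{T,\omega'}:=\{E\in C((0,T];L^2(\mathbb{R}^3)):\sup_{0<t\le T}t^{\omega'}\|E(t)\|_{L^2}<\infty\}$ (vector-valued fields). Splitting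 of the field: with $\lambda=-\frac1{4\pi}$, $E_0(x,t):=\lambda\frac{x}{|x|^3}*_x\int w_0(x-tv,v)\,dv$, and $E_1$ is the (unique) vector field in $V_{T,\omega-\frac12}$ solving, for $j=1,2,3$, $$(E_1)_j(x,t)=\lambda\sum_{k=1}^3\frac{-3x_jx_k+\delta_{jk}|x|^2}{|x|^5}*_x\int_0^ts\int\big(\Gamma_k[E_0+E_1]w\big)(x-sv,v,t-s)\,dv\,ds,$$ where the kernel denotes the distribution $\partial_{x_k}(x_j/|x|^3)$, convolution with which is bounded on $L^2(\mathbb{R}^3)$. The self-consistent field is $\nabla_xV[w]=E_0+E_1$. *)

theory Defs
  imports "HOL-Analysis.Analysis"
begin

type_synonym R3 = "real ^ 3"
type_synonym phase_fun = "R3 \<times> R3 \<Rightarrow> complex"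
type_synonym vfield = "R3 \<Rightarrow> complex ^ 3"

text \<open>Elements of \<open>L\<^sup>p\<close> are represented by Borel functions. All functions are complex valued;
  the real case is the special case of functions with values in the reals, since the operators
  \<open>\<Gamma>\<close> and \<open>\<Theta>\<close> preserve real-valuedness.\<close>

definition Lp_mem :: "real \<Rightarrow> ('a::euclidean_space \<Rightarrow> 'b::euclidean_space) \<Rightarrow> bool" where
  "Lp_mem p f \<longleftrightarrow> f \<in> borel_measurable lborel \<and> integrable lborel (\<lambda>x. norm (f x) powr p)"

definition Lp_norm :: "real \<Rightarrow> ('a::euclidean_space \<Rightarrow> 'b::euclidean_space) \<Rightarrow> real" where
  "Lp_norm p f = (\<integral>x. norm (f x) powr p \<partial>lborel) powr (1 / p)"

definition L2_lim :: "(nat \<Rightarrow> 'a::euclidean_space \<Rightarrow> 'b::euclidean_space) \<Rightarrow> ('a \<Rightarrow> 'b) \<Rightarrow> bool" where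
  "L2_lim f g \<longleftrightarrow> (\<forall>n. Lp_mem 2 (f n)) \<and> Lp_mem 2 g \<and>
     (\<lambda>n. Lp_norm 2 (\<lambda>x. f n x - g x)) \<longlonglongrightarrow> 0"

definition L2_continuous_on :: "real set \<Rightarrow> (real \<Rightarrow> 'a::euclidean_space \<Rightarrow> 'b::euclidean_space) \<Rightarrow> bool" where
  "L2_continuous_on S u \<longleftrightarrow> (\<forall>t\<in>S. Lp_mem 2 (u t)) \<and>
     (\<forall>t\<in>S. ((\<lambda>s. Lp_norm 2 (\<lambda>x. u s x - u t x)) \<longlongrightarrow> 0) (at t within S))"

text \<open>Integral over \<open>(0,t)\<close> of an \<open>L\<^sup>2\<close>-valued function, characterised by duality with \<open>L\<^sup>2\<close>
  (\<open>L\<^sup>2\<close> being separable, this agrees with the Bochner integral for norm-integrable functions).\<close>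

definition L2_integral ::
  "real \<Rightarrow> (real \<Rightarrow> 'a::euclidean_space \<Rightarrow> complex) \<Rightarrow> ('a \<Rightarrow> complex) \<Rightarrow> bool" where
  "L2_integral t g F \<longleftrightarrow> Lp_mem 2 F \<and> (\<forall>s\<in>{0<..<t}. Lp_mem 2 (g s)) \<and>
     (\<forall>\<phi>. Lp_mem 2 \<phi> \<longrightarrow>
        set_integrable lborel {0<..<t} (\<lambda>s. \<integral>x. g s x * \<phi> x \<partial>lborel) \<and>
        (\<integral>x. F x * \<phi> x \<partial>lborel) = (LINT s:{0<..<t}|lborel. (\<integral>x. g s x * \<phi> x \<partial>lborel)))"

fun Ck :: "nat \<Rightarrow> ('a::euclidean_space \<Rightarrow> 'b::real_normed_vector) \<Rightarrow> bool" where
  "Ck 0 f \<longleftrightarrow> continuous_on UNIV f"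
| "Ck (Suc n) f \<longleftrightarrow> (\<forall>x. f differentiable (at x)) \<and>
     (\<forall>h. Ck n (\<lambda>x. frechet_derivative f (at x) h))"

definition test_function :: "('a::euclidean_space \<Rightarrow> 'b::real_normed_vector) \<Rightarrow> bool" where
  "test_function f \<longleftrightarrow> (\<forall>n. Ck n f) \<and> compact (closure {x. f x \<noteq> 0})"

definition locally_integrable :: "(R3 \<Rightarrow> complex) \<Rightarrow> bool" where
  "locally_integrable f \<longleftrightarrow> (\<forall>K. compact K \<longrightarrow> set_integrable lborel K f)"

text \<open>\<open>g\<close> is the distributional partial derivative \<open>\<partial>f/\<partial>x\<^sub>k\<close>.\<close>

definition weak_partial :: "3 \<Rightarrow> (R3 \<Rightarrow> complex) \<Rightarrow> (R3 \<Rightarrow> complex) \<Rightarrow> bool" where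
  "weak_partial k f g \<longleftrightarrow> locally_integrable f \<and> locally_integrable g \<and>
     (\<forall>\<phi>::R3 \<Rightarrow> complex. test_function \<phi> \<longrightarrow>
        (\<integral>x. f x * frechet_derivative \<phi> (at x) (axis k 1) \<partial>lborel)
          = - (\<integral>x. g x * \<phi> x \<partial>lborel))"

section \<open>The operators \<open>\<Gamma>\<close> and \<open>\<Theta>\<close>\<close>

definition fourier_v :: "phase_fun \<Rightarrow> phase_fun" where
  "fourier_v u = (\<lambda>(x, \<eta>). (2 * pi) powr (-3/2) *\<^sub>R (\<integral>v. u (x, v) * cis (- (v \<bullet> \<eta>)) \<partial>lborel))"

definition inv_fourier_v :: "phase_fun \<Rightarrow> phase_fun" where
  "inv_fourier_v u = (\<lambda>(x, v). (2 * pi) powr (-3/2) *\<^sub>R (\<integral>\<eta>. u (x, \<eta>) * cis (v \<bullet> \<eta>) \<partial>lborel))"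

text \<open>\<open>U\<close> is the partial Fourier transform of \<open>u \<in> L\<^sup>2\<close>, i.e. the value at \<open>u\<close> of the continuous
  extension of \<^const>\<open>fourier_v\<close> from the test functions to \<open>L\<^sup>2\<close>.\<close>

definition fourier_v_L2 :: "phase_fun \<Rightarrow> phase_fun \<Rightarrow> bool" where
  "fourier_v_L2 u U \<longleftrightarrow> (\<exists>un. (\<forall>n. test_function (un n)) \<and> L2_lim un u \<and>
     L2_lim (\<lambda>n. fourier_v (un n)) U)"

definition W_symbol :: "vfield \<Rightarrow> 3 \<Rightarrow> phase_fun" where
  "W_symbol E k = (\<lambda>(x, \<eta>). LINT r:{-1/2..1/2}|lborel. E (x - r *\<^sub>R \<eta>) $ k)"

definition Gamma_op :: "vfield \<Rightarrow> phase_fun \<Rightarrow> 3 \<Rightarrow> phase_fun" where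
  "Gamma_op E u k = inv_fourier_v (\<lambda>z. W_symbol E k z * fourier_v u z)"

definition Gamma_average :: "real \<Rightarrow> vfield \<Rightarrow> phase_fun \<Rightarrow> 3 \<Rightarrow> R3 \<Rightarrow> complex" where
  "Gamma_average s E u k x = (\<integral>v. Gamma_op E u k (x - s *\<^sub>R v, v) \<partial>lborel)"

text \<open>\<open>G\<close> is the value at \<open>(E,u) \<in> L\<^sup>2 \<times> L\<^sup>2\<close> of the continuous extension of
  \<open>(E,u) \<mapsto> \<integral> (\<Gamma>\<^sub>k[E]u)(x - s v, v) dv\<close> from the test functions.\<close>

definition Gamma_average_L2 ::
  "real \<Rightarrow> vfield \<Rightarrow> phase_fun \<Rightarrow> 3 \<Rightarrow> (R3 \<Rightarrow> complex) \<Rightarrow> bool" where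
  "Gamma_average_L2 s E u k G \<longleftrightarrow> (\<exists>En un.
     (\<forall>n. test_function (En n)) \<and> (\<forall>n. test_function (un n)) \<and>
     L2_lim En E \<and> L2_lim un u \<and> L2_lim (\<lambda>n. Gamma_average s (En n) (un n) k) G)"

text \<open>The distribution \<open>\<Theta>[V]u\<close> (for \<open>u \<in> L\<^sup>2\<close> in general not a function) takes the value \<open>c\<close> at the
  test function \<open>\<psi>\<close>; the inverse Fourier transform is moved to \<open>\<psi>\<close>, the pairing
  \<open>\<langle>f,\<psi>\<rangle> = \<integral>\<integral> f \<psi>\<close> being bilinear.\<close>

definition Theta_pairing :: "(R3 \<Rightarrow> complex) \<Rightarrow> phase_fun \<Rightarrow> phase_fun \<Rightarrow> complex \<Rightarrow> bool" where
  "Theta_pairing V u \<psi> c \<longleftrightarrow> (\<exists>U. fourier_v_L2 u U \<and>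
     (let f = (\<lambda>(x, \<eta>). \<i> * (V (x + (1/2) *\<^sub>R \<eta>) - V (x - (1/2) *\<^sub>R \<eta>))
                  * U (x, \<eta>) * inv_fourier_v \<psi> (x, \<eta>))
      in integrable lborel f \<and> c = (\<integral>z. f z \<partial>lborel)))"

section \<open>The field and its splitting\<close>

definition lam :: real where "lam = - 1 / (4 * pi)"

definition free_density :: "phase_fun \<Rightarrow> real \<Rightarrow> R3 \<Rightarrow> complex" where
  "free_density w0 t x = (\<integral>v. w0 (x - t *\<^sub>R v, v) \<partial>lborel)"

definition riesz_conv :: "3 \<Rightarrow> (R3 \<Rightarrow> complex) \<Rightarrow> R3 \<Rightarrow> complex" where
  "riesz_conv j f x = (\<integral>y. ((x - y) $ j / norm (x - y) ^ 3) *\<^sub>R f y \<partial>lborel)"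

definition E0_field :: "phase_fun \<Rightarrow> real \<Rightarrow> vfield" where
  "E0_field w0 t x = (\<chi> j. lam *\<^sub>R riesz_conv j (free_density w0 t) x)"

text \<open>For \<open>f \<in> L\<^sup>2\<close>, \<open>g\<close> is the convolution of \<open>f\<close> with the distribution
  \<open>\<partial>\<^sub>k (x\<^sub>j / \<bar>x\<bar>\<^sup>3)\<close>, which is \<open>\<partial>\<^sub>k ((x\<^sub>j / \<bar>x\<bar>\<^sup>3) * f)\<close>; the pointwise kernel
  \<open>(\<delta>\<^sub>j\<^sub>k \<bar>x\<bar>\<^sup>2 - 3 x\<^sub>j x\<^sub>k) / \<bar>x\<bar>\<^sup>5\<close> is the regular part of this distribution.\<close>

definition dipole_conv :: "3 \<Rightarrow> 3 \<Rightarrow> (R3 \<Rightarrow> complex) \<Rightarrow> (R3 \<Rightarrow> complex) \<Rightarrow> bool" where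
  "dipole_conv j k f g \<longleftrightarrow> Lp_mem 2 f \<and> Lp_mem 2 g \<and> weak_partial k (riesz_conv j f) g"

definition V_space :: "real \<Rightarrow> real \<Rightarrow> (real \<Rightarrow> vfield) \<Rightarrow> bool" where
  "V_space T \<omega>' E \<longleftrightarrow> L2_continuous_on {0<..T} E \<and>
     bdd_above ((\<lambda>t. t powr \<omega>' * Lp_norm 2 (E t)) ` {0<..T})"

text \<open>\<open>F\<close> is \<open>\<integral>\<^sub>0\<^sup>t s \<integral> (\<Gamma>\<^sub>k[E]w)(x - s v, v, t - s) dv ds\<close>.\<close>

definition Gamma_moment ::
  "(real \<Rightarrow> vfield) \<Rightarrow> (real \<Rightarrow> phase_fun) \<Rightarrow> real \<Rightarrow> 3 \<Rightarrow> (R3 \<Rightarrow> complex) \<Rightarrow> bool" where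
  "Gamma_moment E w t k F \<longleftrightarrow> (\<exists>G.
     (\<forall>s\<in>{0<..<t}. Gamma_average_L2 s (E (t - s)) (w (t - s)) k (G s)) \<and>
     L2_integral t (\<lambda>s x. s *\<^sub>R G s x) F)"

definition E1_equation ::
  "real \<Rightarrow> phase_fun \<Rightarrow> (real \<Rightarrow> phase_fun) \<Rightarrow> (real \<Rightarrow> vfield) \<Rightarrow> bool" where
  "E1_equation T w0 w E1 \<longleftrightarrow> (\<forall>t\<in>{0<..T}. \<exists>F H.
     (\<forall>k. Gamma_moment (\<lambda>\<tau> x. E0_field w0 \<tau> x + E1 \<tau> x) w t k (F k)) \<and>
     (\<forall>j k. dipole_conv j k (F k) (H j k)) \<and>
     (\<forall>j. AE x in lborel. E1 t x $ j = lam *\<^sub>R (\<Sum>k\<in>UNIV. H j k x)))"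

text \<open>\<open>V\<close> is the potential with field \<open>E\<close>; as for a Newton potential with square integrable field,
  membership in \<open>L\<^sup>6\<close> fixes the additive constant, which does not affect \<open>\<Theta>[V]\<close>.\<close>

definition potential_of :: "(R3 \<Rightarrow> complex) \<Rightarrow> vfield \<Rightarrow> bool" where
  "potential_of V E \<longleftrightarrow> Lp_mem 6 V \<and> (\<forall>k. weak_partial k V (\<lambda>x. E x $ k))"

text \<open>Mild solutions of the Wigner-Poisson equation with self-consistent field \<open>E\<close>. The integral
  \<open>\<integral> w dv\<close> need not exist for \<open>w \<in> L\<^sup>2\<close>, so the Poisson equation enters only through \<open>E\<close>, to be
  taken as \<open>E\<^sub>0 + E\<^sub>1\<close>: this is the field \<open>\<lambda> x/\<bar>x\<bar>\<^sup>3 * n\<close> of the density \<open>n\<close> obtained by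
  integrating the mild formula in \<open>v\<close>. The mild formula is read in the sense of distributions
  on phase space; the shift \<open>(x,v) \<mapsto> (x - s v, v)\<close> preserves volume and is moved to \<open>\<psi>\<close>.\<close>

definition mild_solution_WP ::
  "real \<Rightarrow> phase_fun \<Rightarrow> (real \<Rightarrow> phase_fun) \<Rightarrow> (real \<Rightarrow> vfield) \<Rightarrow> bool" where
  "mild_solution_WP T w0 w E \<longleftrightarrow>
     (AE z in lborel. w 0 z = w0 z) \<and>
     (\<exists>V. (\<forall>t\<in>{0<..T}. potential_of (V t) (E t)) \<and>
       (\<forall>t\<in>{0..T}. \<forall>\<psi>::phase_fun. test_function \<psi> \<longrightarrow>
         (\<exists>\<theta>. (\<forall>s\<in>{0<..<t}.
                 Theta_pairing (V (t - s)) (w (t - s)) (\<lambda>(x, v). \<psi> (x + s *\<^sub>R v, v)) (\<theta> s)) \<and>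
              set_integrable lborel {0<..<t} \<theta> \<and>
              (\<integral>z. w t z * \<psi> z \<partial>lborel)
                = (\<integral>z. (case z of (x, v) \<Rightarrow> w0 (x - t *\<^sub>R v, v)) * \<psi> z \<partial>lborel)
                  + (LINT s:{0<..<t}|lborel. \<theta> s))))"

end

(* The field E0 is the convolution of the density with lam x/|x|^3, so the Hardy-Littlewood-Sobolev
   inequality for the kernel |x|^-2 bounds it. The square of that inequality is a quadratic form in f
   with kernel |y-z|^-1; by symmetry one may restrict it to f(z) <= f(y) and split at
   |y-z| = f(y)^(-2/5).

   For E1, exchanging integrals shows that the velocity average of Gamma[E]u at time s is
   s^-3 times a rescaled Fourier transform, in eta, of the y-integral of W(y,eta) uhat(y,eta) exp(-i y.eta/s);
   Cauchy-Schwarz in y and Bessel's inequality (used twice) give the factor s^(-3/2). The dipole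
   convolution is L2-bounded because x_j/|x|^3 is a superposition of Gaussians times x_j, whose
   Fourier transforms are explicit. Hence t -> ||E1(t)|| satisfies a Volterra inequality with kernel
   s^(-1/2), and a weighted supremum, finite because E1 lies in V_(T,omega-1/2), closes the estimate. *)
theory Submission
  imports Defs "HOL-Probability.Characteristic_Functions"
begin

section \<open>Square integrable functions\<close>

text \<open>The objects in the equation for E1 are characterised only indirectly:
  \<open>Gamma_average_L2\<close> by limits of test functions, \<open>dipole_conv\<close> by a weak
  derivative, \<open>L2_integral\<close> by pairings. Each bound is therefore proved where all
  integrals converge absolutely, and is then transferred either by convergence of norms or by
  pairing with (an approximation of) the complex conjugate of the function to be estimated.
  Exponents: the amplitude s^-3 and the dilation x -> -x/s, which contributes s^(3/2) in L2, combine
  to s^(-3/2); the weight s in the equation leaves s^(-1/2), integrable at 0. Convolved with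
  \<tau>^(-\<omega>), the size of E0, this gives t^(1/2-\<omega>), the rate claimed for E1;
  convolved with \<tau>^(1/2-\<omega>) it gives a further t^(1/2). Since T is arbitrary, the
  Volterra term is not small by itself. The supremum therefore carries a weight exp(-\<mu> t), with
  \<mu> so large that the term is absorbed; removing the weight produces the exponential in the
  final constant, whose explicit form gives continuity in T.\<close>

lemma L2_mem_iff:
  "Lp_mem 2 f \<longleftrightarrow> f \<in> borel_measurable borel \<and> integrable lborel (\<lambda>x. (norm (f x))\<^sup>2)"
  by (simp add: Lp_mem_def)

lemma L2_measurable: "Lp_mem 2 f \<Longrightarrow> f \<in> borel_measurable borel"
  by (simp add: Lp_mem_def)

lemma L2_norm_eq: "Lp_norm 2 f = sqrt (\<integral>x. (norm (f x))\<^sup>2 \<partial>lborel)"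
  by (simp add: Lp_norm_def powr_half_sqrt)

lemma Lp_norm_nonneg [simp]: "0 \<le> Lp_norm p f"
  by (simp add: Lp_norm_def)

lemma L2_nn_integral:
  assumes "Lp_mem 2 f"
  shows "(\<integral>\<^sup>+x. ennreal ((norm (f x))\<^sup>2) \<partial>lborel) = ennreal ((Lp_norm 2 f)\<^sup>2)"
proof -
  have "(\<integral>\<^sup>+x. ennreal ((norm (f x))\<^sup>2) \<partial>lborel) = ennreal (\<integral>x. (norm (f x))\<^sup>2 \<partial>lborel)"
    using assms by (intro nn_integral_eq_integral) (auto simp: L2_mem_iff)
  then show ?thesis by (simp add: L2_norm_eq)
qed

text \<open>Upper bounds are derived for nonnegative extended integrals, where integrability need
  not be known in advance; this turns such a bound into membership and a norm estimate at
  once.\<close>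

lemma L2_nn_integral_le:
  assumes m: "f \<in> borel_measurable borel" and "0 \<le> C"
    and le: "(\<integral>\<^sup>+x. ennreal ((norm (f x))\<^sup>2) \<partial>lborel) \<le> ennreal (C\<^sup>2)"
  shows "Lp_mem 2 f" "Lp_norm 2 f \<le> C"
proof -
  have i: "integrable lborel (\<lambda>x. (norm (f x))\<^sup>2)"
    using m le_less_trans[OF le ennreal_less_top] by (intro integrableI_bounded) auto
  then show 1: "Lp_mem 2 f" using m by (simp add: L2_mem_iff)
  have "(Lp_norm 2 f)\<^sup>2 \<le> C\<^sup>2"
    using le L2_nn_integral[OF 1] by simp
  then show "Lp_norm 2 f \<le> C" using \<open>0 \<le> C\<close> by (rule power2_le_imp_le)
qed

lemma L2_Cauchy_Schwarz:
  fixes f :: "'a::euclidean_space \<Rightarrow> 'b::euclidean_space" and g :: "'a \<Rightarrow> 'c::euclidean_space"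
  assumes f: "Lp_mem 2 f" and g: "Lp_mem 2 g"
  shows "integrable lborel (\<lambda>x. norm (f x) * norm (g x))"
    and "(\<integral>x. norm (f x) * norm (g x) \<partial>lborel) \<le> Lp_norm 2 f * Lp_norm 2 g"
proof -
  note [measurable] = L2_measurable[OF f] L2_measurable[OF g]
  have "(\<integral>\<^sup>+x. ennreal (norm (f x)) * ennreal (norm (g x)) \<partial>lborel)\<^sup>2
      \<le> (\<integral>\<^sup>+x. (ennreal (norm (f x)))\<^sup>2 \<partial>lborel) * (\<integral>\<^sup>+x. (ennreal (norm (g x)))\<^sup>2 \<partial>lborel)"
    by (rule Cauchy_Schwarz_nn_integral) auto
  also have "\<dots> = ennreal ((Lp_norm 2 f * Lp_norm 2 g)\<^sup>2)"
    using L2_nn_integral[OF f] L2_nn_integral[OF g]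
    by (simp add: ennreal_power power_mult_distrib ennreal_mult)
  finally have le: "(\<integral>\<^sup>+x. ennreal (norm (f x) * norm (g x)) \<partial>lborel)\<^sup>2
      \<le> ennreal ((Lp_norm 2 f * Lp_norm 2 g)\<^sup>2)"
    by (simp add: ennreal_mult)
  have fin: "(\<integral>\<^sup>+x. ennreal (norm (f x) * norm (g x)) \<partial>lborel) < \<infinity>" (is "?X < _")
  proof (rule ccontr)
    assume "\<not> ?X < \<infinity>"
    then have "?X = top" by (simp add: less_top[symmetric])
    then show False using le by (simp add: power2_eq_square top_unique)
  qed
  show i: "integrable lborel (\<lambda>x. norm (f x) * norm (g x))"
    using fin by (intro integrableI_bounded) auto
  have "(\<integral>\<^sup>+x. ennreal (norm (f x) * norm (g x)) \<partial>lborel)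
      = ennreal (\<integral>x. norm (f x) * norm (g x) \<partial>lborel)"
    by (rule nn_integral_eq_integral[OF i]) auto
  then have "(\<integral>x. norm (f x) * norm (g x) \<partial>lborel)\<^sup>2 \<le> (Lp_norm 2 f * Lp_norm 2 g)\<^sup>2"
    using le by (simp add: ennreal_power)
  then show "(\<integral>x. norm (f x) * norm (g x) \<partial>lborel) \<le> Lp_norm 2 f * Lp_norm 2 g"
    by (rule power2_le_imp_le) simp
qed

lemma L2_add:
  fixes f g :: "'a::euclidean_space \<Rightarrow> 'b::euclidean_space"
  assumes f: "Lp_mem 2 f" and g: "Lp_mem 2 g"
  shows "Lp_mem 2 (\<lambda>x. f x + g x)" "Lp_norm 2 (\<lambda>x. f x + g x) \<le> Lp_norm 2 f + Lp_norm 2 g"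
proof -
  note [measurable] = L2_measurable[OF f] L2_measurable[OF g]
  note CS = L2_Cauchy_Schwarz[OF f g]
  have fi: "integrable lborel (\<lambda>x. (norm (f x))\<^sup>2)" and gi: "integrable lborel (\<lambda>x. (norm (g x))\<^sup>2)"
    using f g by (auto simp: L2_mem_iff)
  have pw: "(norm (f x + g x))\<^sup>2 \<le> (norm (f x))\<^sup>2 + (norm (g x))\<^sup>2 + 2 * (norm (f x) * norm (g x))" for x
  proof -
    have "(norm (f x + g x))\<^sup>2 \<le> (norm (f x) + norm (g x))\<^sup>2"
      by (intro power_mono norm_triangle_ineq) auto
    then show ?thesis by (simp add: power2_sum)
  qed
  have bi: "integrable lborel (\<lambda>x. (norm (f x))\<^sup>2 + (norm (g x))\<^sup>2 + 2 * (norm (f x) * norm (g x)))"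
    using fi gi CS(1) by (intro Bochner_Integration.integrable_add integrable_mult_right)
  have i: "integrable lborel (\<lambda>x. (norm (f x + g x))\<^sup>2)"
    by (rule Bochner_Integration.integrable_bound[OF bi])
       (auto intro!: AE_I2 order_trans[OF pw])
  then show "Lp_mem 2 (\<lambda>x. f x + g x)" by (simp add: L2_mem_iff)
  have sq: "(Lp_norm 2 h)\<^sup>2 = (\<integral>x. (norm (h x))\<^sup>2 \<partial>lborel)" for h :: "'a \<Rightarrow> 'b"
    by (simp add: L2_norm_eq)
  have "(\<integral>x. (norm (f x + g x))\<^sup>2 \<partial>lborel)
      \<le> (\<integral>x. (norm (f x))\<^sup>2 + (norm (g x))\<^sup>2 + 2 * (norm (f x) * norm (g x)) \<partial>lborel)"
    using pw by (intro integral_mono i bi)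
  also have "\<dots> = (Lp_norm 2 f)\<^sup>2 + (Lp_norm 2 g)\<^sup>2 + 2 * (\<integral>x. norm (f x) * norm (g x) \<partial>lborel)"
    unfolding sq using fi gi CS(1) by simp
  also have "\<dots> \<le> (Lp_norm 2 f + Lp_norm 2 g)\<^sup>2"
    using CS(2) by (simp add: power2_sum)
  finally show "Lp_norm 2 (\<lambda>x. f x + g x) \<le> Lp_norm 2 f + Lp_norm 2 g"
    unfolding sq[symmetric] by (rule power2_le_imp_le) simp
qed

lemma L2_uminus:
  fixes f :: "'a::euclidean_space \<Rightarrow> 'b::euclidean_space"
  shows "Lp_mem 2 (\<lambda>x. - f x) = Lp_mem 2 f" "Lp_norm 2 (\<lambda>x. - f x) = Lp_norm 2 f"
  by (simp_all add: L2_mem_iff L2_norm_eq)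

lemma L2_diff:
  fixes f g :: "'a::euclidean_space \<Rightarrow> 'b::euclidean_space"
  assumes f: "Lp_mem 2 f" and g: "Lp_mem 2 g"
  shows "Lp_mem 2 (\<lambda>x. f x - g x)" "Lp_norm 2 (\<lambda>x. f x - g x) \<le> Lp_norm 2 f + Lp_norm 2 g"
    "Lp_norm 2 f \<le> Lp_norm 2 (\<lambda>x. f x - g x) + Lp_norm 2 g"
proof -
  have g': "Lp_mem 2 (\<lambda>x. - g x)" using g by (simp add: L2_uminus)
  show 1: "Lp_mem 2 (\<lambda>x. f x - g x)" "Lp_norm 2 (\<lambda>x. f x - g x) \<le> Lp_norm 2 f + Lp_norm 2 g"
    using L2_add[OF f g'] by (simp_all add: L2_uminus)
  show "Lp_norm 2 f \<le> Lp_norm 2 (\<lambda>x. f x - g x) + Lp_norm 2 g"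
    using L2_add(2)[OF 1(1) g] by simp
qed

lemma L2_scaleR:
  fixes f :: "'a::euclidean_space \<Rightarrow> 'b::euclidean_space"
  assumes f: "Lp_mem 2 f"
  shows "Lp_mem 2 (\<lambda>x. c *\<^sub>R f x)" "Lp_norm 2 (\<lambda>x. c *\<^sub>R f x) = \<bar>c\<bar> * Lp_norm 2 f"
proof -
  show "Lp_mem 2 (\<lambda>x. c *\<^sub>R f x)" using f by (auto simp: L2_mem_iff power_mult_distrib)
  show "Lp_norm 2 (\<lambda>x. c *\<^sub>R f x) = \<bar>c\<bar> * Lp_norm 2 f"
    by (simp add: L2_norm_eq power_mult_distrib real_sqrt_mult)
qed

lemma L2_cong_AE:
  fixes f g :: "'a::euclidean_space \<Rightarrow> 'b::euclidean_space"
  assumes f: "Lp_mem 2 f" and g: "g \<in> borel_measurable borel" and ae: "AE x in lborel. f x = g x"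
  shows "Lp_mem 2 g" "Lp_norm 2 g = Lp_norm 2 f"
proof -
  note [measurable] = L2_measurable[OF f] g
  have "integrable lborel (\<lambda>x. (norm (f x))\<^sup>2) = integrable lborel (\<lambda>x. (norm (g x))\<^sup>2)"
    using ae by (intro integrable_cong_AE) auto
  then show "Lp_mem 2 g" using f g by (simp add: L2_mem_iff)
  have "(\<integral>x. (norm (g x))\<^sup>2 \<partial>lborel) = (\<integral>x. (norm (f x))\<^sup>2 \<partial>lborel)"
    using ae by (intro integral_cong_AE) auto
  then show "Lp_norm 2 g = Lp_norm 2 f" by (simp add: L2_norm_eq)
qed

text \<open>Reverse triangle inequality. It carries norm bounds from test functions to the
  continuous extension.\<close>

lemma L2_lim_norm:
  fixes f :: "nat \<Rightarrow> 'a::euclidean_space \<Rightarrow> 'b::euclidean_space"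
  assumes "L2_lim f g"
  shows "(\<lambda>n. Lp_norm 2 (f n)) \<longlonglongrightarrow> Lp_norm 2 g"
proof -
  have f: "\<And>n. Lp_mem 2 (f n)" and g: "Lp_mem 2 g"
    and lim: "(\<lambda>n. Lp_norm 2 (\<lambda>x. f n x - g x)) \<longlonglongrightarrow> 0"
    using assms by (auto simp: L2_lim_def)
  have "norm (Lp_norm 2 (f n) - Lp_norm 2 g) \<le> Lp_norm 2 (\<lambda>x. f n x - g x)" for n
  proof -
    have "Lp_norm 2 (\<lambda>x. g x - f n x) = Lp_norm 2 (\<lambda>x. f n x - g x)"
      by (simp add: L2_norm_eq norm_minus_commute)
    then show ?thesis
      using L2_diff(3)[OF f g, of n] L2_diff(3)[OF g f, of n] by simp
  qed
  then have "(\<lambda>n. Lp_norm 2 (f n) - Lp_norm 2 g) \<longlonglongrightarrow> 0"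
    by (intro Lim_null_comparison[OF _ lim]) auto
  then show ?thesis by (simp add: LIM_zero_iff)
qed

section \<open>Affine changes of variable\<close>

lemma nn_integral_lborel_affine:
  fixes t :: "'a::euclidean_space"
  assumes [measurable]: "f \<in> borel_measurable borel" and c: "c \<noteq> 0"
  shows "(\<integral>\<^sup>+x. f x \<partial>lborel) = ennreal (\<bar>c\<bar> ^ DIM('a)) * (\<integral>\<^sup>+x. f (t + c *\<^sub>R x) \<partial>lborel)"
  by (subst lborel_affine[OF c, of t])
     (simp add: nn_integral_density nn_integral_distr nn_integral_cmult)

lemma integral_lborel_affine:
  fixes t :: "'a::euclidean_space" and f :: "'a \<Rightarrow> 'b::{banach, second_countable_topology}"
  assumes c: "c \<noteq> 0" and i: "integrable lborel f"
  shows "integrable lborel (\<lambda>x. f (t + c *\<^sub>R x))"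
    "(\<integral>x. f x \<partial>lborel) = (\<bar>c\<bar> ^ DIM('a)) *\<^sub>R (\<integral>x. f (t + c *\<^sub>R x) \<partial>lborel)"
proof -
  have [measurable]: "f \<in> borel_measurable borel" using i by auto
  have "(\<integral>\<^sup>+x. ennreal (norm (f x)) \<partial>lborel)
      = ennreal (\<bar>c\<bar> ^ DIM('a)) * (\<integral>\<^sup>+x. ennreal (norm (f (t + c *\<^sub>R x))) \<partial>lborel)"
    by (rule nn_integral_lborel_affine) (use c in auto)
  moreover have "(\<integral>\<^sup>+x. ennreal (norm (f x)) \<partial>lborel) < \<infinity>"
    using i by (simp add: integrable_iff_bounded)
  ultimately have "(\<integral>\<^sup>+x. ennreal (norm (f (t + c *\<^sub>R x))) \<partial>lborel) < \<infinity>"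
    using c by (auto simp: ennreal_mult_less_top)
  then show "integrable lborel (\<lambda>x. f (t + c *\<^sub>R x))"
    by (auto simp: integrable_iff_bounded)
  show "(\<integral>x. f x \<partial>lborel) = (\<bar>c\<bar> ^ DIM('a)) *\<^sub>R (\<integral>x. f (t + c *\<^sub>R x) \<partial>lborel)"
  proof (subst lborel_affine[OF c, of t], subst integral_density)
    show "AE x in distr lborel borel (\<lambda>x. t + c *\<^sub>R x). 0 \<le> \<bar>c\<bar> ^ DIM('a)" by simp
    show "(\<integral>x. \<bar>c\<bar> ^ DIM('a) *\<^sub>R f x \<partial>distr lborel borel (\<lambda>x. t + c *\<^sub>R x)) =
      \<bar>c\<bar> ^ DIM('a) *\<^sub>R (\<integral>x. f (t + c *\<^sub>R x) \<partial>lborel)"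
      by (simp add: integral_distr)
  qed auto
qed


section \<open>The Hardy-Littlewood-Sobolev inequality\<close>

text \<open>The kernel |x|^-4 softened to r^-2 |x|^-2 inside the ball of radius r, which makes it
  integrable at 0 as well as at infinity. By scaling its mass is a multiple of 1/r, and it majorises
  every kernel met in the Hardy-Littlewood-Sobolev argument.\<close>

definition rker :: "real \<Rightarrow> R3 \<Rightarrow> real" where
  "rker r x = 1 / ((norm x)\<^sup>2 * (max r (norm x))\<^sup>2)"

text \<open>\<open>enn2real\<close> loses nothing, because the integral is finite
  (\<open>rker_one_finite\<close>). Its numerical value is never computed.\<close>

definition rker_mass :: real where
  "rker_mass = enn2real (\<integral>\<^sup>+x. ennreal (rker 1 x) \<partial>lborel)"

lemma rker_nonneg [simp]: "0 \<le> rker r x"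
  by (simp add: rker_def)

lemma rker_measurable [measurable]: "rker r \<in> borel_measurable borel"
  unfolding rker_def[abs_def] by measurable

lemma nn_integral_split_zero:
  fixes f :: "real \<Rightarrow> ennreal"
  assumes [measurable]: "f \<in> borel_measurable borel" and even: "\<And>t. f (- t) = f t"
  shows "(\<integral>\<^sup>+t. f t \<partial>lborel) = 2 * (\<integral>\<^sup>+t. f t * indicator {0<..} t \<partial>lborel)"
proof -
  have neg: "(\<integral>\<^sup>+t. f t * indicator {..<0} t \<partial>lborel) = (\<integral>\<^sup>+t. f t * indicator {0<..} t \<partial>lborel)"
    by (subst nn_integral_real_affine[where c="-1" and t=0])
       (auto simp: even indicator_def intro!: nn_integral_cong)
  have "(\<integral>\<^sup>+t. f t \<partial>lborel) = (\<integral>\<^sup>+t. f t * indicator {0<..} t + f t * indicator {..<0} t \<partial>lborel)"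
    by (intro nn_integral_cong_AE eventually_mono[OF AE_lborel_singleton[of 0]])
       (auto simp: indicator_def)
  also have "\<dots> = (\<integral>\<^sup>+t. f t * indicator {0<..} t \<partial>lborel) + (\<integral>\<^sup>+t. f t * indicator {..<0} t \<partial>lborel)"
    by (rule nn_integral_add) auto
  finally show ?thesis by (simp add: neg mult_2)
qed

text \<open>One-dimensional factor of the product bound for \<open>rker 1\<close>: the exponent is
  -2/3 > -1 near 0 and -4/3 < -1 at infinity.\<close>

lemma nn_integral_powr_two_sided_finite:
  "(\<integral>\<^sup>+t. ennreal (\<bar>t\<bar> powr (-2/3) * (max 1 \<bar>t\<bar>) powr (-2/3)) \<partial>lborel) < \<infinity>"
proof -
  let ?h = "\<lambda>t::real. \<bar>t\<bar> powr (-2/3) * (max 1 \<bar>t\<bar>) powr (-2/3)"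
  have 1: "(\<integral>\<^sup>+t. ennreal (t powr (-2/3)) * indicator {0..1} t \<partial>lborel) = ennreal (1 powr (-2/3+1) / (-2/3+1))"
    by (rule nn_integral_has_integral_lebesgue'[OF _ has_integral_powr_from_0]) auto
  have 2: "(\<integral>\<^sup>+t. ennreal (t powr (-4/3)) * indicator {1..} t \<partial>lborel) = ennreal (- (1 powr (-4/3+1)) / (-4/3+1))"
    by (rule nn_integral_has_integral_lebesgue'[OF _ has_integral_powr_to_inf]) auto
  have "(\<integral>\<^sup>+t. ennreal (?h t) * indicator {0<..} t \<partial>lborel)
     \<le> (\<integral>\<^sup>+t. ennreal (t powr (-2/3)) * indicator {0..1} t + ennreal (t powr (-4/3)) * indicator {1..} t \<partial>lborel)"
  proof (rule nn_integral_mono)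
    fix t :: real
    show "ennreal (?h t) * indicator {0<..} t
      \<le> ennreal (t powr (-2/3)) * indicator {0..1} t + ennreal (t powr (-4/3)) * indicator {1..} t"
      by (cases "t \<le> 1") (auto simp: indicator_def powr_add[symmetric] max_def)
  qed
  also have "\<dots> = (\<integral>\<^sup>+t. ennreal (t powr (-2/3)) * indicator {0..1} t \<partial>lborel)
      + (\<integral>\<^sup>+t. ennreal (t powr (-4/3)) * indicator {1..} t \<partial>lborel)"
    by (rule nn_integral_add) auto
  also have "\<dots> < \<infinity>" unfolding 1 2 by simp
  finally have "2 * (\<integral>\<^sup>+t. ennreal (?h t) * indicator {0<..} t \<partial>lborel) < \<infinity>"
    by (simp add: ennreal_mult_less_top)
  then show ?thesis by (subst nn_integral_split_zero) auto
qed

text \<open>A substitute for polar coordinates: the radial function is the cube of |x|^(-2/3)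
  max(1,|x|)^(-2/3), and each of the three factors grows when |x| is replaced by the absolute value
  of one coordinate.\<close>

lemma rker_one_le_prod:
  fixes x :: R3
  assumes "\<And>b. b \<in> Basis \<Longrightarrow> x \<bullet> b \<noteq> 0"
  shows "rker 1 x \<le> (\<Prod>b\<in>Basis. \<bar>x \<bullet> b\<bar> powr (-2/3) * (max 1 \<bar>x \<bullet> b\<bar>) powr (-2/3))"
proof -
  obtain b0 :: R3 where b0: "b0 \<in> Basis" using nonempty_Basis by blast
  have nz: "norm x > 0" using assms[OF b0] by auto
  have c: "card (Basis :: R3 set) = 3" by simp
  have "rker 1 x = (\<Prod>b\<in>(Basis::R3 set). norm x powr (-2/3) * (max 1 (norm x)) powr (-2/3))"
    unfolding prod_constant c rker_def
    using nz by (simp add: power_mult_distrib powr_power powr_minus field_simps powr_numeral)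
  also have "\<dots> \<le> (\<Prod>b\<in>Basis. \<bar>x \<bullet> b\<bar> powr (-2/3) * (max 1 \<bar>x \<bullet> b\<bar>) powr (-2/3))"
  proof (intro prod_mono conjI mult_mono)
    fix b :: R3 assume b: "b \<in> Basis"
    have le: "\<bar>x \<bullet> b\<bar> \<le> norm x" using b by (rule Basis_le_norm)
    show "norm x powr (-2/3) \<le> \<bar>x \<bullet> b\<bar> powr (-2/3)"
      using assms[OF b] le by (intro powr_mono2') auto
    show "max 1 (norm x) powr (-2/3) \<le> max 1 \<bar>x \<bullet> b\<bar> powr (-2/3)"
      using le by (intro powr_mono2') auto
  qed auto
  finally show ?thesis .
qed

lemma rker_one_finite: "(\<integral>\<^sup>+x. ennreal (rker 1 x) \<partial>lborel) < \<infinity>"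
proof -
  let ?h = "\<lambda>t::real. \<bar>t\<bar> powr (-2/3) * (max 1 \<bar>t\<bar>) powr (-2/3)"
  \<comment> \<open>Since \<open>0 powr (-2/3) = 0\<close>, the product of the \<open>?h\<close>
    would vanish on the coordinate planes and the bound would fail there. The value
    \<open>top\<close> repairs it everywhere and changes the integrand at one point only.\<close>
  let ?H = "\<lambda>t::real. if t = 0 then top else ennreal (?h t)"
  have "(\<integral>\<^sup>+x. ennreal (rker 1 x) \<partial>lborel) \<le> (\<integral>\<^sup>+x. (\<Prod>b\<in>Basis. ?H ((x::R3) \<bullet> b)) \<partial>lborel)"
  proof (rule nn_integral_mono)
    fix x :: R3
    show "ennreal (rker 1 x) \<le> (\<Prod>b\<in>Basis. ?H (x \<bullet> b))"
    proof (cases "\<exists>b\<in>Basis. x \<bullet> b = 0")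
      case True
      then have "(\<Prod>b\<in>Basis. ?H (x \<bullet> b)) = top"
        by (subst ennreal_prod_eq_top) (auto intro!: bexI)
      then show ?thesis by simp
    next
      case False
      then have "(\<Prod>b\<in>Basis. ?H (x \<bullet> b)) = (\<Prod>b\<in>Basis. ennreal (?h (x \<bullet> b)))"
        by (intro prod.cong) auto
      also have "\<dots> = ennreal (\<Prod>b\<in>Basis. ?h (x \<bullet> b))"
        by (intro prod_ennreal) auto
      finally show ?thesis
        using False rker_one_le_prod[of x] by (auto intro!: ennreal_leI)
    qed
  qed
  also have "\<dots> = (\<Prod>b\<in>(Basis::R3 set). \<integral>\<^sup>+t. ?H t \<partial>lborel)"
    by (rule nn_integral_lborel_prod) auto
  also have "(\<integral>\<^sup>+t. ?H t \<partial>lborel) = (\<integral>\<^sup>+t. ennreal (?h t) \<partial>lborel)"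
    by (intro nn_integral_cong_AE eventually_mono[OF AE_lborel_singleton[of 0]]) auto
  also have "(\<Prod>b\<in>(Basis::R3 set). \<dots>) < \<infinity>"
    using nn_integral_powr_two_sided_finite by (simp add: power_less_top_ennreal)
  finally show ?thesis .
qed

lemma rker_mass_nonneg [simp]: "0 \<le> rker_mass"
  by (simp add: rker_mass_def)

lemma nn_integral_rker:
  assumes "0 < r"
  shows "(\<integral>\<^sup>+x. ennreal (rker r (y - x)) \<partial>lborel) = ennreal (rker_mass / r)"
proof -
  have "(\<integral>\<^sup>+x. ennreal (rker r (y - x)) \<partial>lborel)
      = ennreal (\<bar>-r\<bar> ^ DIM(R3)) * (\<integral>\<^sup>+x. ennreal (rker r (y - (y + (-r) *\<^sub>R x))) \<partial>lborel)"
    by (rule nn_integral_lborel_affine) (use assms in auto)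
  also have "(\<integral>\<^sup>+x. ennreal (rker r (y - (y + (-r) *\<^sub>R x))) \<partial>lborel)
      = (\<integral>\<^sup>+x. ennreal (1 / r ^ 4) * ennreal (rker 1 x) \<partial>lborel)"
  proof (rule nn_integral_cong)
    fix x :: R3
    have "max r (r * norm x) = r * max 1 (norm x)"
      using assms by (simp add: max_mult_distrib_left)
    then have "rker r (r *\<^sub>R x) = 1 / r ^ 4 * rker 1 x"
      using assms by (simp add: rker_def power_mult_distrib power2_eq_square power4_eq_xxxx)
    then show "ennreal (rker r (y - (y + (-r) *\<^sub>R x))) = ennreal (1 / r ^ 4) * ennreal (rker 1 x)"
      using assms by (simp add: ennreal_mult[symmetric])
  qed
  also have "\<dots> = ennreal (1 / r ^ 4) * ennreal rker_mass"
    using rker_one_finite by (simp add: nn_integral_cmult rker_mass_def ennreal_enn2real less_top[symmetric])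
  also have "ennreal (\<bar>-r\<bar> ^ DIM(R3)) * \<dots> = ennreal (rker_mass / r)"
    using assms by (simp add: ennreal_mult[symmetric] power4_eq_xxxx power3_eq_cube field_simps)
  finally show ?thesis .
qed

text \<open>Near y the bound f <= a controls the integral of 1/|y-z|; far from y, Young's inequality
  trades f/|y-z| for a^(1/5) f^(6/5), whose integral is normalised, plus |y-z|^-6 / a, which is
  integrable at infinity.\<close>

lemma HLS_inner_bound:
  fixes f :: "R3 \<Rightarrow> real"
  assumes [measurable]: "f \<in> borel_measurable borel" and f0: "\<And>x. 0 \<le> f x"
    and one: "(\<integral>\<^sup>+x. ennreal (f x powr (6/5)) \<partial>lborel) = 1" and a: "0 < a"
  shows "(\<integral>\<^sup>+z. ennreal (if f z \<le> a then f z / norm (y - z) else 0) \<partial>lborel)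
     \<le> ennreal ((1 + 2 * rker_mass) * a powr (1/5))"
proof -
  \<comment> \<open>The near part is of order a R^2 and the far part of order 1/(a R^3); this radius
    makes both equal to a^(1/5).\<close>
  define R where "R = a powr (-2/5)"
  have R: "0 < R" using a by (simp add: R_def)
  \<comment> \<open>The two coefficients with which \<open>rker R\<close> majorises the near part,
    where 1/|w| <= R/|w|^2, and the far part, where |w|^-6 <= R^-2 |w|^-4. Dividing by R, as the
    mass of \<open>rker R\<close> requires, yields 2 a^(1/5).\<close>
  define A where "A = a * R ^ 3 + 1 / (a * R\<^sup>2)"
  have A0: "0 \<le> A" using a R by (simp add: A_def)
  have pw: "(if f z \<le> a then f z / norm (y - z) else 0) \<le> A * rker R (y - z) + a powr (1/5) * f z powr (6/5)" for z
  proof (cases "f z \<le> a \<and> y \<noteq> z \<and> f z \<noteq> 0")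
    case False
    then show ?thesis using A0 by auto
  next
    case True
    define w where "w = norm (y - z)"
    have w: "0 < w" using True by (simp add: w_def)
    have fz: "0 < f z" using f0[of z] True by simp
    show ?thesis
    proof (cases "w \<le> R")
      case True': True
      have "f z / w \<le> a / w" using True w by (simp add: divide_right_mono)
      also have "\<dots> \<le> a * R / w\<^sup>2"
        using True' w a by (simp add: power2_eq_square field_simps)
      also have "\<dots> = a * R ^ 3 * rker R (y - z)"
        using True' w R by (simp add: rker_def w_def[symmetric] max_def power2_eq_square power3_eq_cube field_simps)
      also have "\<dots> \<le> A * rker R (y - z)"
        using a R by (intro mult_right_mono) (auto simp: A_def)
      finally show ?thesis using True by (simp add: w_def add_increasing2)
    next
      case False
      then have wR: "R < w" by simp
      have k: "rker R (y - z) = 1 / w ^ 4"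
        using wR by (simp add: rker_def w_def[symmetric] max_def power2_eq_square power4_eq_xxxx)
      \<comment> \<open>Young's inequality, by comparing the two factors\<close>
      have "f z / w \<le> a powr (1/5) * f z powr (6/5) + 1 / (a * w ^ 6)"
      proof (cases "1 / w \<le> (a * f z) powr (1/5)")
        case True
        have "f z / w = f z * (1 / w)" by simp
        also have "\<dots> \<le> f z * (a * f z) powr (1/5)" using True fz by (intro mult_left_mono) auto
        also have "\<dots> = a powr (1/5) * (f z powr 1 * f z powr (1/5))"
          using fz a by (simp add: powr_mult)
        also have "\<dots> = a powr (1/5) * f z powr (6/5)"
          by (subst powr_add[symmetric]) simp
        finally show ?thesis using a w by (simp add: add_increasing2)
      next
        case False
        then have "((a * f z) powr (1/5)) ^ 5 \<le> (1 / w) ^ 5" by (intro power_mono) auto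
        moreover have "((a * f z) powr (1/5)) ^ 5 = a * f z"
          using a fz by (simp add: powr_power)
        ultimately have "f z \<le> 1 / (a * w ^ 5)" using a w by (simp add: power_divide field_simps)
        then have "f z / w \<le> 1 / (a * w ^ 5) / w" using w by (intro divide_right_mono) auto
        also have "\<dots> = 1 / (a * w ^ 6)" by (simp add: power_Suc[symmetric] numeral_eq_Suc mult_ac)
        finally show ?thesis by (simp add: add_increasing)
      qed
      also have "1 / (a * w ^ 6) \<le> 1 / (a * R\<^sup>2) * rker R (y - z)"
      proof -
        have "R\<^sup>2 \<le> w\<^sup>2" using wR R by (intro power_mono) auto
        then have "a * R\<^sup>2 * w ^ 4 \<le> a * w ^ 6"
          using a w mult_right_mono[of "R\<^sup>2" "w\<^sup>2" "w ^ 4"] by (simp add: power_add[symmetric])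
        then show ?thesis using a R w unfolding k by (simp add: frac_le)
      qed
      also have "\<dots> \<le> A * rker R (y - z)"
        using a R by (intro mult_right_mono) (auto simp: A_def)
      finally show ?thesis using True by (simp add: w_def)
    qed
  qed
  have "(\<integral>\<^sup>+z. ennreal (if f z \<le> a then f z / norm (y - z) else 0) \<partial>lborel)
     \<le> (\<integral>\<^sup>+z. ennreal A * ennreal (rker R (y - z)) + ennreal (a powr (1/5)) * ennreal (f z powr (6/5)) \<partial>lborel)"
    using A0 ennreal_leI[OF pw] by (intro nn_integral_mono) (simp add: ennreal_mult)
  also have "\<dots> = ennreal A * ennreal (rker_mass / R) + ennreal (a powr (1/5))"
    using R by (simp add: nn_integral_add nn_integral_cmult nn_integral_rker one)
  also have "\<dots> = ennreal (A * (rker_mass / R) + a powr (1/5))"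
    using A0 R by (simp add: ennreal_mult[symmetric] ennreal_plus[symmetric] del: ennreal_plus)
  also have "A * (rker_mass / R) + a powr (1/5) = (1 + 2 * rker_mass) * a powr (1/5)"
  proof -
    have 1: "a * R\<^sup>2 = a powr (1/5)"
    proof -
      have "a * R\<^sup>2 = a powr 1 * a powr (-4/5)" using a by (simp add: R_def powr_power)
      also have "\<dots> = a powr (1/5)" by (subst powr_add[symmetric]) simp
      finally show ?thesis .
    qed
    have 2: "1 / (a * R ^ 3) = a powr (1/5)"
    proof -
      have "a * R ^ 3 = a powr 1 * a powr (-6/5)" using a by (simp add: R_def powr_power)
      also have "\<dots> = a powr (-(1/5))" by (subst powr_add[symmetric]) simp
      finally show ?thesis by (simp add: powr_minus_divide)
    qed
    have "A / R = a * R\<^sup>2 + 1 / (a * R ^ 3)"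
      using R a by (simp add: A_def add_divide_distrib power2_eq_square power3_eq_cube)
    then have "A / R = 2 * a powr (1/5)" unfolding 1 2 by simp
    moreover have "A * (rker_mass / R) = (A / R) * rker_mass" by simp
    ultimately have "A * (rker_mass / R) = 2 * a powr (1/5) * rker_mass" by (simp only:)
    then show ?thesis by (simp add: algebra_simps)
  qed
  finally show ?thesis .
qed


text \<open>Every x has distance at least r = |y-z|/2 from the farther of y and z, and that distance
  also dominates the nearer one. So the product is at most \<open>rker r\<close> centred at the
  nearer point, and the two masses add up to 2 \<open>rker_mass\<close> / r.\<close>

lemma rker_convolution_bound:
  fixes y z :: R3
  assumes "y \<noteq> z"
  shows "(\<integral>\<^sup>+x. ennreal (1 / ((norm (x - y))\<^sup>2 * (norm (x - z))\<^sup>2)) \<partial>lborel)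
     \<le> ennreal (4 * rker_mass / norm (y - z))"
proof -
  define r where "r = norm (y - z) / 2"
  have r: "0 < r" using assms by (simp add: r_def)
  have aux: "1 / ((norm (x - y))\<^sup>2 * (norm (x - z))\<^sup>2) \<le> rker r (y - x)"
    if le: "norm (x - y) \<le> norm (x - z)" and s: "norm (y - z) = 2 * r" for x y z :: R3
  proof (cases "x = y")
    case False
    have "norm (y - z) \<le> norm (x - y) + norm (x - z)"
      by (metis norm_minus_commute norm_triangle_sub add.commute diff_add_cancel norm_triangle_ineq add_diff_eq)
    then have "max r (norm (x - y)) \<le> norm (x - z)" using le s by simp
    then have "(max r (norm (x - y)))\<^sup>2 \<le> (norm (x - z))\<^sup>2"
      using r by (intro power_mono) auto
    moreover have "0 < (norm (x - y))\<^sup>2" "0 < (max r (norm (x - y)))\<^sup>2"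
      using False r by auto
    ultimately show ?thesis unfolding rker_def norm_minus_commute[of y x]
      by (intro frac_le mult_left_mono mult_pos_pos) auto
  qed simp
  have "1 / ((norm (x - y))\<^sup>2 * (norm (x - z))\<^sup>2) \<le> rker r (y - x) + rker r (z - x)" for x
  proof (cases "norm (x - y) \<le> norm (x - z)")
    case True
    from aux[OF this] show ?thesis by (simp add: r_def add_increasing2)
  next
    case False
    then have "norm (x - z) \<le> norm (x - y)" by simp
    from aux[OF this] show ?thesis by (simp add: r_def add_increasing norm_minus_commute mult.commute)
  qed
  then have "(\<integral>\<^sup>+x. ennreal (1 / ((norm (x - y))\<^sup>2 * (norm (x - z))\<^sup>2)) \<partial>lborel)
     \<le> (\<integral>\<^sup>+x. ennreal (rker r (y - x)) + ennreal (rker r (z - x)) \<partial>lborel)"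
    by (intro nn_integral_mono) (simp add: ennreal_plus[symmetric] ennreal_leI del: ennreal_plus)
  also have "\<dots> = ennreal (rker_mass / r) + ennreal (rker_mass / r)"
    using r by (simp add: nn_integral_add nn_integral_rker)
  also have "\<dots> = ennreal (4 * rker_mass / norm (y - z))"
    using r by (simp add: ennreal_plus[symmetric] r_def del: ennreal_plus)
  finally show ?thesis .
qed

text \<open>On the half where f z <= f y, the inner bound is applied with a = f y. It returns f y
  times f y^(1/5), that is f y^(6/5), whose integral is 1.\<close>

lemma HLS_diagonal:
  fixes f :: "R3 \<Rightarrow> real"
  assumes [measurable]: "f \<in> borel_measurable borel" and f0: "\<And>x. 0 \<le> f x"
    and one: "(\<integral>\<^sup>+x. ennreal (f x powr (6/5)) \<partial>lborel) = 1"
  shows "(\<integral>\<^sup>+y. \<integral>\<^sup>+z. ennreal (f y * f z / norm (y - z)) \<partial>lborel \<partial>lborel)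
     \<le> ennreal (2 * (1 + 2 * rker_mass))"
proof -
  define P where "P y z = (if f z \<le> f y then f y * f z / norm (y - z) else 0)" for y z
  have P0: "0 \<le> P y z" for y z using f0 by (simp add: P_def)
  have [measurable]: "(\<lambda>(y, z). P y z) \<in> borel_measurable (borel \<Otimes>\<^sub>M borel)"
    unfolding P_def case_prod_unfold by measurable
  have pw: "f y * f z / norm (y - z) \<le> P y z + P z y" for y z
    using f0 by (simp add: P_def norm_minus_commute mult.commute)
  have inner: "(\<integral>\<^sup>+z. ennreal (P y z) \<partial>lborel) \<le> ennreal (1 + 2 * rker_mass) * ennreal (f y powr (6/5))" for y
  proof (cases "f y = 0")
    case True
    then show ?thesis by (simp add: P_def if_distrib cong: if_cong)
  next
    case False
    then have fy: "0 < f y" using f0[of y] by simp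
    have "(\<integral>\<^sup>+z. ennreal (P y z) \<partial>lborel)
        = (\<integral>\<^sup>+z. ennreal (f y) * ennreal (if f z \<le> f y then f z / norm (y - z) else 0) \<partial>lborel)"
      using fy by (intro nn_integral_cong) (auto simp: P_def ennreal_mult'[symmetric])
    also have "\<dots> = ennreal (f y) * (\<integral>\<^sup>+z. ennreal (if f z \<le> f y then f z / norm (y - z) else 0) \<partial>lborel)"
      by (rule nn_integral_cmult) measurable
    also have "\<dots> \<le> ennreal (f y) * ennreal ((1 + 2 * rker_mass) * f y powr (1/5))"
      by (intro mult_left_mono HLS_inner_bound f0 one fy) auto
    also have "\<dots> = ennreal ((1 + 2 * rker_mass) * (f y powr 1 * f y powr (1/5)))"
      using fy by (simp add: ennreal_mult[symmetric] mult_ac)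
    also have "\<dots> = ennreal (1 + 2 * rker_mass) * ennreal (f y powr (6/5))"
      by (subst powr_add[symmetric]) (simp add: ennreal_mult)
    finally show ?thesis .
  qed
  have half: "(\<integral>\<^sup>+y. \<integral>\<^sup>+z. ennreal (P y z) \<partial>lborel \<partial>lborel) \<le> ennreal (1 + 2 * rker_mass)"
  proof -
    have "(\<integral>\<^sup>+y. \<integral>\<^sup>+z. ennreal (P y z) \<partial>lborel \<partial>lborel)
       \<le> (\<integral>\<^sup>+y. ennreal (1 + 2 * rker_mass) * ennreal (f y powr (6/5)) \<partial>lborel)"
      by (intro nn_integral_mono inner)
    then show ?thesis by (simp add: nn_integral_cmult one)
  qed
  have "(\<integral>\<^sup>+y. \<integral>\<^sup>+z. ennreal (f y * f z / norm (y - z)) \<partial>lborel \<partial>lborel)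
     \<le> (\<integral>\<^sup>+y. \<integral>\<^sup>+z. ennreal (P y z) + ennreal (P z y) \<partial>lborel \<partial>lborel)"
    using pw P0 by (intro nn_integral_mono) (simp add: ennreal_plus[symmetric] ennreal_leI del: ennreal_plus)
  also have "\<dots> = (\<integral>\<^sup>+y. \<integral>\<^sup>+z. ennreal (P y z) \<partial>lborel \<partial>lborel) + (\<integral>\<^sup>+y. \<integral>\<^sup>+z. ennreal (P z y) \<partial>lborel \<partial>lborel)"
    by (simp add: nn_integral_add)
  also have "(\<integral>\<^sup>+y. \<integral>\<^sup>+z. ennreal (P z y) \<partial>lborel \<partial>lborel) = (\<integral>\<^sup>+y. \<integral>\<^sup>+z. ennreal (P y z) \<partial>lborel \<partial>lborel)"
    by (subst lborel_pair.Fubini') (auto simp: case_prod_unfold)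
  also have "(\<integral>\<^sup>+y. \<integral>\<^sup>+z. ennreal (P y z) \<partial>lborel \<partial>lborel) + \<dots> \<le> ennreal (1 + 2 * rker_mass) + ennreal (1 + 2 * rker_mass)"
    by (intro add_mono half)
  also have "\<dots> = ennreal (2 * (1 + 2 * rker_mass))"
    using ennreal_plus[of "1 + 2 * rker_mass" "1 + 2 * rker_mass"] by (simp del: ennreal_plus)
  finally show ?thesis .
qed

text \<open>Absolute majorant of both the Riesz convolution and its transpose. As an extended
  integral it exists without any convergence question, and its finiteness at a point is exactly the
  integrability wanted there.\<close>

definition riesz_maj :: "(R3 \<Rightarrow> 'b::euclidean_space) \<Rightarrow> R3 \<Rightarrow> ennreal" where
  "riesz_maj f x = (\<integral>\<^sup>+y. ennreal (norm (f y) / (norm (x - y))\<^sup>2) \<partial>lborel)"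

text \<open>Square root of the product of 4 \<open>rker_mass\<close>, from convolving the kernel
  with itself, and 2 (1 + 2 \<open>rker_mass\<close>), from the quadratic form.\<close>

definition HLS_const :: real where
  "HLS_const = sqrt (8 * rker_mass * (1 + 2 * rker_mass))"

lemma HLS_const_nonneg [simp]: "0 \<le> HLS_const"
  by (simp add: HLS_const_def)

lemma riesz_maj_measurable [measurable]:
  assumes [measurable]: "f \<in> borel_measurable borel"
  shows "riesz_maj f \<in> borel_measurable borel"
  unfolding riesz_maj_def[abs_def] by measurable

lemma HLS_normalized:
  fixes f :: "R3 \<Rightarrow> real"
  assumes [measurable]: "f \<in> borel_measurable borel" and f0: "\<And>x. 0 \<le> f x"
    and one: "(\<integral>\<^sup>+x. ennreal (f x powr (6/5)) \<partial>lborel) = 1"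
  shows "(\<integral>\<^sup>+x. (riesz_maj f x)\<^sup>2 \<partial>lborel) \<le> ennreal (HLS_const\<^sup>2)"
proof -
  define F where "F x y = ennreal (f y / (norm (x - y))\<^sup>2)" for x y
  have [measurable]: "(\<lambda>(x, y). F x y) \<in> borel_measurable (borel \<Otimes>\<^sub>M borel)"
    unfolding F_def case_prod_unfold by measurable
  have rm: "riesz_maj f x = (\<integral>\<^sup>+y. F x y \<partial>lborel)" for x
    using f0 by (simp add: riesz_maj_def F_def)
  have "(\<integral>\<^sup>+x. (riesz_maj f x)\<^sup>2 \<partial>lborel) = (\<integral>\<^sup>+x. \<integral>\<^sup>+y. \<integral>\<^sup>+z. F x y * F x z \<partial>lborel \<partial>lborel \<partial>lborel)"
    by (simp add: rm power2_eq_square nn_integral_cmult nn_integral_multc)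
  also have "\<dots> = (\<integral>\<^sup>+y. \<integral>\<^sup>+x. \<integral>\<^sup>+z. F x y * F x z \<partial>lborel \<partial>lborel \<partial>lborel)"
    by (rule lborel_pair.Fubini') simp
  also have "\<dots> = (\<integral>\<^sup>+y. \<integral>\<^sup>+z. \<integral>\<^sup>+x. F x y * F x z \<partial>lborel \<partial>lborel \<partial>lborel)"
    by (intro nn_integral_cong lborel_pair.Fubini') simp
  also have "\<dots> \<le> (\<integral>\<^sup>+y. \<integral>\<^sup>+z. ennreal (4 * rker_mass) * ennreal (f y * f z / norm (y - z)) \<partial>lborel \<partial>lborel)"
  \<comment> \<open>The point z = y is removed because division by zero makes the right-hand side 0
    there.\<close>
  proof (rule nn_integral_mono, rule nn_integral_mono_AE, rule eventually_mono[OF AE_lborel_singleton])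
    fix y z :: R3 assume "z \<noteq> y"
    have "(\<integral>\<^sup>+x. F x y * F x z \<partial>lborel)
        = (\<integral>\<^sup>+x. ennreal (f y * f z) * ennreal (1 / ((norm (x - y))\<^sup>2 * (norm (x - z))\<^sup>2)) \<partial>lborel)"
      using f0 by (simp add: F_def ennreal_mult'[symmetric])
    also have "\<dots> = ennreal (f y * f z) * (\<integral>\<^sup>+x. ennreal (1 / ((norm (x - y))\<^sup>2 * (norm (x - z))\<^sup>2)) \<partial>lborel)"
      by (rule nn_integral_cmult) measurable
    also have "\<dots> \<le> ennreal (f y * f z) * ennreal (4 * rker_mass / norm (y - z))"
      using \<open>z \<noteq> y\<close> by (intro mult_left_mono rker_convolution_bound) auto
    also have "\<dots> = ennreal (4 * rker_mass) * ennreal (f y * f z / norm (y - z))"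
      using f0 by (simp add: ennreal_mult'[symmetric] mult_ac)
    finally show "(\<integral>\<^sup>+x. F x y * F x z \<partial>lborel) \<le> ennreal (4 * rker_mass) * ennreal (f y * f z / norm (y - z))" .
  qed
  also have "\<dots> = ennreal (4 * rker_mass) * (\<integral>\<^sup>+y. \<integral>\<^sup>+z. ennreal (f y * f z / norm (y - z)) \<partial>lborel \<partial>lborel)"
    by (simp add: nn_integral_cmult)
  also have "\<dots> \<le> ennreal (4 * rker_mass) * ennreal (2 * (1 + 2 * rker_mass))"
    by (intro mult_left_mono HLS_diagonal f0 one) auto
  also have "\<dots> = ennreal (HLS_const\<^sup>2)"
    by (subst ennreal_mult[symmetric]) (auto simp: HLS_const_def algebra_simps)
  finally show ?thesis .
qed

theorem Hardy_Littlewood_Sobolev: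
  fixes f :: "R3 \<Rightarrow> 'b::euclidean_space"
  assumes f: "Lp_mem (6/5) f"
  shows "(\<integral>\<^sup>+x. (riesz_maj f x)\<^sup>2 \<partial>lborel) \<le> ennreal ((HLS_const * Lp_norm (6/5) f)\<^sup>2)"
proof -
  have [measurable]: "f \<in> borel_measurable borel" using f by (simp add: Lp_mem_def)
  define N where "N = Lp_norm (6/5) f"
  define I where "I = (\<integral>x. norm (f x) powr (6/5) \<partial>lborel)"
  have int: "integrable lborel (\<lambda>x. norm (f x) powr (6/5))" using f by (simp add: Lp_mem_def)
  have I0: "0 \<le> I" by (simp add: I_def)
  have NI: "N = I powr (5/6)" by (simp add: N_def Lp_norm_def I_def)
  have nnI: "(\<integral>\<^sup>+x. ennreal (norm (f x) powr (6/5)) \<partial>lborel) = ennreal I"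
    unfolding I_def by (rule nn_integral_eq_integral[OF int]) auto
  show ?thesis
  proof (cases "I = 0")
    case True
    then have "(\<integral>\<^sup>+x. ennreal (norm (f x) powr (6/5)) \<partial>lborel) = 0" using nnI by simp
    then have "AE x in lborel. ennreal (norm (f x) powr (6/5)) = 0"
      by (subst (asm) nn_integral_0_iff_AE) auto
    then have "AE x in lborel. f x = 0" by (rule eventually_mono) simp
    then have "riesz_maj f x = 0" for x
      unfolding riesz_maj_def
      by (subst nn_integral_0_iff_AE) (auto elim!: eventually_mono)
    then show ?thesis by simp
  next
    case False
    then have I: "0 < I" using I0 by simp
    then have N: "0 < N" by (simp add: NI)
    define g where "g x = norm (f x) / N" for x
    have [measurable]: "g \<in> borel_measurable borel" unfolding g_def[abs_def] by measurable
    have "(\<integral>\<^sup>+x. ennreal (g x powr (6/5)) \<partial>lborel)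
        = (\<integral>\<^sup>+x. ennreal (1 / I) * ennreal (norm (f x) powr (6/5)) \<partial>lborel)"
      using I N by (intro nn_integral_cong)
        (simp add: g_def powr_divide NI powr_powr ennreal_mult[symmetric])
    also have "\<dots> = ennreal (1 / I) * ennreal I" by (simp add: nn_integral_cmult nnI)
    also have "\<dots> = 1" using I by (simp add: ennreal_mult[symmetric])
    finally have one: "(\<integral>\<^sup>+x. ennreal (g x powr (6/5)) \<partial>lborel) = 1" .
    have rm: "riesz_maj f x = ennreal N * riesz_maj g x" for x
    proof -
      have "riesz_maj f x = (\<integral>\<^sup>+y. ennreal N * ennreal (norm (g y) / (norm (x - y))\<^sup>2) \<partial>lborel)"
        unfolding riesz_maj_def using N
        by (intro nn_integral_cong) (simp add: g_def ennreal_mult[symmetric])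
      then show ?thesis unfolding riesz_maj_def by (simp add: nn_integral_cmult)
    qed
    have "(\<integral>\<^sup>+x. (riesz_maj f x)\<^sup>2 \<partial>lborel) = (\<integral>\<^sup>+x. ennreal (N\<^sup>2) * (riesz_maj g x)\<^sup>2 \<partial>lborel)"
      using N by (simp add: rm power_mult_distrib ennreal_power)
    also have "\<dots> = ennreal (N\<^sup>2) * (\<integral>\<^sup>+x. (riesz_maj g x)\<^sup>2 \<partial>lborel)"
      by (simp add: nn_integral_cmult)
    also have "\<dots> \<le> ennreal (N\<^sup>2) * ennreal (HLS_const\<^sup>2)"
      using N by (intro mult_left_mono HLS_normalized one) (auto simp: g_def)
    also have "\<dots> = ennreal ((HLS_const * N)\<^sup>2)"
      by (simp add: ennreal_mult[symmetric] power_mult_distrib mult.commute)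
    finally show ?thesis by (simp add: N_def)
  qed
qed


section \<open>Gaussians and Bessel's inequality\<close>

text \<open>A bound uniform in a regularisation survives its removal. This is used to remove the
  Gaussian damping in Bessel's inequality and the truncation of the Riesz kernel.\<close>

lemma nn_integral_Fatou_bound:
  fixes u :: "nat \<Rightarrow> 'a \<Rightarrow> ennreal"
  assumes [measurable]: "\<And>n. u n \<in> borel_measurable M"
    and lim: "AE x in M. (\<lambda>n. u n x) \<longlonglongrightarrow> v x" and le: "\<And>n. (\<integral>\<^sup>+x. u n x \<partial>M) \<le> C"
  shows "(\<integral>\<^sup>+x. v x \<partial>M) \<le> C"
proof -
  have "(\<integral>\<^sup>+x. v x \<partial>M) = (\<integral>\<^sup>+x. liminf (\<lambda>n. u n x) \<partial>M)"
    using lim by (intro nn_integral_cong_AE) (auto elim!: eventually_mono simp: lim_imp_Liminf)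
  also have "\<dots> \<le> liminf (\<lambda>n. \<integral>\<^sup>+x. u n x \<partial>M)"
    by (rule nn_integral_liminf) simp
  also have "\<dots> \<le> C"
    using le by (intro Liminf_le) (auto intro: always_eventually)
  finally show ?thesis .
qed

text \<open>A product majorant makes every slice integrable, not merely almost every one, and yields
  all consequences of Fubini's theorem together.\<close>

lemma Fubini_dominated:
  fixes F :: "'a::euclidean_space \<Rightarrow> 'b::euclidean_space \<Rightarrow> 'c::{banach, second_countable_topology}"
  assumes m' [measurable]: "(\<lambda>(x, y). F x y) \<in> borel_measurable (borel \<Otimes>\<^sub>M borel)"
    and f: "integrable lborel f" and g: "integrable lborel g"
    and le: "\<And>x y. norm (F x y) \<le> f x * g y"
  shows "integrable (lborel \<Otimes>\<^sub>M lborel) (\<lambda>(x, y). F x y)"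
    and "(\<integral>y. \<integral>x. F x y \<partial>lborel \<partial>lborel) = (\<integral>x. \<integral>y. F x y \<partial>lborel \<partial>lborel)"
    and "\<And>x. integrable lborel (F x)" and "\<And>y. integrable lborel (\<lambda>x. F x y)"
    and "integrable lborel (\<lambda>x. \<integral>y. F x y \<partial>lborel)" and "integrable lborel (\<lambda>y. \<integral>x. F x y \<partial>lborel)"
proof -
  have [measurable]: "f \<in> borel_measurable borel" "g \<in> borel_measurable borel" using f g by auto
  have [measurable]: "\<And>x. F x \<in> borel_measurable borel" "\<And>y. (\<lambda>x. F x y) \<in> borel_measurable borel"
    using m' by measurable
  show ix: "integrable lborel (F x)" for x
    by (rule Bochner_Integration.integrable_bound[OF integrable_mult_right[OF g, of "f x"]])
       (auto intro!: AE_I2 order_trans[OF le])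
  show iy: "integrable lborel (\<lambda>x. F x y)" for y
    by (rule Bochner_Integration.integrable_bound[OF integrable_mult_left[OF f, of "g y"]])
       (auto intro!: AE_I2 order_trans[OF le])
  show i: "integrable (lborel \<Otimes>\<^sub>M lborel) (\<lambda>(x, y). F x y)"
  proof (rule lborel_pair.Fubini_integrable)
    show "(\<lambda>(x, y). F x y) \<in> borel_measurable (lborel \<Otimes>\<^sub>M lborel)" by measurable
    show "AE x in lborel. integrable lborel (\<lambda>y. case (x, y) of (x, y) \<Rightarrow> F x y)"
      using ix by simp
    have "norm (\<integral>y. norm (F x y) \<partial>lborel) \<le> norm (f x * (\<integral>y. g y \<partial>lborel))" for x
    proof -
      have "(\<integral>y. norm (F x y) \<partial>lborel) \<le> (\<integral>y. f x * g y \<partial>lborel)"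
        using ix le g by (intro integral_mono) auto
      moreover have "0 \<le> (\<integral>y. norm (F x y) \<partial>lborel)" by simp
      ultimately show ?thesis by simp
    qed
    then show "integrable lborel (\<lambda>x. \<integral>y. norm (case (x, y) of (x, y) \<Rightarrow> F x y) \<partial>lborel)"
      by (intro Bochner_Integration.integrable_bound[OF integrable_mult_left[OF f, of "\<integral>y. g y \<partial>lborel"]])
         (auto intro!: AE_I2)
  qed
  show "(\<integral>y. \<integral>x. F x y \<partial>lborel \<partial>lborel) = (\<integral>x. \<integral>y. F x y \<partial>lborel \<partial>lborel)"
    by (rule lborel_pair.Fubini_integral[OF i])
  show "integrable lborel (\<lambda>x. \<integral>y. F x y \<partial>lborel)" 
    using lborel_pair.integrable_fst[OF i] by simp
  show "integrable lborel (\<lambda>y. \<integral>x. F x y \<partial>lborel)"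
    using lborel_pair.integrable_snd[OF i] by simp
qed

lemma
  fixes f :: "'a::euclidean_space \<Rightarrow> real \<Rightarrow> complex"
  assumes f: "\<And>b. b \<in> Basis \<Longrightarrow> integrable lborel (f b)"
  shows integrable_lborel_prod: "integrable lborel (\<lambda>x. \<Prod>b\<in>Basis. f b (x \<bullet> b))"
    and integral_lborel_prod: "(\<integral>x. (\<Prod>b\<in>Basis. f b (x \<bullet> b)) \<partial>lborel) = (\<Prod>b\<in>Basis. \<integral>t. f b t \<partial>lborel)"
proof -
  interpret product_sigma_finite "\<lambda>_::'a. lborel :: real measure" by standard
  have [measurable]: "\<And>b. b \<in> Basis \<Longrightarrow> f b \<in> borel_measurable borel" using f by auto
  have T [measurable]: "(\<lambda>f. \<Sum>b\<in>(Basis::'a set). f b *\<^sub>R b) \<in> (\<Pi>\<^sub>M b\<in>Basis. lborel) \<rightarrow>\<^sub>M borel"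
    by measurable
  have eq: "(\<Prod>b\<in>Basis. f b ((\<Sum>c\<in>Basis. x c *\<^sub>R c) \<bullet> b)) = (\<Prod>b\<in>Basis. f b (x b))" for x :: "'a \<Rightarrow> real"
    by (intro prod.cong) auto
  show "integrable lborel (\<lambda>x. \<Prod>b\<in>Basis. f b (x \<bullet> b))"
    unfolding lborel_eq[where 'a='a]
    by (subst integrable_distr_eq[OF T]) (auto simp: eq intro!: product_integrable_prod f)
  show "(\<integral>x. (\<Prod>b\<in>Basis. f b (x \<bullet> b)) \<partial>lborel) = (\<Prod>b\<in>Basis. \<integral>t. f b t \<partial>lborel)"
    unfolding lborel_eq[where 'a='a]
    by (subst integral_distr[OF T]) (auto simp: eq intro!: product_integral_prod f)
qed

section \<open>Fourier transforms of Gaussians\<close>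

definition FT :: "('a::euclidean_space \<Rightarrow> complex) \<Rightarrow> 'a \<Rightarrow> complex" where
  "FT f \<eta> = (\<integral>x. f x * cis (- (x \<bullet> \<eta>)) \<partial>lborel)"

definition gauss :: "real \<Rightarrow> 'a::euclidean_space \<Rightarrow> real" where
  "gauss s x = exp (- (s * (norm x)\<^sup>2))"

lemma cis_measurable [measurable]: "cis \<in> borel_measurable borel"
  by (intro borel_measurable_continuous_onI continuous_intros)

lemma cnj_measurable [measurable]: "cnj \<in> borel_measurable borel"
  by (intro borel_measurable_continuous_onI continuous_intros)

lemma norm_square_Basis: "(norm x)\<^sup>2 = (\<Sum>b\<in>Basis. (x \<bullet> b)\<^sup>2)"
  unfolding power2_norm_eq_inner euclidean_inner[of x x] by (simp add: power2_eq_square)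

lemma gauss_measurable [measurable]: "gauss s \<in> borel_measurable borel"
  unfolding gauss_def[abs_def] by measurable

lemma gauss_nonneg [simp]: "0 \<le> gauss s x"
  by (simp add: gauss_def)

lemma gauss_minus [simp]: "gauss s (- x) = gauss s x"
  by (simp add: gauss_def)

text \<open>The substitution t = x / sqrt(2 s) turns the Gaussian into the standard normal density,
  whose characteristic function is known.\<close>

lemma gauss_real_FT:
  assumes s: "0 < s"
  shows "integrable lborel (\<lambda>t::real. complex_of_real (exp (- (s * t\<^sup>2))) * cis (- (t * e)))"
    and "(\<integral>t. complex_of_real (exp (- (s * t\<^sup>2))) * cis (- (t * e)) \<partial>lborel)
      = complex_of_real (sqrt (pi / s) * exp (- (e\<^sup>2 / (4 * s))))"
proof -
  define r where "r = sqrt (2 * s)"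
  have r: "0 < r" "r\<^sup>2 = 2 * s" using s by (auto simp: r_def)
  let ?F = "\<lambda>t::real. complex_of_real (exp (- (s * t\<^sup>2))) * cis (- (t * e))"
  have m: "integrable lborel (\<lambda>x. complex_of_real (std_normal_density x))"
    using integrable_normal_moment[of 1 0 0] by (simp add: complex_of_real_integrable_eq)
  have eq: "?F (0 + inverse r * x) = sqrt (2 * pi) *\<^sub>R (std_normal_density x *\<^sub>R iexp ((- e / r) * x))" for x
  proof -
    have "s * (inverse r * x)\<^sup>2 = x\<^sup>2 / 2"
      using r s by (simp add: power_mult_distrib power_inverse field_simps)
    moreover have "sqrt (2 * pi) * std_normal_density x = exp (- (x\<^sup>2 / 2))"
      by (simp add: std_normal_density_def)
    moreover have "iexp ((- e / r) * x) = cis (- (inverse r * x * e))"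
      by (simp add: cis_conv_exp divide_inverse mult_ac)
    moreover have "sqrt (2 * pi) *\<^sub>R (std_normal_density x *\<^sub>R z) = complex_of_real (sqrt (2 * pi) * std_normal_density x) * z" for z
      by (simp add: scaleR_conv_of_real)
    ultimately show ?thesis
      by (simp only: add_0)
  qed
  have i': "integrable lborel (\<lambda>x. std_normal_density x *\<^sub>R iexp ((- e / r) * x))"
    by (rule Bochner_Integration.integrable_bound[OF m]) (auto intro!: AE_I2 simp: norm_mult)
  have "integrable lborel (\<lambda>x. ?F (0 + inverse r * x))"
    unfolding eq by (rule integrable_scaleR_right[OF i'])
  then show "integrable lborel ?F"
    using r by (subst (asm) lborel_integrable_real_affine_iff) auto
  have "(\<integral>t. ?F t \<partial>lborel) = \<bar>inverse r\<bar> *\<^sub>R (\<integral>x. ?F (0 + inverse r * x) \<partial>lborel)"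
    using r by (intro lborel_integral_real_affine) auto
  also have "(\<integral>x. ?F (0 + inverse r * x) \<partial>lborel)
      = sqrt (2 * pi) *\<^sub>R (\<integral>x. std_normal_density x *\<^sub>R iexp ((- e / r) * x) \<partial>lborel)"
    unfolding eq by (rule integral_scaleR_right)
  also have "(\<integral>x. std_normal_density x *\<^sub>R iexp ((- e / r) * x) \<partial>lborel) = char std_normal_distribution (- e / r)"
    unfolding char_def by (subst integral_density) auto
  also have "\<dots> = complex_of_real (exp (- (e\<^sup>2 / (4 * s))))"
    using s by (simp add: char_std_normal_distribution power_divide r(2) field_simps)
  also have "\<bar>inverse r\<bar> *\<^sub>R (sqrt (2 * pi) *\<^sub>R \<dots>) = complex_of_real (sqrt (pi / s) * exp (- (e\<^sup>2 / (4 * s))))"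
  proof -
    have "inverse r * sqrt (2 * pi) = sqrt (pi / s)"
      using s by (simp add: r_def real_sqrt_mult real_sqrt_divide field_simps)
    moreover have "\<bar>inverse r\<bar> *\<^sub>R (sqrt (2 * pi) *\<^sub>R complex_of_real E)
        = complex_of_real ((inverse r * sqrt (2 * pi)) * E)" for E
      using r by (simp add: scaleR_conv_of_real)
    ultimately show ?thesis by (simp only:)
  qed
  finally show "(\<integral>t. ?F t \<partial>lborel) = complex_of_real (sqrt (pi / s) * exp (- (e\<^sup>2 / (4 * s))))" .
qed

lemma gauss_zero [simp]: "gauss s 0 = 1"
  by (simp add: gauss_def)

lemma gauss_prod_cis:
  "complex_of_real (gauss s x) * cis (- (x \<bullet> \<eta>))
    = (\<Prod>b\<in>Basis. complex_of_real (exp (- (s * (x \<bullet> b)\<^sup>2))) * cis (- ((x \<bullet> b) * (\<eta> \<bullet> b))))"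
proof -
  have "gauss s x = (\<Prod>b\<in>Basis. exp (- (s * (x \<bullet> b)\<^sup>2)))"
    by (simp add: gauss_def norm_square_Basis[of x] exp_sum[symmetric] sum_distrib_left sum_negf)
  moreover have "cis (- (x \<bullet> \<eta>)) = (\<Prod>b\<in>Basis. cis (- ((x \<bullet> b) * (\<eta> \<bullet> b))))"
    by (simp add: cis_conv_exp exp_sum[symmetric] euclidean_inner[of x \<eta>] sum_distrib_left sum_negf)
  ultimately show ?thesis by (simp add: prod.distrib)
qed

lemma gauss_FT_integrable:
  fixes \<eta> :: "'a::euclidean_space"
  assumes "0 < s"
  shows "integrable lborel (\<lambda>x. complex_of_real (gauss s x) * cis (- (x \<bullet> \<eta>)))"
  unfolding gauss_prod_cis
  by (rule integrable_lborel_prod) (rule gauss_real_FT(1)[OF assms])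

lemma gauss_integrable:
  assumes "0 < s"
  shows "integrable lborel (gauss s :: 'a::euclidean_space \<Rightarrow> real)"
  using gauss_FT_integrable[OF assms, of "0::'a"] by (simp add: complex_of_real_integrable_eq)

lemma FT_gauss:
  fixes \<eta> :: "'a::euclidean_space"
  assumes s: "0 < s"
  shows "FT (\<lambda>x. complex_of_real (gauss s x)) \<eta> = complex_of_real (sqrt (pi / s) ^ DIM('a) * gauss (1 / (4 * s)) \<eta>)"
proof -
  have "FT (\<lambda>x. complex_of_real (gauss s x)) \<eta>
     = (\<Prod>b\<in>(Basis::'a set). complex_of_real (sqrt (pi / s) * exp (- ((\<eta> \<bullet> b)\<^sup>2 / (4 * s)))))"
    unfolding FT_def gauss_prod_cis
    by (subst integral_lborel_prod) (auto simp: gauss_real_FT[OF s])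
  also have "\<dots> = complex_of_real (sqrt (pi / s) ^ DIM('a) * (\<Prod>b\<in>(Basis::'a set). exp (- ((\<eta> \<bullet> b)\<^sup>2 / (4 * s)))))"
    by (simp add: prod.distrib)
  also have "(\<Prod>b\<in>(Basis::'a set). exp (- ((\<eta> \<bullet> b)\<^sup>2 / (4 * s)))) = gauss (1 / (4 * s)) \<eta>"
    by (simp add: gauss_def norm_square_Basis[of \<eta>] exp_sum[symmetric] sum_divide_distrib sum_negf)
  finally show ?thesis .
qed

lemma gauss_integral:
  assumes "0 < s"
  shows "(\<integral>x. gauss s (x::'a::euclidean_space) \<partial>lborel) = sqrt (pi / s) ^ DIM('a)"
proof -
  have "complex_of_real (\<integral>x. gauss s (x::'a) \<partial>lborel) = FT (\<lambda>x. complex_of_real (gauss s x)) (0::'a)"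
    by (simp add: FT_def)
  also have "\<dots> = complex_of_real (sqrt (pi / s) ^ DIM('a))"
    by (simp add: FT_gauss[OF assms])
  finally show ?thesis by (simp only: of_real_eq_iff)
qed

lemma FT_measurable [measurable]:
  fixes f :: "'a::euclidean_space \<Rightarrow> complex"
  assumes [measurable]: "f \<in> borel_measurable borel"
  shows "FT f \<in> borel_measurable borel"
  unfolding FT_def[abs_def] by measurable

lemma FT_bound:
  fixes f :: "'a::euclidean_space \<Rightarrow> complex"
  shows "norm (FT f \<eta>) \<le> (\<integral>x. norm (f x) \<partial>lborel)"
proof -
  have "norm (FT f \<eta>) \<le> (\<integral>x. norm (f x * cis (- (x \<bullet> \<eta>))) \<partial>lborel)"
    unfolding FT_def by (rule integral_norm_bound)
  then show ?thesis by (simp add: norm_mult)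
qed

text \<open>Both sides are one double integral. With a Gaussian in one slot, this exchange takes the
  part of Fourier inversion below.\<close>

lemma FT_multiplication:
  fixes f h :: "'a::euclidean_space \<Rightarrow> complex"
  assumes f: "integrable lborel f" and h: "integrable lborel h"
  shows "(\<integral>\<eta>. FT f \<eta> * h \<eta> \<partial>lborel) = (\<integral>x. f x * FT h x \<partial>lborel)"
proof -
  have [measurable]: "f \<in> borel_measurable borel" "h \<in> borel_measurable borel" using f h by auto
  have "(\<integral>\<eta>. FT f \<eta> * h \<eta> \<partial>lborel) = (\<integral>\<eta>. \<integral>x. f x * h \<eta> * cis (- (x \<bullet> \<eta>)) \<partial>lborel \<partial>lborel)"
  proof (rule Bochner_Integration.integral_cong[OF refl])
    fix \<eta>
    have "FT f \<eta> * h \<eta> = (\<integral>x. f x * cis (- (x \<bullet> \<eta>)) * h \<eta> \<partial>lborel)"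
      unfolding FT_def by simp
    then show "FT f \<eta> * h \<eta> = (\<integral>x. f x * h \<eta> * cis (- (x \<bullet> \<eta>)) \<partial>lborel)" by (simp add: mult_ac)
  qed
  also have "\<dots> = (\<integral>x. \<integral>\<eta>. f x * h \<eta> * cis (- (x \<bullet> \<eta>)) \<partial>lborel \<partial>lborel)"
    by (rule Fubini_dominated(2)[OF _ integrable_norm[OF f] integrable_norm[OF h]])
       (measurable, simp add: norm_mult)
  also have "\<dots> = (\<integral>x. f x * FT h x \<partial>lborel)"
    by (simp add: FT_def mult.assoc inner_commute)
  finally show ?thesis .
qed

lemma gauss_shift_le:
  fixes x y :: "'a::euclidean_space"
  assumes s: "0 < s"
  shows "integrable lborel (\<lambda>y. gauss s (x - y))" "(\<integral>y. gauss s (x - y) \<partial>lborel) = sqrt (pi / s) ^ DIM('a)"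
proof -
  have "(\<lambda>y::'a. gauss s (x - y)) = (\<lambda>y. gauss s (- x + 1 *\<^sub>R y))"
    by (rule ext) (metis gauss_minus minus_diff_eq scaleR_one uminus_add_conv_diff)
  then show "integrable lborel (\<lambda>y. gauss s (x - y))" "(\<integral>y. gauss s (x - y) \<partial>lborel) = sqrt (pi / s) ^ DIM('a)"
    using integral_lborel_affine[of 1 "gauss s :: 'a \<Rightarrow> real" "- x", OF _ gauss_integrable[OF s]]
      gauss_integral[OF s, where 'a='a] by auto
qed

text \<open>Inserting a Gaussian turns the left-hand side into a convolution form with a positive kernel
  of total mass \<open>(2 \<pi>)\<^sup>n\<close>, to which Schur's test applies.\<close>

lemma Bessel_damped:
  fixes f :: "'a::euclidean_space \<Rightarrow> complex"
  assumes f: "integrable lborel f" and f2: "integrable lborel (\<lambda>x. (norm (f x))\<^sup>2)" and s: "0 < s"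
  shows "(\<integral>\<^sup>+\<eta>. ennreal (gauss s \<eta> * (norm (FT f \<eta>))\<^sup>2) \<partial>lborel)
     \<le> ennreal ((2 * pi) ^ DIM('a) * (\<integral>x. (norm (f x))\<^sup>2 \<partial>lborel))"
proof -
  have [measurable]: "f \<in> borel_measurable borel" using f by auto
  define N where "N = (\<integral>x. norm (f x) \<partial>lborel)"
  have N: "norm (FT f \<eta>) \<le> N" for \<eta> unfolding N_def by (rule FT_bound)
  have N0: "0 \<le> N" by (simp add: N_def)
  define c where "c = sqrt (pi / s) ^ DIM('a)"
  have c0: "0 \<le> c" using s by (simp add: c_def)
  define q where "q = 1 / (4 * s)"
  have q: "0 < q" using s by (simp add: q_def)
  \<comment> \<open>Chosen so that \<open>FT f \<eta> * h \<eta>\<close> is the damped integrand.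
    After the exchange, \<open>FT h\<close> is the conjugate of f convolved with a Gaussian, since
    the transform of a modulated Gaussian is a translated one.\<close>
  define h where "h \<eta> = complex_of_real (gauss s \<eta>) * cnj (FT f \<eta>)" for \<eta>
  have [measurable]: "h \<in> borel_measurable borel" unfolding h_def[abs_def] by measurable
  have hi: "integrable lborel h"
    by (rule Bochner_Integration.integrable_bound[OF integrable_mult_left[OF gauss_integrable[OF s], of N]])
       (use N N0 in \<open>auto intro!: AE_I2 mult_left_mono simp: h_def norm_mult\<close>)
  have FTh: "FT h x = (\<integral>y. cnj (f y) * complex_of_real (c * gauss q (x - y)) \<partial>lborel)" for x
  proof -
    define k where "k \<eta> = complex_of_real (gauss s \<eta>) * cis (\<eta> \<bullet> x)" for \<eta>
    have ki: "integrable lborel k"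
      unfolding k_def using gauss_FT_integrable[OF s, of "- x"] by simp
    have FTk: "FT k y = complex_of_real (c * gauss q (x - y))" for y
    proof -
      have "FT k y = FT (\<lambda>x. complex_of_real (gauss s x)) (y - x)"
        unfolding FT_def k_def by (simp add: mult.assoc cis_mult inner_diff_right)
      also have "\<dots> = complex_of_real (c * gauss q (x - y))"
        unfolding FT_gauss[OF s] c_def q_def by (metis gauss_minus minus_diff_eq)
      finally show ?thesis .
    qed
    have "FT h x = cnj (\<integral>\<eta>. FT f \<eta> * k \<eta> \<partial>lborel)"
      unfolding FT_def[of h] h_def k_def
      by (subst Bochner_Integration.integral_cnj[symmetric]) (simp add: cis_cnj mult_ac inner_commute)
    also have "\<dots> = cnj (\<integral>y. f y * complex_of_real (c * gauss q (x - y)) \<partial>lborel)"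
      by (subst FT_multiplication[OF f ki]) (simp add: FTk)
    finally show ?thesis by (simp flip: Bochner_Integration.integral_cnj)
  qed
  define K where "K = (\<integral>y. c * gauss q (0 - y::'a) \<partial>lborel)"
  have K: "(\<integral>y. c * gauss q (x - y) \<partial>lborel) = K" "(\<integral>y. c * gauss q (y - x) \<partial>lborel) = K" 
    "integrable lborel (\<lambda>y. c * gauss q (x - y))" "integrable lborel (\<lambda>y. c * gauss q (y - x))" for x :: 'a
  proof -
    have eq: "(\<lambda>y. gauss q (y - x)) = (\<lambda>y. gauss q (x - y))"
      by (rule ext) (metis gauss_minus minus_diff_eq)
    show "(\<integral>y. c * gauss q (x - y) \<partial>lborel) = K" "(\<integral>y. c * gauss q (y - x) \<partial>lborel) = K" 
      "integrable lborel (\<lambda>y. c * gauss q (x - y))" "integrable lborel (\<lambda>y. c * gauss q (y - x))"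
      using gauss_shift_le[OF q, of x] gauss_shift_le(2)[OF q, of "0::'a"] by (auto simp: K_def eq)
  qed
  \<comment> \<open>c carries (pi/s)^(n/2), and the Gaussian of parameter q = 1/(4s) has mass (4 pi
    s)^(n/2). The product does not depend on s, which is what allows s to tend to 0
    afterwards.\<close>
  have Kval: "K = (2 * pi) ^ DIM('a)"
  proof -
    have "K = c * sqrt (pi / q) ^ DIM('a)" unfolding K_def using gauss_shift_le(2)[OF q, of "0::'a"] by simp
    also have "\<dots> = (sqrt (pi / s) * sqrt (pi / q)) ^ DIM('a)" by (simp add: c_def power_mult_distrib)
    also have "sqrt (pi / s) * sqrt (pi / q) = 2 * pi"
      using s by (simp add: q_def real_sqrt_mult[symmetric] power2_eq_square[symmetric] real_sqrt_mult real_sqrt_divide)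
    finally show ?thesis .
  qed
  \<comment> \<open>Schur's test in its simplest form: 2|f(x)||f(y)| <= |f(x)|^2 + |f(y)|^2. In each
    summand the other variable then meets only the kernel, which integrates to K.\<close>
  have FTh_bd: "ennreal (norm (f x * FT h x)) \<le> (\<integral>\<^sup>+y. ennreal ((norm (f x))\<^sup>2 / 2 * (c * gauss q (x - y))
      + (norm (f y))\<^sup>2 / 2 * (c * gauss q (x - y))) \<partial>lborel)" for x
  proof -
    have "ennreal (norm (f x * FT h x)) = ennreal (norm (f x)) * ennreal (norm (FT h x))"
      by (simp add: norm_mult ennreal_mult)
    also have "\<dots> \<le> ennreal (norm (f x)) * (\<integral>\<^sup>+y. ennreal (norm (cnj (f y) * complex_of_real (c * gauss q (x - y)))) \<partial>lborel)"
      unfolding FTh by (intro mult_left_mono integral_norm_bound_ennreal)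
        (auto intro!: Bochner_Integration.integrable_bound[OF integrable_mult_left[OF integrable_norm[OF f], of c]]
           AE_I2 mult_left_mono mult_left_le simp: norm_mult c0 gauss_def q less_imp_le)
    also have "\<dots> = (\<integral>\<^sup>+y. ennreal (norm (f x)) * ennreal (norm (cnj (f y) * complex_of_real (c * gauss q (x - y)))) \<partial>lborel)"
      by (rule nn_integral_cmult[symmetric]) measurable
    also have "\<dots> \<le> (\<integral>\<^sup>+y. ennreal ((norm (f x))\<^sup>2 / 2 * (c * gauss q (x - y))
      + (norm (f y))\<^sup>2 / 2 * (c * gauss q (x - y))) \<partial>lborel)"
    proof (rule nn_integral_mono)
      fix y
      have "norm (f x) * norm (f y) \<le> (norm (f x))\<^sup>2 / 2 + (norm (f y))\<^sup>2 / 2"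
        using sum_squares_bound[of "norm (f x)" "norm (f y)"] by simp
      then have "norm (f x) * norm (f y) * (c * gauss q (x - y)) \<le> ((norm (f x))\<^sup>2 / 2 + (norm (f y))\<^sup>2 / 2) * (c * gauss q (x - y))"
        using c0 by (intro mult_right_mono) auto
      then show "ennreal (norm (f x)) * ennreal (norm (cnj (f y) * complex_of_real (c * gauss q (x - y))))
        \<le> ennreal ((norm (f x))\<^sup>2 / 2 * (c * gauss q (x - y)) + (norm (f y))\<^sup>2 / 2 * (c * gauss q (x - y)))"
        using c0 by (simp add: ennreal_mult[symmetric] norm_mult ennreal_leI algebra_simps del: ennreal_plus)
    qed
    finally show ?thesis .
  qed
  let ?I = "\<integral>x. (norm (f x))\<^sup>2 \<partial>lborel"
  have A1: "(\<integral>\<^sup>+x. \<integral>\<^sup>+y. ennreal ((norm (f x))\<^sup>2 / 2 * (c * gauss q (x - y))) \<partial>lborel \<partial>lborel) = ennreal (?I / 2 * K)"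
  proof -
    have "(\<integral>\<^sup>+y. ennreal ((norm (f x))\<^sup>2 / 2 * (c * gauss q (x - y))) \<partial>lborel) = ennreal ((norm (f x))\<^sup>2 / 2 * K)" for x
      using K(1,3)[of x] c0 by (subst nn_integral_eq_integral) auto
    moreover have "(\<integral>\<^sup>+x. ennreal ((norm (f x))\<^sup>2 / 2 * K) \<partial>lborel) = ennreal (?I / 2 * K)"
      using f2 by (subst nn_integral_eq_integral) (auto simp: Kval)
    ultimately show ?thesis by simp
  qed
  have A2: "(\<integral>\<^sup>+x. \<integral>\<^sup>+y. ennreal ((norm (f y))\<^sup>2 / 2 * (c * gauss q (x - y))) \<partial>lborel \<partial>lborel) = ennreal (?I / 2 * K)"
  proof -
    have "(\<integral>\<^sup>+x. ennreal ((norm (f y))\<^sup>2 / 2 * (c * gauss q (x - y))) \<partial>lborel) = ennreal ((norm (f y))\<^sup>2 / 2 * K)" for y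
      using K(2,4)[of y] c0 by (subst nn_integral_eq_integral) auto
    moreover have "(\<integral>\<^sup>+x. ennreal ((norm (f x))\<^sup>2 / 2 * K) \<partial>lborel) = ennreal (?I / 2 * K)"
      using f2 by (subst nn_integral_eq_integral) (auto simp: Kval)
    ultimately show ?thesis by (subst lborel_pair.Fubini') (auto simp: case_prod_unfold)
  qed
  have gi: "integrable lborel (\<lambda>\<eta>. gauss s \<eta> * (norm (FT f \<eta>))\<^sup>2)"
    by (rule Bochner_Integration.integrable_bound[OF integrable_mult_left[OF gauss_integrable[OF s], of "N\<^sup>2"]])
       (use N in \<open>auto intro!: AE_I2 mult_left_mono power_mono\<close>)
  have "(\<integral>\<^sup>+\<eta>. ennreal (gauss s \<eta> * (norm (FT f \<eta>))\<^sup>2) \<partial>lborel) = ennreal (\<integral>\<eta>. gauss s \<eta> * (norm (FT f \<eta>))\<^sup>2 \<partial>lborel)"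
    by (rule nn_integral_eq_integral[OF gi]) auto
  also have "(\<integral>\<eta>. gauss s \<eta> * (norm (FT f \<eta>))\<^sup>2 \<partial>lborel) = norm (\<integral>\<eta>. FT f \<eta> * h \<eta> \<partial>lborel)"
  proof -
    have "FT f \<eta> * h \<eta> = complex_of_real (gauss s \<eta> * (norm (FT f \<eta>))\<^sup>2)" for \<eta>
      unfolding h_def by (simp add: complex_norm_square[of "FT f \<eta>"] mult_ac del: of_real_power)
    then have "(\<integral>\<eta>. FT f \<eta> * h \<eta> \<partial>lborel) = complex_of_real (\<integral>\<eta>. gauss s \<eta> * (norm (FT f \<eta>))\<^sup>2 \<partial>lborel)"
      by (simp del: of_real_mult)
    then show ?thesis by (simp add: abs_of_nonneg)
  qed
  also have "(\<integral>\<eta>. FT f \<eta> * h \<eta> \<partial>lborel) = (\<integral>x. f x * FT h x \<partial>lborel)"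
    by (rule FT_multiplication[OF f hi])
  also have "ennreal (norm \<dots>) \<le> (\<integral>\<^sup>+x. ennreal (norm (f x * FT h x)) \<partial>lborel)"
  proof (rule integral_norm_bound_ennreal)
    show "integrable lborel (\<lambda>x. f x * FT h x)"
      by (rule Bochner_Integration.integrable_bound[OF integrable_mult_left[OF f, of "complex_of_real (\<integral>x. norm (h x) \<partial>lborel)"]])
         (auto intro!: AE_I2 mult_left_mono FT_bound simp: norm_mult)
  qed
  also have "\<dots> \<le> (\<integral>\<^sup>+x. \<integral>\<^sup>+y. ennreal ((norm (f x))\<^sup>2 / 2 * (c * gauss q (x - y))
      + (norm (f y))\<^sup>2 / 2 * (c * gauss q (x - y))) \<partial>lborel \<partial>lborel)"
    by (intro nn_integral_mono FTh_bd)
  also have "\<dots> = (\<integral>\<^sup>+x. \<integral>\<^sup>+y. ennreal ((norm (f x))\<^sup>2 / 2 * (c * gauss q (x - y))) \<partial>lborel \<partial>lborel)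
      + (\<integral>\<^sup>+x. \<integral>\<^sup>+y. ennreal ((norm (f y))\<^sup>2 / 2 * (c * gauss q (x - y))) \<partial>lborel \<partial>lborel)"
    using c0 by (simp add: nn_integral_add)
  also have "\<dots> = ennreal (?I / 2 * K) + ennreal (?I / 2 * K)"
    unfolding A1 A2 ..
  also have "\<dots> = ennreal ((2 * pi) ^ DIM('a) * ?I)"
    by (subst ennreal_plus[symmetric]) (auto simp: Kval)
  finally show ?thesis .
qed

text \<open>Limit of the damped inequality as the Gaussian tends to 1. Integrability of f makes
  \<open>FT f\<close> a genuine integral; the factor (2 pi)^n reflects that \<open>FT\<close> is not
  normalised.\<close>

theorem Bessel:
  fixes f :: "'a::euclidean_space \<Rightarrow> complex"
  assumes f: "integrable lborel f" and f2: "Lp_mem 2 f"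
  shows "(\<integral>\<^sup>+\<eta>. ennreal ((norm (FT f \<eta>))\<^sup>2) \<partial>lborel) \<le> ennreal ((2 * pi) ^ DIM('a) * (Lp_norm 2 f)\<^sup>2)"
proof -
  have [measurable]: "f \<in> borel_measurable borel" using f by auto
  have sq: "(Lp_norm 2 f)\<^sup>2 = (\<integral>x. (norm (f x))\<^sup>2 \<partial>lborel)" by (simp add: L2_norm_eq)
  have f2': "integrable lborel (\<lambda>x. (norm (f x))\<^sup>2)" using f2 by (simp add: L2_mem_iff)
  define s where "s n = inverse (real (Suc n))" for n
  have s: "0 < s n" "s \<longlonglongrightarrow> 0" for n
    unfolding s_def using LIMSEQ_inverse_real_of_nat by auto
  show ?thesis
  proof (rule nn_integral_Fatou_bound)
    show "AE \<eta> in lborel. (\<lambda>n. ennreal (gauss (s n) \<eta> * (norm (FT f \<eta>))\<^sup>2)) \<longlonglongrightarrow> ennreal ((norm (FT f \<eta>))\<^sup>2)"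
    proof (rule AE_I2, rule tendsto_ennrealI)
      fix \<eta> :: 'a
      have "(\<lambda>n. gauss (s n) \<eta> * (norm (FT f \<eta>))\<^sup>2) \<longlonglongrightarrow> exp (- (0 * (norm \<eta>)\<^sup>2)) * (norm (FT f \<eta>))\<^sup>2"
        unfolding gauss_def by (intro tendsto_intros s)
      then show "(\<lambda>n. gauss (s n) \<eta> * (norm (FT f \<eta>))\<^sup>2) \<longlonglongrightarrow> (norm (FT f \<eta>))\<^sup>2" by simp
    qed
    show "(\<integral>\<^sup>+\<eta>. ennreal (gauss (s n) \<eta> * (norm (FT f \<eta>))\<^sup>2) \<partial>lborel) \<le> ennreal ((2 * pi) ^ DIM('a) * (Lp_norm 2 f)\<^sup>2)" for n
      unfolding sq by (rule Bessel_damped[OF f f2' s(1)])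
  qed simp
qed


section \<open>Test functions\<close>

text \<open>The direction comes first so that the derivative is an operator on functions and can be
  iterated.\<close>

definition dd :: "'a::euclidean_space \<Rightarrow> ('a \<Rightarrow> 'b::real_normed_vector) \<Rightarrow> 'a \<Rightarrow> 'b" where
  "dd h f x = frechet_derivative f (at x) h"

lemma frechet_derivative_eq_dd: "(\<lambda>x. frechet_derivative f (at x) h) = dd h f"
  by (simp add: dd_def fun_eq_iff)

lemma test_function_derivative:
  "test_function f \<Longrightarrow> (f has_derivative (\<lambda>h. dd h f x)) (at x)"
  unfolding test_function_def dd_def
  by (metis Ck.simps(2) frechet_derivative_works)

lemma test_function_continuous: "test_function f \<Longrightarrow> continuous_on UNIV f"
  unfolding test_function_def by (metis Ck.simps(1))

lemma test_function_dd:
  fixes f :: "'a::euclidean_space \<Rightarrow> 'b::real_normed_vector"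
  assumes f: "test_function f"
  shows "test_function (dd h f)"
proof -
  have "Ck n (dd h f)" for n
    using f unfolding test_function_def frechet_derivative_eq_dd[symmetric] by (metis Ck.simps(2))
  moreover have "{x. dd h f x \<noteq> 0} \<subseteq> closure {x. f x \<noteq> 0}"
  proof (intro subsetI, rule ccontr)
    fix x assume x: "x \<in> {x. dd h f x \<noteq> 0}" and nx: "x \<notin> closure {x. f x \<noteq> 0}"
    let ?S = "- closure {x. f x \<noteq> 0}"
    have z: "f y = 0" if "y \<in> ?S" for y
      using that closure_subset[of "{x. f x \<noteq> 0}"] by auto
    have "(f has_derivative (\<lambda>h. 0)) (at x)"
    proof (rule has_derivative_transform_within_open[where s="?S", OF has_derivative_const[of 0]])
      show "x \<in> ?S" using nx by simp
    qed (simp_all only: z open_Compl closed_closure)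
    then have "dd h f x = 0"
      by (simp add: dd_def frechet_derivative_at[symmetric])
    with x show False by simp
  qed
  then have "closure {x. dd h f x \<noteq> 0} \<subseteq> closure {x. f x \<noteq> 0}"
    by (simp add: closure_minimal)
  then have "compact (closure {x. dd h f x \<noteq> 0})"
    using f unfolding test_function_def compact_eq_bounded_closed
    by (metis bounded_subset closed_closure)
  ultimately show ?thesis by (simp add: test_function_def)
qed

lemma test_function_bounds:
  fixes f :: "'a::euclidean_space \<Rightarrow> 'b::real_normed_vector"
  assumes f: "test_function f"
  obtains B R where "0 \<le> B" "0 < R" "\<And>x. norm (f x) \<le> B * indicator (cball 0 R) x"
proof -
  have c: "compact (closure {x. f x \<noteq> 0})" using f by (simp add: test_function_def)
  then obtain R where R: "0 < R" "\<And>x. x \<in> closure {x. f x \<noteq> 0} \<Longrightarrow> norm x \<le> R"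
    by (meson bounded_pos compact_imp_bounded)
  have "compact (f ` closure {x. f x \<noteq> 0})"
    by (intro compact_continuous_image c continuous_on_subset[OF test_function_continuous[OF f]]) auto
  then obtain B where B: "0 < B" "\<And>y. y \<in> f ` closure {x. f x \<noteq> 0} \<Longrightarrow> norm y \<le> B"
    by (meson bounded_pos compact_imp_bounded)
  have "norm (f x) \<le> B * indicator (cball 0 R) x" for x
  proof (cases "f x = 0")
    case False
    then have "x \<in> closure {x. f x \<noteq> 0}" using closure_subset[of "{x. f x \<noteq> 0}"] by auto
    then show ?thesis using R B by auto
  qed (use B in auto)
  then show ?thesis using that[of B R] B(1) R(1) by simp
qed

lemma indicator_cball_integrable:
  "integrable lborel (indicator (cball 0 R) :: 'a::euclidean_space \<Rightarrow> real)"
  by (intro integrable_real_indicator emeasure_bounded_finite) auto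

lemma test_function_measurable:
  fixes f :: "'a::euclidean_space \<Rightarrow> 'b::euclidean_space"
  shows "test_function f \<Longrightarrow> f \<in> borel_measurable borel"
  by (intro borel_measurable_continuous_onI test_function_continuous)

lemma test_function_Lp:
  fixes f :: "'a::euclidean_space \<Rightarrow> 'b::euclidean_space"
  assumes f: "test_function f" and p: "0 < p"
  shows "Lp_mem p f"
proof -
  note [measurable] = test_function_measurable[OF f]
  obtain B R where B: "0 \<le> B" "\<And>x. norm (f x) \<le> B * indicator (cball 0 R) x"
    using test_function_bounds[OF f] by metis
  have "norm (f x) powr p \<le> B powr p * indicator (cball 0 R) x" for x
    using B(2)[of x] p by (cases "x \<in> cball 0 R") (auto intro: powr_mono2)
  then have "integrable lborel (\<lambda>x. norm (f x) powr p)"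
    by (intro Bochner_Integration.integrable_bound[OF integrable_mult_right[OF indicator_cball_integrable[of R], of "B powr p"]])
       auto
  then show ?thesis by (simp add: Lp_mem_def)
qed

lemma test_function_integrable:
  fixes f :: "'a::euclidean_space \<Rightarrow> 'b::euclidean_space"
  assumes f: "test_function f"
  shows "integrable lborel f"
  using test_function_Lp[OF f, of 1] by (simp add: Lp_mem_def integrable_iff_bounded)

text \<open>Difference quotients of f have integral 0 by translation invariance. They are bounded by
  a Lipschitz constant on a fixed ball, so dominated convergence passes this to the
  derivative.\<close>

lemma integral_derivative_eq_0:
  fixes f :: "'a::euclidean_space \<Rightarrow> 'b::euclidean_space"
  assumes d: "\<And>x. (f has_derivative f' x) (at x)" and c: "continuous_on UNIV (\<lambda>x. f' x h)"
    and supp: "\<And>x. norm x > R \<Longrightarrow> f x = 0"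
  shows "(\<integral>x. f' x h \<partial>lborel) = 0"
proof -
  have fc: "continuous_on UNIV f"
    using d by (meson has_derivative_at_withinI has_derivative_continuous_on)
  have [measurable]: "f \<in> borel_measurable borel" "(\<lambda>x. f' x h) \<in> borel_measurable borel"
    using fc c by (auto intro: borel_measurable_continuous_onI)
  have z: "f' x h = 0" if "norm x > R" for x
  proof -
    have "(f has_derivative (\<lambda>h. 0)) (at x)"
      by (rule has_derivative_transform_within_open[where s="- cball 0 R", OF has_derivative_const[of 0]])
         (use that supp in \<open>auto simp: open_Compl\<close>)
    then have "f' x = (\<lambda>h. 0)" using d[of x] has_derivative_unique by blast
    then show ?thesis by simp
  qed
  have "bounded ((\<lambda>x. f' x h) ` cball 0 R)"
    by (intro compact_imp_bounded compact_continuous_image continuous_on_subset[OF c]) auto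
  then obtain B where B: "0 < B" "\<And>x. x \<in> cball 0 R \<Longrightarrow> norm (f' x h) \<le> B"
    unfolding bounded_pos by auto
  have B': "norm (f' x h) \<le> B" for x
    using B z[of x] by (cases "norm x \<le> R") (auto simp: dist_norm)
  have lip: "norm (f (x + t *\<^sub>R h) - f x) \<le> B * t" if t: "0 \<le> t" for x t
  proof -
    have "norm (f (x + t *\<^sub>R h) - f (x + 0 *\<^sub>R h)) \<le> B * norm (t - 0)"
    proof (rule differentiable_bound[of UNIV "\<lambda>t. f (x + t *\<^sub>R h)" "\<lambda>t s. f' (x + t *\<^sub>R h) (s *\<^sub>R h)"])
      fix t :: real
      show "((\<lambda>t. f (x + t *\<^sub>R h)) has_derivative (\<lambda>s. f' (x + t *\<^sub>R h) (s *\<^sub>R h))) (at t within UNIV)"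
        by (rule has_derivative_compose[where f="\<lambda>t. x + t *\<^sub>R h" and g=f, OF _ d])
           (auto intro!: derivative_eq_intros)
      have "linear (f' (x + t *\<^sub>R h))" using d has_derivative_linear by blast
      then have "f' (x + t *\<^sub>R h) (s *\<^sub>R h) = s *\<^sub>R f' (x + t *\<^sub>R h) h" for s
        by (rule linear_cmul)
      then show "onorm (\<lambda>s. f' (x + t *\<^sub>R h) (s *\<^sub>R h)) \<le> B"
        by (intro onorm_le) (simp add: mult.commute[of B] mult_left_mono B')
    qed auto
    then show ?thesis using t by simp
  qed
  define t where "t n = inverse (real (Suc n))" for n
  have t: "0 < t n" "t n \<le> 1" "t \<longlonglongrightarrow> 0" for n
    unfolding t_def using LIMSEQ_inverse_real_of_nat by (auto simp: inverse_le_1_iff)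
  define u where "u n x = inverse (t n) *\<^sub>R (f (x + t n *\<^sub>R h) - f x)" for n x
  have fi: "integrable lborel f"
  proof -
    have "bounded (f ` cball 0 R)"
      by (intro compact_imp_bounded compact_continuous_image continuous_on_subset[OF fc]) auto
    then obtain C where C: "0 < C" "\<And>x. x \<in> cball 0 R \<Longrightarrow> norm (f x) \<le> C"
      unfolding bounded_pos by auto
    have "norm (f x) \<le> C * indicator (cball 0 R) x" for x
      using C supp[of x] by (cases "norm x \<le> R") (auto simp: dist_norm)
    then show ?thesis
      by (intro Bochner_Integration.integrable_bound[OF integrable_mult_right[OF indicator_cball_integrable[of R], of C]])
        (auto intro!: AE_I2 order_trans[OF _ abs_ge_self])
  qed
  have u0: "(\<integral>x. u n x \<partial>lborel) = 0" for n
  proof -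
    have 1: "integrable lborel (\<lambda>x. f (x + t n *\<^sub>R h))" "(\<integral>x. f (x + t n *\<^sub>R h) \<partial>lborel) = (\<integral>x. f x \<partial>lborel)"
      using integral_lborel_affine[of 1 f "t n *\<^sub>R h", OF _ fi] by (auto simp: add.commute)
    show ?thesis unfolding u_def using 1 fi by simp
  qed
  have "(\<lambda>n. \<integral>x. u n x \<partial>lborel) \<longlonglongrightarrow> (\<integral>x. f' x h \<partial>lborel)"
  proof (rule integral_dominated_convergence)
    show "integrable lborel (\<lambda>x::'a. B * indicator (cball 0 (R + norm h)) x)"
      by (intro integrable_mult_right indicator_cball_integrable)
    show "AE x in lborel. norm (u n x) \<le> B * indicator (cball 0 (R + norm h)) x" for n
    proof (rule AE_I2)
      fix x
      show "norm (u n x) \<le> B * indicator (cball 0 (R + norm h)) x"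
      proof (cases "norm x \<le> R + norm h")
        case True
        have "norm (u n x) = inverse (t n) * norm (f (x + t n *\<^sub>R h) - f x)"
          using t(1)[of n] by (simp add: u_def)
        also have "\<dots> \<le> inverse (t n) * (B * t n)"
          using t(1)[of n] by (intro mult_left_mono lip) (auto simp: less_imp_le)
        also have "\<dots> = B" using t(1)[of n] by simp
        finally show ?thesis using True by simp
      next
        case False
        have "norm (t n *\<^sub>R h) \<le> norm h" using t(1,2)[of n] by (simp add: mult_left_le_one_le)
        then have "norm (x + t n *\<^sub>R h) > R"
          using False norm_triangle_ineq2[of x "- (t n *\<^sub>R h)"] by simp
        moreover have "norm x > R" using False norm_ge_zero[of h] by linarith
        ultimately show ?thesis using False by (simp add: u_def supp)
      qed
    qed
    show "AE x in lborel. (\<lambda>n. u n x) \<longlonglongrightarrow> f' x h"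
    proof (rule AE_I2)
      fix x
      have d0: "(f has_derivative f' x) (at (x + 0 *\<^sub>R h))" using d[of x] by simp
      have "((\<lambda>s. f (x + s *\<^sub>R h)) has_derivative (\<lambda>s. f' x (s *\<^sub>R h))) (at 0)"
        by (rule has_derivative_compose[where f="\<lambda>t. x + t *\<^sub>R h" and g=f, OF _ d0])
           (auto intro!: derivative_eq_intros)
      moreover have "f' x (s *\<^sub>R h) = s *\<^sub>R f' x h" for s
        using d[of x] has_derivative_linear linear_cmul by blast
      ultimately have "((\<lambda>s. f (x + s *\<^sub>R h)) has_vector_derivative f' x h) (at 0)"
        by (simp add: has_vector_derivative_def)
      then have "((\<lambda>s. inverse s *\<^sub>R (f (x + s *\<^sub>R h) - f x)) \<longlongrightarrow> f' x h) (at 0)"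
      proof (subst tendsto_iff, intro allI impI)
        fix e :: real assume "0 < e"
        then obtain r where r: "0 < r"
          "\<And>s. s \<noteq> 0 \<Longrightarrow> \<bar>s\<bar> < r \<Longrightarrow> norm (f (x + s *\<^sub>R h) - f x - s *\<^sub>R f' x h) / \<bar>s\<bar> < e"
          using \<open>((\<lambda>s. f (x + s *\<^sub>R h)) has_vector_derivative f' x h) (at 0)\<close>
          by (auto simp: has_vector_derivative_def has_derivative_at')
        have "dist (inverse s *\<^sub>R (f (x + s *\<^sub>R h) - f x)) (f' x h) < e" if "s \<noteq> 0" "\<bar>s\<bar> < r" for s
        proof -
          have "inverse s *\<^sub>R (f (x + s *\<^sub>R h) - f x) - f' x h
              = inverse s *\<^sub>R (f (x + s *\<^sub>R h) - f x - s *\<^sub>R f' x h)"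
            using that by (simp add: scaleR_diff_right)
          then show ?thesis using r(2)[OF that] by (simp add: dist_norm divide_inverse mult.commute)
        qed
        then show "\<forall>\<^sub>F s in at 0. dist (inverse s *\<^sub>R (f (x + s *\<^sub>R h) - f x)) (f' x h) < e"
          using r(1) by (auto simp: eventually_at)
      qed
      moreover have "filterlim t (at 0) sequentially"
        using t by (auto simp: filterlim_at intro!: always_eventually less_imp_neq[symmetric])
      ultimately show "(\<lambda>n. u n x) \<longlonglongrightarrow> f' x h"
        unfolding u_def by (rule filterlim_compose)
    qed
  qed (auto simp: u_def)
  then show ?thesis unfolding u0 by (simp add: LIMSEQ_const_iff)
qed

text \<open>The second factor needs only one continuous derivative and no decay, since the test
  function localises everything. That admits exponentials and Gaussians in its place.\<close>

lemma integration_by_parts: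
  fixes f g :: "'a::euclidean_space \<Rightarrow> complex"
  assumes f: "test_function f"
    and g: "\<And>x. (g has_derivative g' x) (at x)" and gc: "continuous_on UNIV (\<lambda>x. g' x h)"
  shows "(\<integral>x. dd h f x * g x \<partial>lborel) = - (\<integral>x. f x * g' x h \<partial>lborel)"
proof -
  have gcont: "continuous_on UNIV g"
    using g by (meson has_derivative_at_withinI has_derivative_continuous_on)
  obtain B R where B: "0 \<le> B" "0 < R" "\<And>x. norm (f x) \<le> B * indicator (cball 0 R) x"
    using test_function_bounds[OF f] by metis
  obtain B' R' where B': "0 \<le> B'" "0 < R'" "\<And>x. norm (dd h f x) \<le> B' * indicator (cball 0 R') x"
    using test_function_bounds[OF test_function_dd[OF f, of h]] by metis
  note [measurable] = test_function_measurable[OF f] test_function_measurable[OF test_function_dd[OF f, of h]]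
  have [measurable]: "g \<in> borel_measurable borel" "(\<lambda>x. g' x h) \<in> borel_measurable borel"
    using gcont gc by (auto intro: borel_measurable_continuous_onI)
  have prod_int: "integrable lborel (\<lambda>x. p x * q x)"
    if p: "\<And>x. norm (p x) \<le> C * indicator (cball 0 S) x" and pm: "p \<in> borel_measurable borel"
      and q: "continuous_on UNIV q" for p q :: "'a \<Rightarrow> complex" and C S :: real
  proof -
    have "bounded (q ` cball 0 S)"
      by (intro compact_imp_bounded compact_continuous_image continuous_on_subset[OF q]) auto
    then obtain D where D: "0 < D" "\<And>x. x \<in> cball 0 S \<Longrightarrow> norm (q x) \<le> D"
      unfolding bounded_pos by auto
    have qm: "q \<in> borel_measurable borel" using q by (rule borel_measurable_continuous_onI)
    have "norm (p x * q x) \<le> norm (C * D * indicator (cball 0 S) x)" for x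
    proof (cases "x \<in> cball 0 S")
      case True
      then have "norm (p x) * norm (q x) \<le> C * D"
        using p[of x] D(2)[OF True] by (intro mult_mono) (auto intro: order_trans[OF norm_ge_zero])
      then show ?thesis using True by (simp add: norm_mult)
    next
      case False
      then show ?thesis using p[of x] by simp
    qed
    then show ?thesis
      using pm qm by (intro Bochner_Integration.integrable_bound[OF integrable_mult_right[OF indicator_cball_integrable[of S], of "C * D"]])
        (auto intro!: AE_I2)
  qed
  have i1: "integrable lborel (\<lambda>x. dd h f x * g x)"
    by (rule prod_int[OF B'(3) _ gcont]) simp
  have i2: "integrable lborel (\<lambda>x. f x * g' x h)"
    by (rule prod_int[OF B(3) _ gc]) simp
  have "(\<integral>x. f x * g' x h + dd h f x * g x \<partial>lborel) = 0"
  proof (rule integral_derivative_eq_0[where f="\<lambda>x. f x * g x" and f'="\<lambda>x h. f x * g' x h + dd h f x * g x" and R=R])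
    show "((\<lambda>x. f x * g x) has_derivative (\<lambda>h. f x * g' x h + dd h f x * g x)) (at x)" for x
      by (rule has_derivative_mult[OF test_function_derivative[OF f] g])
    show "continuous_on UNIV (\<lambda>x. f x * g' x h + dd h f x * g x)"
      by (intro continuous_intros gc gcont test_function_continuous test_function_dd f)
    show "f x * g x = 0" if "norm x > R" for x using B(3)[of x] that by simp
  qed
  then show ?thesis using i1 i2 by (simp add: add_eq_0_iff)
qed

lemma FT_dd:
  fixes f :: "'a::euclidean_space \<Rightarrow> complex"
  assumes f: "test_function f"
  shows "FT (dd h f) \<eta> = \<i> * complex_of_real (h \<bullet> \<eta>) * FT f \<eta>"
proof -
  have "((\<lambda>x. cis (- (x \<bullet> \<eta>))) has_derivative (\<lambda>h. - (\<i> * complex_of_real (h \<bullet> \<eta>)) * cis (- (x \<bullet> \<eta>)))) (at x)" for x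
  proof -
    have "((\<lambda>x. \<i> * complex_of_real (- (x \<bullet> \<eta>))) has_derivative (\<lambda>h. \<i> * complex_of_real (- (h \<bullet> \<eta>)))) (at x)"
      by (auto intro!: derivative_eq_intros)
    from has_derivative_compose[OF this DERIV_exp[THEN has_field_derivative_imp_has_derivative]]
    show ?thesis by (simp add: cis_conv_exp mult_ac)
  qed
  moreover have "continuous_on UNIV (\<lambda>x. - (\<i> * complex_of_real (h \<bullet> \<eta>)) * cis (- (x \<bullet> \<eta>)))"
    by (intro continuous_intros)
  ultimately have "FT (dd h f) \<eta> = - (\<integral>x. f x * (- (\<i> * complex_of_real (h \<bullet> \<eta>)) * cis (- (x \<bullet> \<eta>))) \<partial>lborel)"
    unfolding FT_def by (rule integration_by_parts[OF f])
  also have "\<dots> = - (\<integral>x. - (\<i> * complex_of_real (h \<bullet> \<eta>)) * (f x * cis (- (x \<bullet> \<eta>))) \<partial>lborel)"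
    by (simp only: mult_ac)
  also have "\<dots> = \<i> * complex_of_real (h \<bullet> \<eta>) * FT f \<eta>"
    by (simp add: FT_def)
  finally show ?thesis .
qed

lemma Ck_slice:
  fixes u :: "'a::euclidean_space \<times> 'b::euclidean_space \<Rightarrow> 'c::real_normed_vector"
  assumes "\<And>n. Ck n u"
  shows "(\<lambda>v. u (y, v)) differentiable (at v)" "dd h (\<lambda>v. u (y, v)) = (\<lambda>v. dd (0, h) u (y, v))"
proof -
  have u: "(u has_derivative (\<lambda>h. dd h u z)) (at z)" for z
    using assms[of "Suc 0"] unfolding Ck.simps dd_def by (metis frechet_derivative_works)
  have d: "((\<lambda>v. u (y, v)) has_derivative (\<lambda>h. dd (0, h) u (y, v))) (at v)" for v
    by (rule has_derivative_compose[where f="\<lambda>v. (y, v)" and g=u, OF _ u])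
       (auto intro!: derivative_eq_intros)
  then show "(\<lambda>v. u (y, v)) differentiable (at v)" by (auto simp: differentiable_def)
  show "dd h (\<lambda>v. u (y, v)) = (\<lambda>v. dd (0, h) u (y, v))"
    using frechet_derivative_at[OF d] by (simp add: fun_eq_iff dd_def)
qed

text \<open>Makes Bessel's inequality and the decay estimate applicable in v for each fixed y. The
  induction varies u because a v-derivative of a slice is a slice of a derivative of u.\<close>

lemma test_function_slice:
  fixes u :: "'a::euclidean_space \<times> 'b::euclidean_space \<Rightarrow> 'c::real_normed_vector"
  assumes u: "test_function u"
  shows "test_function (\<lambda>v. u (y, v))" "dd h (\<lambda>v. u (y, v)) = (\<lambda>v. dd (0, h) u (y, v))"
proof -
  show "dd h (\<lambda>v. u (y, v)) = (\<lambda>v. dd (0, h) u (y, v))"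
    using u by (intro Ck_slice) (auto simp: test_function_def)
  have "Ck n (\<lambda>v. u (y, v))" for n
    using u
  proof (induction n arbitrary: u)
    case 0
    then show ?case
      by (auto intro!: continuous_intros continuous_on_compose2[OF test_function_continuous])
  next
    case (Suc n)
    have C: "\<And>n. Ck n u" using Suc.prems by (auto simp: test_function_def)
    show ?case
      using Ck_slice[OF C] Suc.IH[OF test_function_dd[OF Suc.prems]]
      by (simp add: frechet_derivative_eq_dd)
  qed
  moreover have "compact (closure {v. u (y, v) \<noteq> 0})"
  proof -
    obtain B R where B: "\<And>x. norm (u x) \<le> B * indicator (cball 0 R) x"
      using test_function_bounds[OF u] by metis
    have "norm v \<le> R" if "u (y, v) \<noteq> 0" for v
    proof -
      have "(y, v) \<in> cball 0 R" using B[of "(y, v)"] that by (cases "(y, v) \<in> cball 0 R") auto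
      then show ?thesis using norm_snd_le[of v y] by simp
    qed
    then have "bounded {v. u (y, v) \<noteq> 0}" by (auto simp: bounded_iff)
    then show ?thesis by simp
  qed
  ultimately show "test_function (\<lambda>v. u (y, v))" by (simp add: test_function_def)
qed

section \<open>Decay of Fourier transforms of test functions\<close>

definition decay :: "R3 \<Rightarrow> real" where
  "decay \<eta> = 1 / (1 + norm \<eta> ^ 4)"

lemma decay_nonneg [simp]: "0 \<le> decay \<eta>"
  by (simp add: decay_def)

lemma decay_integrable: "integrable lborel decay"
proof (rule integrableI_bounded)
  show "decay \<in> borel_measurable lborel" unfolding decay_def[abs_def] by measurable
  have "(\<integral>\<^sup>+\<eta>. ennreal (norm (decay \<eta>)) \<partial>lborel) \<le> (\<integral>\<^sup>+\<eta>. ennreal (rker 1 \<eta>) \<partial>lborel)"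
  proof (rule nn_integral_mono_AE, rule eventually_mono[OF AE_lborel_singleton[of 0]])
    fix \<eta> :: R3 assume nz: "\<eta> \<noteq> 0"
    have "(norm \<eta>)\<^sup>2 * (max 1 (norm \<eta>))\<^sup>2 \<le> 1 + norm \<eta> ^ 4"
    proof (cases "norm \<eta> \<le> 1")
      case True
      then show ?thesis by (simp add: max_def power_le_one add_increasing2)
    next
      case False
      then show ?thesis by (simp add: max_def power_add[symmetric])
    qed
    then have "decay \<eta> \<le> rker 1 \<eta>"
      using nz unfolding decay_def rker_def by (intro divide_left_mono mult_pos_pos) (auto simp: add_pos_nonneg)
    then show "ennreal (norm (decay \<eta>)) \<le> ennreal (rker 1 \<eta>)" by (simp add: ennreal_leI)
  qed
  then show "(\<integral>\<^sup>+\<eta>. ennreal (norm (decay \<eta>)) \<partial>lborel) < \<infinity>"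
    using rker_one_finite by (rule le_less_trans)
qed

abbreviation dd4 :: "'a::euclidean_space \<Rightarrow> ('a \<Rightarrow> 'b::real_normed_vector) \<Rightarrow> 'a \<Rightarrow> 'b" where
  "dd4 h f \<equiv> dd h (dd h (dd h (dd h f)))"

text \<open>Four derivatives along b multiply the transform by the fourth power of its b-coordinate.
  Four is the first even order above the dimension 3, so the decay is integrable. Cauchy-Schwarz
  gives |\<eta>|^4 <= 3 times the sum of the three fourth powers, hence 9 M; the undifferentiated
  bound supplies the tenth M.\<close>

lemma FT_decay:
  fixes f :: "R3 \<Rightarrow> complex"
  assumes f: "test_function f" and M0: "(\<integral>x. norm (f x) \<partial>lborel) \<le> M"
    and M4: "\<And>b. b \<in> Basis \<Longrightarrow> (\<integral>x. norm (dd4 b f x) \<partial>lborel) \<le> M"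
  shows "norm (FT f \<eta>) \<le> 10 * M * decay \<eta>"
proof -
  have b: "\<bar>\<eta> \<bullet> b\<bar> ^ 4 * norm (FT f \<eta>) \<le> M" if "b \<in> Basis" for b
  proof -
    have "FT (dd4 b f) \<eta> = (\<i> * complex_of_real (b \<bullet> \<eta>)) ^ 4 * FT f \<eta>"
      by (simp add: FT_dd f test_function_dd power4_eq_xxxx mult_ac)
    then have "norm (FT (dd4 b f) \<eta>) = \<bar>\<eta> \<bullet> b\<bar> ^ 4 * norm (FT f \<eta>)"
      by (simp add: norm_mult norm_power inner_commute)
    then show ?thesis using FT_bound[of "dd4 b f" \<eta>] M4[OF that] by simp
  qed
  have "norm \<eta> ^ 4 = ((norm \<eta>)\<^sup>2)\<^sup>2" by (simp flip: power_mult)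
  also have "(norm \<eta>)\<^sup>2 = (\<Sum>b\<in>Basis. (\<eta> \<bullet> b)\<^sup>2 * 1)" by (simp add: norm_square_Basis)
  also have "(\<Sum>b\<in>Basis. (\<eta> \<bullet> b)\<^sup>2 * 1)\<^sup>2 \<le> (\<Sum>b\<in>Basis. ((\<eta> \<bullet> b)\<^sup>2)\<^sup>2) * (\<Sum>b\<in>(Basis::R3 set). 1\<^sup>2)"
    by (rule Cauchy_Schwarz_ineq_sum)
  also have "\<dots> = 3 * (\<Sum>b\<in>Basis. \<bar>\<eta> \<bullet> b\<bar> ^ 4)"
    by (simp add: power_mult[symmetric] power_even_abs)
  finally have "norm \<eta> ^ 4 * norm (FT f \<eta>) \<le> 3 * (\<Sum>b\<in>Basis. \<bar>\<eta> \<bullet> b\<bar> ^ 4) * norm (FT f \<eta>)"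
    by (rule mult_right_mono) simp
  also have "\<dots> = 3 * (\<Sum>b\<in>Basis. \<bar>\<eta> \<bullet> b\<bar> ^ 4 * norm (FT f \<eta>))"
    by (simp add: sum_distrib_right mult.assoc)
  also have "\<dots> \<le> 3 * (\<Sum>b\<in>(Basis::R3 set). M)"
    by (intro mult_left_mono sum_mono b) auto
  finally have "norm \<eta> ^ 4 * norm (FT f \<eta>) \<le> 9 * M" by simp
  moreover have "norm (FT f \<eta>) \<le> M" using FT_bound[of f \<eta>] M0 by simp
  ultimately have "(1 + norm \<eta> ^ 4) * norm (FT f \<eta>) \<le> 10 * M" by (simp add: distrib_right)
  moreover have "0 < 1 + norm \<eta> ^ 4" by (simp add: add_pos_nonneg)
  ultimately show ?thesis by (simp add: decay_def field_simps)
qed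

lemma FT_test_function_decay:
  fixes f :: "R3 \<Rightarrow> complex"
  assumes f: "test_function f"
  obtains C where "0 \<le> C" "\<And>\<eta>. norm (FT f \<eta>) \<le> C * decay \<eta>"
proof -
  define M where "M = (\<integral>x. norm (f x) \<partial>lborel) + (\<Sum>b\<in>Basis. \<integral>x. norm (dd4 b f x) \<partial>lborel)"
  have s0: "0 \<le> (\<Sum>b\<in>(Basis::R3 set). \<integral>x. norm (dd4 b f x) \<partial>lborel)" by (intro sum_nonneg) simp
  have M: "(\<integral>x. norm (f x) \<partial>lborel) \<le> M" using s0 by (simp add: M_def)
  have "(\<integral>x. norm (dd4 b f x) \<partial>lborel) \<le> M" if "b \<in> Basis" for b
    using member_le_sum[OF that, of "\<lambda>b. \<integral>x. norm (dd4 b f x) \<partial>lborel"]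
    by (simp add: M_def add_increasing)
  from FT_decay[OF f M this] have "\<And>\<eta>. norm (FT f \<eta>) \<le> 10 * M * decay \<eta>" .
  moreover have "0 \<le> 10 * M" using s0 by (simp add: M_def)
  ultimately show ?thesis using that by blast
qed

lemma FT_slice_decay:
  fixes u :: "R3 \<times> R3 \<Rightarrow> complex"
  assumes u: "test_function u"
  obtains C R where "0 \<le> C" "\<And>y \<eta>. norm (FT (\<lambda>v. u (y, v)) \<eta>) \<le> C * indicator (cball 0 R) y * decay \<eta>"
proof -
  \<comment> \<open>u and the fourth v-derivatives form a finite family, so one bound B0 and one
    radius R0 serve all of them; this makes the decay uniform in y and confines y to a ball.\<close>
  define Z where "Z = insert u ((\<lambda>b. dd4 (0, b) u) ` (Basis :: R3 set))"
  have Zt: "test_function z" if "z \<in> Z" for z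
    using that u by (auto simp: Z_def intro!: test_function_dd)
  have "\<forall>z\<in>Z. \<exists>B R. 0 \<le> B \<and> 0 < R \<and> (\<forall>x. norm (z x) \<le> B * indicator (cball 0 R) x)"
    using test_function_bounds[OF Zt] by metis
  then obtain B R where BR: "\<And>z. z \<in> Z \<Longrightarrow> 0 \<le> B z \<and> 0 < R z \<and> (\<forall>x. norm (z x) \<le> B z * indicator (cball 0 (R z)) x)"
    by metis
  have fin: "finite Z" by (simp add: Z_def)
  define R0 where "R0 = (\<Sum>z\<in>Z. R z)"
  define B0 where "B0 = (\<Sum>z\<in>Z. B z)"
  have le: "norm (z (y, v)) \<le> B0 * indicator (cball 0 R0) y * indicator (cball 0 R0) v" if z: "z \<in> Z" for z y v
  proof (cases "norm (y, v) \<le> R z")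
    case True
    have "R z \<le> R0" unfolding R0_def using BR by (intro member_le_sum z fin) (auto simp: less_imp_le)
    then have "norm y \<le> R0" "norm v \<le> R0"
      using True norm_fst_le[of y v] norm_snd_le[of v y] by auto
    moreover have "B z \<le> B0" unfolding B0_def using BR by (intro member_le_sum z fin) auto
    moreover have "norm (z (y, v)) \<le> B z * indicator (cball 0 (R z)) (y, v)"
      using BR[OF z] by blast
    ultimately show ?thesis using True by simp
  next
    case False
    then have "norm (z (y, v)) \<le> 0" using BR[OF z] by (metis indicator_simps(2) mem_cball_0 mult_zero_right)
    moreover have "0 \<le> B0" unfolding B0_def using BR by (intro sum_nonneg) auto
    ultimately show ?thesis by (simp add: indicator_def)
  qed
  define V where "V = (\<integral>v. indicator (cball 0 R0) (v::R3) \<partial>lborel :: real)"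
  have V: "(\<integral>v. norm (z (y, v)) \<partial>lborel) \<le> B0 * indicator (cball 0 R0) y * V" if z: "z \<in> Z" for z y
  proof -
    have "(\<integral>v. norm (z (y, v)) \<partial>lborel) \<le> (\<integral>v. B0 * indicator (cball 0 R0) y * indicator (cball 0 R0) (v::R3) \<partial>lborel)"
    proof (rule integral_mono)
      show "integrable lborel (\<lambda>v. norm (z (y, v)))"
        by (intro integrable_norm test_function_integrable test_function_slice(1) Zt z)
    qed (use le[OF z] in \<open>auto intro: integrable_mult_right indicator_cball_integrable\<close>)
    then show ?thesis by (simp add: V_def)
  qed
  have "norm (FT (\<lambda>v. u (y, v)) \<eta>) \<le> 10 * (B0 * indicator (cball 0 R0) y * V) * decay \<eta>" for y \<eta>
  proof (rule FT_decay[OF test_function_slice(1)[OF u]])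
    show "(\<integral>v. norm (u (y, v)) \<partial>lborel) \<le> B0 * indicator (cball 0 R0) y * V"
      by (rule V) (simp add: Z_def)
    fix b :: R3 assume "b \<in> Basis"
    then show "(\<integral>v. norm (dd4 b (\<lambda>v. u (y, v)) v) \<partial>lborel) \<le> B0 * indicator (cball 0 R0) y * V"
      using V[of "dd4 (0, b) u" y] by (simp add: Z_def test_function_slice(2) u test_function_dd)
  qed
  moreover have "0 \<le> B0 * V" unfolding B0_def V_def using BR by (intro mult_nonneg_nonneg sum_nonneg) auto
  ultimately show ?thesis using that[of "10 * (B0 * V)" R0] by (simp add: mult_ac)
qed


section \<open>Velocity averages of \<open>\<Gamma>[E]u\<close>\<close>

lemma vec_nth_L2:
  fixes E :: "'a::euclidean_space \<Rightarrow> complex ^ 'n"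
  assumes E: "Lp_mem 2 E"
  shows "Lp_mem 2 (\<lambda>x. E x $ k)" "Lp_norm 2 (\<lambda>x. E x $ k) \<le> Lp_norm 2 E"
proof -
  note [measurable] = L2_measurable[OF E]
  have m: "(\<lambda>x. E x $ k) \<in> borel_measurable borel"
    by (rule measurable_compose[OF L2_measurable[OF E]])
       (intro borel_measurable_continuous_onI continuous_intros)
  have "(\<integral>\<^sup>+x. ennreal ((norm (E x $ k))\<^sup>2) \<partial>lborel) \<le> (\<integral>\<^sup>+x. ennreal ((norm (E x))\<^sup>2) \<partial>lborel)"
    by (intro nn_integral_mono ennreal_leI power_mono Finite_Cartesian_Product.norm_nth_le) auto
  also have "\<dots> = ennreal ((Lp_norm 2 E)\<^sup>2)" by (rule L2_nn_integral[OF E])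
  finally show "Lp_mem 2 (\<lambda>x. E x $ k)" "Lp_norm 2 (\<lambda>x. E x $ k) \<le> Lp_norm 2 E"
    using L2_nn_integral_le[OF m Lp_norm_nonneg] by auto
qed

section \<open>The symbol W\<close>

lemma W_symbol_measurable:
  assumes [measurable]: "(\<lambda>x. E x $ k) \<in> borel_measurable borel"
  shows "(\<lambda>(y, \<eta>). W_symbol E k (y, \<eta>)) \<in> borel_measurable (borel \<Otimes>\<^sub>M borel)"
  unfolding W_symbol_def set_lebesgue_integral_def by measurable

text \<open>The indicator is written twice so that Cauchy-Schwarz in r can use one copy as a factor
  of norm 1. If the defining integral diverges, its default value 0 satisfies the bound.\<close>

lemma norm_W_symbol_le:
  assumes [measurable]: "(\<lambda>x. E x $ k) \<in> borel_measurable borel"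
  shows "ennreal (norm (W_symbol E k (y, \<eta>)))
    \<le> (\<integral>\<^sup>+r. indicator {-1/2..1/2::real} r * (ennreal (norm (E (y - r *\<^sub>R \<eta>) $ k)) * indicator {-1/2..1/2} r) \<partial>lborel)"
proof (cases "integrable lborel (\<lambda>r. indicator {-1/2..1/2::real} r *\<^sub>R (E (y - r *\<^sub>R \<eta>) $ k))")
  case True
  have "ennreal (norm (W_symbol E k (y, \<eta>)))
      \<le> (\<integral>\<^sup>+r. ennreal (norm (indicator {-1/2..1/2::real} r *\<^sub>R (E (y - r *\<^sub>R \<eta>) $ k))) \<partial>lborel)"
    unfolding W_symbol_def set_lebesgue_integral_def prod.case by (rule integral_norm_bound_ennreal[OF True])
  also have "\<dots> = (\<integral>\<^sup>+r. indicator {-1/2..1/2::real} r * (ennreal (norm (E (y - r *\<^sub>R \<eta>) $ k)) * indicator {-1/2..1/2} r) \<partial>lborel)"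
    by (intro nn_integral_cong) (auto simp: indicator_def)
  finally show ?thesis .
next
  case False
  then show ?thesis
    by (simp add: W_symbol_def set_lebesgue_integral_def not_integrable_integral_eq)
qed

text \<open>For fixed \<eta>, the symbol is an average of translates of E over an r-interval of
  length 1, and translation preserves the L2 norm. The bound in y is thus uniform in \<eta>.\<close>

lemma W_symbol_L2:
  assumes E: "Lp_mem 2 (\<lambda>x. E x $ k)"
  shows "(\<integral>\<^sup>+y. (ennreal (norm (W_symbol E k (y, \<eta>))))\<^sup>2 \<partial>lborel) \<le> ennreal ((Lp_norm 2 (\<lambda>x. E x $ k))\<^sup>2)"
proof -
  note m [measurable] = L2_measurable[OF E]
  let ?I = "indicator {-1/2..1/2::real} :: real \<Rightarrow> ennreal"
  let ?e = "\<lambda>y r. ennreal (norm (E (y - r *\<^sub>R \<eta>) $ k))"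
  have I: "(\<integral>\<^sup>+r. ?I r \<partial>lborel) = 1" by simp
  have "(\<integral>\<^sup>+y. (ennreal (norm (W_symbol E k (y, \<eta>))))\<^sup>2 \<partial>lborel)
      \<le> (\<integral>\<^sup>+y. \<integral>\<^sup>+r. (?e y r)\<^sup>2 * ?I r \<partial>lborel \<partial>lborel)"
  proof (rule nn_integral_mono)
    fix y
    have "(ennreal (norm (W_symbol E k (y, \<eta>))))\<^sup>2 \<le> (\<integral>\<^sup>+r. ?I r * (?e y r * ?I r) \<partial>lborel)\<^sup>2"
      by (intro power_mono norm_W_symbol_le[OF m]) simp
    also have "\<dots> \<le> (\<integral>\<^sup>+r. (?I r)\<^sup>2 \<partial>lborel) * (\<integral>\<^sup>+r. (?e y r * ?I r)\<^sup>2 \<partial>lborel)"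
      by (rule Cauchy_Schwarz_nn_integral) measurable
    also have "(\<integral>\<^sup>+r. (?I r)\<^sup>2 \<partial>lborel) = 1"
      by (subst I[symmetric], intro nn_integral_cong) (auto simp: indicator_def)
    also have "(\<integral>\<^sup>+r. (?e y r * ?I r)\<^sup>2 \<partial>lborel) = (\<integral>\<^sup>+r. (?e y r)\<^sup>2 * ?I r \<partial>lborel)"
      by (intro nn_integral_cong) (auto simp: indicator_def)
    finally show "(ennreal (norm (W_symbol E k (y, \<eta>))))\<^sup>2 \<le> (\<integral>\<^sup>+r. (?e y r)\<^sup>2 * ?I r \<partial>lborel)" by simp
  qed
  also have "\<dots> = (\<integral>\<^sup>+r. \<integral>\<^sup>+y. (?e y r)\<^sup>2 * ?I r \<partial>lborel \<partial>lborel)"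
    by (rule lborel_pair.Fubini') measurable
  also have "\<dots> = (\<integral>\<^sup>+r. ennreal ((Lp_norm 2 (\<lambda>x. E x $ k))\<^sup>2) * ?I r \<partial>lborel)"
  proof (rule nn_integral_cong)
    fix r :: real
    have "(\<integral>\<^sup>+y. (?e y r)\<^sup>2 \<partial>lborel) = (\<integral>\<^sup>+y. ennreal ((norm (E (- (r *\<^sub>R \<eta>) + 1 *\<^sub>R y) $ k))\<^sup>2) \<partial>lborel)"
      by (intro nn_integral_cong) (simp add: ennreal_power)
    also have "\<dots> = (\<integral>\<^sup>+y. ennreal ((norm (E y $ k))\<^sup>2) \<partial>lborel)"
      using nn_integral_lborel_affine[of "\<lambda>y. ennreal ((norm (E y $ k))\<^sup>2)" 1 "- (r *\<^sub>R \<eta>)"] by simp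
    also have "\<dots> = ennreal ((Lp_norm 2 (\<lambda>x. E x $ k))\<^sup>2)" by (rule L2_nn_integral[OF E])
    finally show "(\<integral>\<^sup>+y. (?e y r)\<^sup>2 * ?I r \<partial>lborel) = ennreal ((Lp_norm 2 (\<lambda>x. E x $ k))\<^sup>2) * ?I r"
      by (subst nn_integral_multc) auto
  qed
  also have "\<dots> = ennreal ((Lp_norm 2 (\<lambda>x. E x $ k))\<^sup>2)"
    by (subst nn_integral_cmult) (auto simp: I)
  finally show ?thesis .
qed

lemma norm_W_symbol_bounded:
  assumes m: "(\<lambda>x. E x $ k) \<in> borel_measurable borel" and B: "\<And>x. norm (E x $ k) \<le> B"
  shows "norm (W_symbol E k (y, \<eta>)) \<le> B"
proof -
  have B0: "0 \<le> B" using B[of 0] norm_ge_zero order_trans by blast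
  have "ennreal (norm (W_symbol E k (y, \<eta>))) \<le> (\<integral>\<^sup>+r. ennreal B * indicator {-1/2..1/2::real} r \<partial>lborel)"
    using B by (intro order_trans[OF norm_W_symbol_le[OF m]] nn_integral_mono)
      (auto simp: indicator_def ennreal_leI)
  also have "\<dots> = ennreal B" by (subst nn_integral_cmult) auto
  finally show ?thesis using B0 by simp
qed

text \<open>Substituting y = x - s v gives the Jacobian s^-3 and turns the phase v.\<eta> into
  (x-y).\<eta>/s. The y-part is absorbed in g, and the x-part is the exponential of a transform
  evaluated at -x/s. The two normalisations of the v-transforms supply ((2 pi)^(-3/2))^2.\<close>

lemma Gamma_average_eq_FT:
  fixes k :: 3
  assumes s: "0 < s" and E: "test_function E" and u: "test_function u"
  defines "g \<equiv> \<lambda>\<eta>. \<integral>y. W_symbol E k (y, \<eta>) * FT (\<lambda>v. u (y, v)) \<eta> * cis (- ((y \<bullet> \<eta>) / s)) \<partial>lborel"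
  shows "integrable lborel g"
    and "Gamma_average s E u k x = (((2 * pi) powr (-3/2))\<^sup>2 / s ^ 3) *\<^sub>R FT g ((- 1 / s) *\<^sub>R x)"
proof -
  define c where "c = (2 * pi) powr (-3/2)"
  have E2: "Lp_mem 2 E" by (rule test_function_Lp[OF E]) simp
  note m = L2_measurable[OF vec_nth_L2(1)[OF E2]]
  have [measurable]: "(\<lambda>(y, \<eta>). W_symbol E k (y, \<eta>)) \<in> borel_measurable (borel \<Otimes>\<^sub>M borel)"
    by (rule W_symbol_measurable[OF m])
  have [measurable]: "u \<in> borel_measurable (borel \<Otimes>\<^sub>M borel)"
    using test_function_measurable[OF u] by (simp add: borel_prod)
  define U where "U y \<eta> = FT (\<lambda>v. u (y, v)) \<eta>" for y \<eta>
  have [measurable]: "(\<lambda>(y, \<eta>). U y \<eta>) \<in> borel_measurable (borel \<Otimes>\<^sub>M borel)"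
    unfolding U_def FT_def by measurable
  define P where "P y \<eta> = W_symbol E k (y, \<eta>) * U y \<eta>" for y \<eta>
  have [measurable]: "(\<lambda>(y, \<eta>). P y \<eta>) \<in> borel_measurable (borel \<Otimes>\<^sub>M borel)"
    unfolding P_def by measurable
  obtain B R0 where B: "0 \<le> B" "\<And>x. norm (E x) \<le> B * indicator (cball 0 R0) x"
    using test_function_bounds[OF E] by metis
  have "norm (E x $ k) \<le> B" for x
    using Finite_Cartesian_Product.norm_nth_le[of "E x" k] B(2)[of x] B(1) by (auto simp: indicator_def split: if_splits intro: order_trans)
  then have WB: "norm (W_symbol E k (y, \<eta>)) \<le> B" for y \<eta>
    by (rule norm_W_symbol_bounded[OF m])
  obtain C R where C: "0 \<le> C" "\<And>y \<eta>. norm (U y \<eta>) \<le> C * indicator (cball 0 R) y * decay \<eta>"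
    unfolding U_def using FT_slice_decay[OF u] by metis
  \<comment> \<open>Compact support in y together with integrable decay in \<eta> is the product
    majorant that justifies exchanging the integrals.\<close>
  have PB: "norm (P y \<eta>) \<le> B * C * indicator (cball 0 R) y * decay \<eta>" for y \<eta>
  proof -
    have "norm (P y \<eta>) \<le> B * (C * indicator (cball 0 R) y * decay \<eta>)"
      unfolding P_def norm_mult using B(1) by (intro mult_mono WB C) auto
    then show ?thesis by (simp add: mult.assoc)
  qed
  have dom: "integrable lborel (\<lambda>y::R3. B * C * indicator (cball 0 R) y)"
    by (intro integrable_mult_right indicator_cball_integrable)
  have g: "g \<eta> = (\<integral>y. P y \<eta> * cis (- ((y \<bullet> \<eta>) / s)) \<partial>lborel)" for \<eta>
    by (simp add: g_def P_def U_def)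
  show "integrable lborel g"
    unfolding g by (rule Fubini_dominated(6)[OF _ dom decay_integrable])
      (measurable, simp add: norm_mult PB)
  define F where "F y \<eta> = P y \<eta> * cis (((1 / s) *\<^sub>R (x - y)) \<bullet> \<eta>)" for y \<eta>
  have Fm: "(\<lambda>(y, \<eta>). F y \<eta>) \<in> borel_measurable (borel \<Otimes>\<^sub>M borel)"
    unfolding F_def by measurable
  have FB: "norm (F y \<eta>) \<le> B * C * indicator (cball 0 R) y * decay \<eta>" for y \<eta>
    by (simp add: F_def norm_mult PB)
  note Fub = Fubini_dominated[OF Fm dom decay_integrable FB]
  have op: "Gamma_op E u k (x - s *\<^sub>R v, v) = c\<^sup>2 *\<^sub>R (\<integral>\<eta>. F (x + (- s) *\<^sub>R v) \<eta> \<partial>lborel)" for v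
  proof -
    have "Gamma_op E u k (x - s *\<^sub>R v, v) = c *\<^sub>R (\<integral>\<eta>. c *\<^sub>R (F (x + (- s) *\<^sub>R v) \<eta>) \<partial>lborel)"
      using s by (simp add: Gamma_op_def inv_fourier_v_def fourier_v_def FT_def U_def P_def F_def c_def)
    then show ?thesis by (simp add: power2_eq_square)
  qed
  have "Gamma_average s E u k x = c\<^sup>2 *\<^sub>R (\<integral>v. (\<integral>\<eta>. F (x + (- s) *\<^sub>R v) \<eta> \<partial>lborel) \<partial>lborel)"
    unfolding Gamma_average_def op by simp
  also have "(\<integral>v. (\<integral>\<eta>. F (x + (- s) *\<^sub>R v) \<eta> \<partial>lborel) \<partial>lborel) = (1 / s ^ 3) *\<^sub>R (\<integral>y. \<integral>\<eta>. F y \<eta> \<partial>lborel \<partial>lborel)"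
    using s by (subst integral_lborel_affine(2)[OF _ Fub(5), of "- s" x]) auto
  also have "(\<integral>y. \<integral>\<eta>. F y \<eta> \<partial>lborel \<partial>lborel) = (\<integral>\<eta>. \<integral>y. F y \<eta> \<partial>lborel \<partial>lborel)"
    by (rule Fub(2)[symmetric])
  also have "\<dots> = FT g ((- 1 / s) *\<^sub>R x)"
    unfolding FT_def
  proof (rule Bochner_Integration.integral_cong[OF refl])
    fix \<eta> :: R3
    have "F y \<eta> = P y \<eta> * cis (- ((y \<bullet> \<eta>) / s)) * cis (- (\<eta> \<bullet> ((- 1 / s) *\<^sub>R x)))" for y
    proof -
      have "((1 / s) *\<^sub>R (x - y)) \<bullet> \<eta> = - ((y \<bullet> \<eta>) / s) + - (\<eta> \<bullet> ((- 1 / s) *\<^sub>R x))"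
        by (simp add: inner_diff_left inner_diff_right inner_commute diff_divide_distrib)
      then show ?thesis by (simp only: F_def cis_mult[symmetric] mult.assoc)
    qed
    then show "(\<integral>y. F y \<eta> \<partial>lborel) = g \<eta> * cis (- (\<eta> \<bullet> ((- 1 / s) *\<^sub>R x)))"
      unfolding g by simp
  qed
  finally show "Gamma_average s E u k x = (((2 * pi) powr (-3/2))\<^sup>2 / s ^ 3) *\<^sub>R FT g ((- 1 / s) *\<^sub>R x)"
    by (simp add: c_def)
qed

lemma test_function_partial_FT_L2:
  fixes u :: phase_fun
  assumes u: "test_function u"
  shows "(\<integral>\<^sup>+y. \<integral>\<^sup>+\<eta>. ennreal ((norm (FT (\<lambda>v. u (y, v)) \<eta>))\<^sup>2) \<partial>lborel \<partial>lborel)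
    \<le> ennreal ((2 * pi) ^ 3 * (Lp_norm 2 u)\<^sup>2)"
proof -
  have um [measurable]: "u \<in> borel_measurable (borel \<Otimes>\<^sub>M borel)"
    using test_function_measurable[OF u] by (simp add: borel_prod)
  have u2: "Lp_mem 2 u" by (rule test_function_Lp[OF u]) simp
  have "(\<integral>\<^sup>+y. \<integral>\<^sup>+\<eta>. ennreal ((norm (FT (\<lambda>v. u (y, v)) \<eta>))\<^sup>2) \<partial>lborel \<partial>lborel)
      \<le> (\<integral>\<^sup>+y. ennreal ((2 * pi) ^ 3) * (\<integral>\<^sup>+v. ennreal ((norm (u (y, v)))\<^sup>2) \<partial>lborel) \<partial>lborel)"
  proof (rule nn_integral_mono)
    fix y :: R3
    have t: "test_function (\<lambda>v. u (y, v))" by (rule test_function_slice(1)[OF u])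
    have t2: "Lp_mem 2 (\<lambda>v. u (y, v))" by (rule test_function_Lp[OF t]) simp
    show "(\<integral>\<^sup>+\<eta>. ennreal ((norm (FT (\<lambda>v. u (y, v)) \<eta>))\<^sup>2) \<partial>lborel)
        \<le> ennreal ((2 * pi) ^ 3) * (\<integral>\<^sup>+v. ennreal ((norm (u (y, v)))\<^sup>2) \<partial>lborel)"
      using Bessel[OF test_function_integrable[OF t] t2]
      by (simp add: L2_nn_integral[OF t2] ennreal_mult)
  qed
  also have "\<dots> = ennreal ((2 * pi) ^ 3) * (\<integral>\<^sup>+y. \<integral>\<^sup>+v. ennreal ((norm (u (y, v)))\<^sup>2) \<partial>lborel \<partial>lborel)"
    by (rule nn_integral_cmult) measurable
  also have "(\<integral>\<^sup>+y. \<integral>\<^sup>+v. ennreal ((norm (u (y, v)))\<^sup>2) \<partial>lborel \<partial>lborel)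
      = (\<integral>\<^sup>+z. ennreal ((norm (u z))\<^sup>2) \<partial>(lborel \<Otimes>\<^sub>M lborel))"
    by (rule lborel.nn_integral_fst) measurable
  also have "\<dots> = ennreal ((Lp_norm 2 u)\<^sup>2)" by (simp add: lborel_prod L2_nn_integral[OF u2])
  finally show ?thesis by (simp add: ennreal_mult)
qed

lemma powr_minus_three_halves_square:
  fixes a :: real
  assumes "0 < a"
  shows "(a powr (-3/2))\<^sup>2 = 1 / a ^ 3"
proof -
  have "(a powr (-3/2))\<^sup>2 = a powr (-3)" by (simp add: power2_eq_square flip: powr_add)
  also have "\<dots> = 1 / a powr 3" by (rule powr_minus_divide)
  finally show ?thesis using assms by simp
qed

text \<open>Cauchy-Schwarz in y separates E, since \<open>W_symbol_L2\<close> is uniform in \<eta>.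
  Bessel in v then estimates the transform of u, and Bessel in \<eta> the transform of g.\<close>

theorem Gamma_average_test_bound:
  assumes s: "0 < s" and E: "test_function E" and u: "test_function u"
  shows "(\<integral>\<^sup>+x. ennreal ((norm (Gamma_average s E u k x))\<^sup>2) \<partial>lborel)
    \<le> ennreal ((s powr (-3/2) * Lp_norm 2 E * Lp_norm 2 u)\<^sup>2)"
proof -
  define c where "c = ((2 * pi) powr (-3/2))\<^sup>2"
  have c: "c = 1 / (2 * pi) ^ 3"
    unfolding c_def by (rule powr_minus_three_halves_square) simp
  define p where "p = (2 * pi) ^ 3"
  have p: "0 < p" by (simp add: p_def)
  define g where "g = (\<lambda>\<eta>. \<integral>y. W_symbol E k (y, \<eta>) * FT (\<lambda>v. u (y, v)) \<eta> * cis (- ((y \<bullet> \<eta>) / s)) \<partial>lborel)"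
  have gi: "integrable lborel g" and G: "Gamma_average s E u k x = (c / s ^ 3) *\<^sub>R FT g ((- 1 / s) *\<^sub>R x)" for x
    using Gamma_average_eq_FT[OF s E u, of k] unfolding g_def c_def by blast+
  have [measurable]: "g \<in> borel_measurable borel" using gi by auto
  have E2: "Lp_mem 2 E" by (rule test_function_Lp[OF E]) simp
  note Ek = vec_nth_L2[OF E2, of k]
  note m [measurable] = L2_measurable[OF Ek(1)]
  have [measurable]: "(\<lambda>(y, \<eta>). W_symbol E k (y, \<eta>)) \<in> borel_measurable (borel \<Otimes>\<^sub>M borel)"
    by (rule W_symbol_measurable[OF m])
  have [measurable]: "u \<in> borel_measurable (borel \<Otimes>\<^sub>M borel)"
    using test_function_measurable[OF u] by (simp add: borel_prod)
  have [measurable]: "(\<lambda>(y, \<eta>). FT (\<lambda>v. u (y, v)) \<eta>) \<in> borel_measurable (borel \<Otimes>\<^sub>M borel)"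
    unfolding FT_def by measurable
  let ?e = "Lp_norm 2 E"
  have pw: "ennreal ((norm (g \<eta>))\<^sup>2) \<le> ennreal (?e\<^sup>2) * (\<integral>\<^sup>+y. ennreal ((norm (FT (\<lambda>v. u (y, v)) \<eta>))\<^sup>2) \<partial>lborel)" for \<eta>
  proof (cases "integrable lborel (\<lambda>y. W_symbol E k (y, \<eta>) * FT (\<lambda>v. u (y, v)) \<eta> * cis (- ((y \<bullet> \<eta>) / s)))")
    case True
    have "ennreal (norm (g \<eta>)) \<le> (\<integral>\<^sup>+y. ennreal (norm (W_symbol E k (y, \<eta>) * FT (\<lambda>v. u (y, v)) \<eta> * cis (- ((y \<bullet> \<eta>) / s)))) \<partial>lborel)"
      unfolding g_def by (rule integral_norm_bound_ennreal[OF True])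
    also have "\<dots> = (\<integral>\<^sup>+y. ennreal (norm (W_symbol E k (y, \<eta>))) * ennreal (norm (FT (\<lambda>v. u (y, v)) \<eta>)) \<partial>lborel)"
      by (simp add: norm_mult ennreal_mult)
    finally have "(ennreal (norm (g \<eta>)))\<^sup>2
        \<le> (\<integral>\<^sup>+y. ennreal (norm (W_symbol E k (y, \<eta>))) * ennreal (norm (FT (\<lambda>v. u (y, v)) \<eta>)) \<partial>lborel)\<^sup>2"
      by (rule power_mono) simp
    also have "\<dots> \<le> (\<integral>\<^sup>+y. (ennreal (norm (W_symbol E k (y, \<eta>))))\<^sup>2 \<partial>lborel) * (\<integral>\<^sup>+y. (ennreal (norm (FT (\<lambda>v. u (y, v)) \<eta>)))\<^sup>2 \<partial>lborel)"
      by (rule Cauchy_Schwarz_nn_integral) measurable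
    also have "\<dots> \<le> ennreal (?e\<^sup>2) * (\<integral>\<^sup>+y. (ennreal (norm (FT (\<lambda>v. u (y, v)) \<eta>)))\<^sup>2 \<partial>lborel)"
      using Ek(2) by (intro mult_right_mono order_trans[OF W_symbol_L2[OF Ek(1)]] ennreal_leI power_mono) auto
    finally show ?thesis by (simp add: ennreal_power)
  next
    case False
    then show ?thesis by (simp add: g_def not_integrable_integral_eq)
  qed
  have "(\<integral>\<^sup>+\<eta>. ennreal ((norm (g \<eta>))\<^sup>2) \<partial>lborel)
     \<le> (\<integral>\<^sup>+\<eta>. ennreal (?e\<^sup>2) * (\<integral>\<^sup>+y. ennreal ((norm (FT (\<lambda>v. u (y, v)) \<eta>))\<^sup>2) \<partial>lborel) \<partial>lborel)"
    by (intro nn_integral_mono pw)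
  also have "\<dots> = ennreal (?e\<^sup>2) * (\<integral>\<^sup>+\<eta>. \<integral>\<^sup>+y. ennreal ((norm (FT (\<lambda>v. u (y, v)) \<eta>))\<^sup>2) \<partial>lborel \<partial>lborel)"
    by (rule nn_integral_cmult) measurable
  also have "(\<integral>\<^sup>+\<eta>. \<integral>\<^sup>+y. ennreal ((norm (FT (\<lambda>v. u (y, v)) \<eta>))\<^sup>2) \<partial>lborel \<partial>lborel)
     = (\<integral>\<^sup>+y. \<integral>\<^sup>+\<eta>. ennreal ((norm (FT (\<lambda>v. u (y, v)) \<eta>))\<^sup>2) \<partial>lborel \<partial>lborel)"
    by (rule lborel_pair.Fubini') measurable
  also have "ennreal (?e\<^sup>2) * \<dots> \<le> ennreal (?e\<^sup>2) * ennreal (p * (Lp_norm 2 u)\<^sup>2)"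
    unfolding p_def by (intro mult_left_mono test_function_partial_FT_L2 u) simp
  also have "\<dots> = ennreal ((sqrt p * ?e * Lp_norm 2 u)\<^sup>2)"
    using p by (simp add: ennreal_mult[symmetric] power_mult_distrib mult_ac)
  finally have le: "(\<integral>\<^sup>+\<eta>. ennreal ((norm (g \<eta>))\<^sup>2) \<partial>lborel) \<le> ennreal ((sqrt p * ?e * Lp_norm 2 u)\<^sup>2)" .
  have g2: "Lp_mem 2 g" and gn: "Lp_norm 2 g \<le> sqrt p * ?e * Lp_norm 2 u"
    using L2_nn_integral_le[OF _ _ le] p by auto
  have Bg: "(\<integral>\<^sup>+\<eta>. ennreal ((norm (FT g \<eta>))\<^sup>2) \<partial>lborel) \<le> ennreal (p * (sqrt p * ?e * Lp_norm 2 u)\<^sup>2)"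
  proof -
    have "(\<integral>\<^sup>+\<eta>. ennreal ((norm (FT g \<eta>))\<^sup>2) \<partial>lborel) \<le> ennreal (p * (Lp_norm 2 g)\<^sup>2)"
      using Bessel[OF gi g2] by (simp add: p_def)
    also have "\<dots> \<le> ennreal (p * (sqrt p * ?e * Lp_norm 2 u)\<^sup>2)"
      using p gn by (intro ennreal_leI mult_left_mono power_mono) auto
    finally show ?thesis .
  qed
  have "(\<integral>\<^sup>+x. ennreal ((norm (Gamma_average s E u k x))\<^sup>2) \<partial>lborel)
      = (\<integral>\<^sup>+x. ennreal ((c / s ^ 3)\<^sup>2) * ennreal ((norm (FT g ((- 1 / s) *\<^sub>R x)))\<^sup>2) \<partial>lborel)"
    unfolding G by (simp add: power_mult_distrib ennreal_mult[symmetric] power_divide)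
  also have "\<dots> = ennreal ((c / s ^ 3)\<^sup>2) * (\<integral>\<^sup>+x. ennreal ((norm (FT g ((- 1 / s) *\<^sub>R x)))\<^sup>2) \<partial>lborel)"
    by (rule nn_integral_cmult) measurable
  also have "(\<integral>\<^sup>+x. ennreal ((norm (FT g ((- 1 / s) *\<^sub>R x)))\<^sup>2) \<partial>lborel)
      = ennreal (s ^ 3) * (\<integral>\<^sup>+\<eta>. ennreal ((norm (FT g \<eta>))\<^sup>2) \<partial>lborel)"
    using s by (subst nn_integral_lborel_affine[of _ "- s" 0]) (auto simp: power3_eq_cube field_simps)
  also have "\<dots> \<le> ennreal (s ^ 3) * ennreal (p * (sqrt p * ?e * Lp_norm 2 u)\<^sup>2)"
    by (intro mult_left_mono Bg) simp
  also have "ennreal ((c / s ^ 3)\<^sup>2) * \<dots> = ennreal ((s powr (-3/2) * ?e * Lp_norm 2 u)\<^sup>2)"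
  proof -
    \<comment> \<open>Each use of Bessel gives (2 pi)^3, cancelled by c^2. The squared amplitude
      s^-6 and the Jacobian s^3 of x -> -x/s leave s^-3.\<close>
    have "(c / s ^ 3)\<^sup>2 * (s ^ 3 * (p * (sqrt p * ?e * Lp_norm 2 u)\<^sup>2)) = (c\<^sup>2 * p\<^sup>2) * (1 / s ^ 3) * (?e * Lp_norm 2 u)\<^sup>2"
      using s p by (simp add: power_mult_distrib power_divide power2_eq_square field_simps)
    also have "c\<^sup>2 * p\<^sup>2 = 1" using p by (simp add: c p_def power_divide)
    also have "1 / s ^ 3 = (s powr (-3/2))\<^sup>2"
      by (rule powr_minus_three_halves_square[OF s, symmetric])
    finally show ?thesis using s p by (simp add: ennreal_mult[symmetric] power_mult_distrib mult_ac)
  qed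
  finally show ?thesis by (simp add: mult_left_mono)
qed

text \<open>All three norms converge along the approximating sequences, so the estimate for test
  functions passes to the limit.\<close>

theorem Gamma_average_L2_bound:
  assumes s: "0 < s" and G: "Gamma_average_L2 s E u k G"
  shows "Lp_mem 2 G" "Lp_norm 2 G \<le> s powr (-3/2) * Lp_norm 2 E * Lp_norm 2 u"
proof -
  obtain En un where t: "\<And>n. test_function (En n)" "\<And>n. test_function (un n)"
    and lim: "L2_lim En E" "L2_lim un u" "L2_lim (\<lambda>n. Gamma_average s (En n) (un n) k) G"
    using G unfolding Gamma_average_L2_def by blast
  show "Lp_mem 2 G" using lim(3) by (simp add: L2_lim_def)
  have mem: "Lp_mem 2 (Gamma_average s (En n) (un n) k)" for n using lim(3) by (simp add: L2_lim_def)
  have "Lp_norm 2 (Gamma_average s (En n) (un n) k) \<le> s powr (-3/2) * Lp_norm 2 (En n) * Lp_norm 2 (un n)" for n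
    by (rule L2_nn_integral_le(2)[OF L2_measurable[OF mem] _ Gamma_average_test_bound[OF s t]]) simp
  moreover have "(\<lambda>n. s powr (-3/2) * Lp_norm 2 (En n) * Lp_norm 2 (un n)) \<longlonglongrightarrow> s powr (-3/2) * Lp_norm 2 E * Lp_norm 2 u"
    by (intro tendsto_intros L2_lim_norm lim)
  ultimately show "Lp_norm 2 G \<le> s powr (-3/2) * Lp_norm 2 E * Lp_norm 2 u"
    by (intro LIMSEQ_le[OF L2_lim_norm[OF lim(3)]]) auto
qed


section \<open>Riesz kernels as superpositions of Gaussians\<close>

text \<open>The Gamma integral at 3/2, rescaled. Multiplied by w_j it displays the Riesz kernel
  w_j/|w|^3 as a superposition of Gaussians times w_j, up to the factor Gamma(3/2).\<close>

lemma nn_integral_sqrt_gauss: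
  assumes r: "0 < r"
  shows "(\<integral>\<^sup>+s. ennreal (indicator {0..} s * (sqrt s * exp (- (s * r\<^sup>2)))) \<partial>lborel) = ennreal (Gamma (3/2) / r ^ 3)"
proof -
  let ?f = "\<lambda>t::real. ennreal (indicator {0..} t * t powr (3/2 - 1) / exp t)"
  have "ennreal (Gamma (3/2)) = (\<integral>\<^sup>+t. ?f t \<partial>lborel)"
    by (rule Gamma_conv_nn_integral_real) simp
  also have "\<dots> = ennreal \<bar>r\<^sup>2\<bar> * (\<integral>\<^sup>+s. ?f (0 + r\<^sup>2 * s) \<partial>lborel)"
    by (rule nn_integral_real_affine) (use r in auto)
  also have "(\<integral>\<^sup>+s. ?f (0 + r\<^sup>2 * s) \<partial>lborel)
      = (\<integral>\<^sup>+s. ennreal r * ennreal (indicator {0..} s * (sqrt s * exp (- (s * r\<^sup>2)))) \<partial>lborel)"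
    using r by (intro nn_integral_cong)
      (auto simp: indicator_def powr_half_sqrt real_sqrt_mult ennreal_mult[symmetric] exp_minus
        field_simps zero_le_mult_iff)
  also have "\<dots> = ennreal r * (\<integral>\<^sup>+s. ennreal (indicator {0..} s * (sqrt s * exp (- (s * r\<^sup>2)))) \<partial>lborel)"
    by (rule nn_integral_cmult) measurable
  finally have eq: "ennreal (Gamma (3/2)) = ennreal (r ^ 3) * (\<integral>\<^sup>+s. ennreal (indicator {0..} s * (sqrt s * exp (- (s * r\<^sup>2)))) \<partial>lborel)"
    using r by (simp add: mult.assoc[symmetric] ennreal_mult[symmetric] power2_eq_square power3_eq_cube)
  have "ennreal (Gamma (3/2) / r ^ 3) = ennreal (1 / r ^ 3) * ennreal (Gamma (3/2))"
    using r by (simp add: ennreal_mult'[symmetric])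
  also have "\<dots> = ennreal (1 / r ^ 3 * r ^ 3) * (\<integral>\<^sup>+s. ennreal (indicator {0..} s * (sqrt s * exp (- (s * r\<^sup>2)))) \<partial>lborel)"
    unfolding eq using r by (subst ennreal_mult) (auto simp: mult.assoc)
  finally show ?thesis using r by simp
qed

text \<open>Staying away from 0 and infinity keeps every s-integral absolutely convergent, in
  particular that of 1/s^2 on the Fourier side. Bounds needed in the limit must not depend on
  n.\<close>

definition window :: "nat \<Rightarrow> real set" where
  "window n = {inverse (real (Suc n))..real (Suc n)}"

lemma window_pos: "s \<in> window n \<Longrightarrow> 0 < s"
  unfolding window_def by (auto intro: less_le_trans[of 0 "inverse (real (Suc n))"])

lemma window_measurable [measurable]: "window n \<in> sets borel"
  by (simp add: window_def)

lemma window_indicator_integrable: "integrable lborel (indicator (window n) :: real \<Rightarrow> real)"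
  by (rule integrable_real_indicator) (simp_all add: window_def emeasure_lborel_Icc_eq)

lemma window_eventually:
  assumes "0 < s"
  shows "eventually (\<lambda>n. s \<in> window n) sequentially"
proof -
  have "(\<lambda>n. inverse (real (Suc n))) \<longlonglongrightarrow> 0" by (rule LIMSEQ_inverse_real_of_nat)
  then have "eventually (\<lambda>n. inverse (real (Suc n)) < s) sequentially"
    using assms order_tendstoD(2) by blast
  moreover have "eventually (\<lambda>n. s \<le> real (Suc n)) sequentially"
    using filterlim_real_sequentially[unfolded filterlim_at_top]
    by (auto elim!: eventually_mono dest!: spec[of _ s])
  ultimately show ?thesis by eventually_elim (auto simp: window_def)
qed

definition trunc_kernel :: "nat \<Rightarrow> R3 \<Rightarrow> real" where
  "trunc_kernel n w = (\<integral>s. indicator (window n) s * (sqrt s * gauss s w) \<partial>lborel)"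

lemma gauss_measurable2 [measurable]: "(\<lambda>(s, w). gauss s w) \<in> borel_measurable (borel \<Otimes>\<^sub>M borel)"
  unfolding gauss_def by measurable

lemma gauss_le_1: "0 \<le> s \<Longrightarrow> gauss s w \<le> 1"
  by (simp add: gauss_def)

lemma trunc_kernel_measurable [measurable]: "trunc_kernel n \<in> borel_measurable borel"
  unfolding trunc_kernel_def[abs_def] by measurable

lemma
  assumes w: "w \<noteq> 0"
  shows trunc_kernel_le: "\<bar>trunc_kernel n w\<bar> \<le> Gamma (3/2) / norm w ^ 3"
    and trunc_kernel_lim: "(\<lambda>n. trunc_kernel n w) \<longlonglongrightarrow> Gamma (3/2) / norm w ^ 3"
proof -
  define F where "F s = indicator {0..} s * (sqrt s * gauss s w)" for s :: real
  have [measurable]: "F \<in> borel_measurable borel" unfolding F_def[abs_def] by measurable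
  have F0: "0 \<le> F s" for s by (simp add: F_def indicator_def)
  have nn: "(\<integral>\<^sup>+s. ennreal (F s) \<partial>lborel) = ennreal (Gamma (3/2) / norm w ^ 3)"
    using nn_integral_sqrt_gauss[of "norm w"] w by (simp add: F_def gauss_def)
  have G0: "0 \<le> Gamma (3/2::real) / norm w ^ 3" by (simp add: Gamma_real_nonneg)
  have Fi: "integrable lborel F"
    using F0 nn by (intro integrableI_bounded) auto
  have FI: "(\<integral>s. F s \<partial>lborel) = Gamma (3/2) / norm w ^ 3"
    using nn nn_integral_eq_integral[OF Fi] F0 G0 by (simp add: integral_nonneg_AE)
  have tk: "trunc_kernel n w = (\<integral>s. indicator (window n) s * F s \<partial>lborel)" for n
    unfolding trunc_kernel_def F_def
    by (intro Bochner_Integration.integral_cong) (auto simp: indicator_def dest: window_pos)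
  have ti: "integrable lborel (\<lambda>s. indicator (window n) s * F s)" for n
    by (rule Bochner_Integration.integrable_bound[OF Fi]) (auto simp: indicator_def)
  show "\<bar>trunc_kernel n w\<bar> \<le> Gamma (3/2) / norm w ^ 3"
  proof -
    have "0 \<le> trunc_kernel n w" unfolding tk using F0 by (intro integral_nonneg_AE) auto
    moreover have "trunc_kernel n w \<le> (\<integral>s. F s \<partial>lborel)"
      unfolding tk using F0 by (intro integral_mono ti Fi) (auto simp: indicator_def)
    ultimately show ?thesis by (simp add: FI)
  qed
  show "(\<lambda>n. trunc_kernel n w) \<longlonglongrightarrow> Gamma (3/2) / norm w ^ 3"
    unfolding tk FI[symmetric]
  proof (rule integral_dominated_convergence[OF _ _ Fi])
    show "AE s in lborel. (\<lambda>n. indicator (window n) s * F s) \<longlonglongrightarrow> F s"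
    proof (rule AE_I2)
      fix s :: real
      show "(\<lambda>n. indicator (window n) s * F s) \<longlonglongrightarrow> F s"
      proof (cases "0 < s")
        case True
        show ?thesis
          by (rule tendsto_eventually, rule eventually_mono[OF window_eventually[OF True]]) simp
      next
        case False
        then have "F s = 0" by (simp add: F_def indicator_def)
        then show ?thesis by simp
      qed
    qed
  qed (auto simp: indicator_def F0)
qed

lemma gauss_shift_derivative:
  "((\<lambda>x. complex_of_real (gauss s (x - y))) has_derivative
     (\<lambda>h. complex_of_real (- 2 * s * ((x - y) \<bullet> h) * gauss s (x - y)))) (at x)"
proof -
  have "((\<lambda>x. gauss s (x - y)) has_derivative (\<lambda>h. - 2 * s * ((x - y) \<bullet> h) * gauss s (x - y))) (at x)"
    unfolding gauss_def power2_norm_eq_inner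
    by (auto intro!: derivative_eq_intros simp: fun_eq_iff inner_commute algebra_simps)
  then show ?thesis by (rule has_derivative_of_real)
qed

text \<open>The linear factor times the Gaussian is -1/(2s) times a derivative of the Gaussian, and
  that derivative moves to the test function.\<close>

lemma gauss_moment_by_parts:
  fixes \<phi> :: "R3 \<Rightarrow> complex"
  assumes \<phi>: "test_function \<phi>" and s: "0 < s"
  shows "(\<integral>x. complex_of_real (((x - y) \<bullet> e) * gauss s (x - y)) * \<phi> x \<partial>lborel)
    = complex_of_real (1 / (2 * s)) * (\<integral>x. dd e \<phi> x * complex_of_real (gauss s (x - y)) \<partial>lborel)"
proof -
  have "(\<integral>x. dd e \<phi> x * complex_of_real (gauss s (x - y)) \<partial>lborel)
      = - (\<integral>x. \<phi> x * complex_of_real (- 2 * s * ((x - y) \<bullet> e) * gauss s (x - y)) \<partial>lborel)"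
    by (rule integration_by_parts[OF \<phi> gauss_shift_derivative])
       (auto simp: gauss_def intro!: continuous_intros)
  also have "\<dots> = - (\<integral>x. complex_of_real (- 2 * s) * (complex_of_real (((x - y) \<bullet> e) * gauss s (x - y)) * \<phi> x) \<partial>lborel)"
    by (simp add: mult_ac)
  also have "\<dots> = complex_of_real (2 * s) * (\<integral>x. complex_of_real (((x - y) \<bullet> e) * gauss s (x - y)) * \<phi> x \<partial>lborel)"
    by (subst integral_mult_right_zero) simp
  finally show ?thesis using s by simp
qed

text \<open>A translated Gaussian is itself the transform of a modulated Gaussian, so
  \<open>FT_multiplication\<close> puts the convolution on the Fourier side.\<close>

lemma gauss_convolution_FT:
  fixes \<phi> :: "R3 \<Rightarrow> complex"
  assumes \<phi>: "integrable lborel \<phi>" and s: "0 < s"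
  shows "(\<integral>x. \<phi> x * complex_of_real (gauss s (x - y)) \<partial>lborel)
    = complex_of_real (1 / sqrt (4 * pi * s) ^ 3)
       * (\<integral>\<eta>. FT \<phi> \<eta> * (complex_of_real (gauss (1 / (4 * s)) \<eta>) * cis (\<eta> \<bullet> y)) \<partial>lborel)"
proof -
  define q where "q = 1 / (4 * s)"
  have q: "0 < q" using s by (simp add: q_def)
  define c where "c = sqrt (4 * pi * s) ^ 3"
  have c: "0 < c" using s by (simp add: c_def)
  define h where "h \<eta> = complex_of_real (gauss q \<eta>) * cis (\<eta> \<bullet> y)" for \<eta> :: R3
  have hi: "integrable lborel h"
    unfolding h_def using gauss_FT_integrable[OF q, of "- y"] by simp
  have FTh: "FT h x = complex_of_real (c * gauss s (x - y))" for x
  proof -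
    have "FT h x = FT (\<lambda>x. complex_of_real (gauss q x)) (x - y)"
      unfolding FT_def h_def by (simp add: mult.assoc cis_mult inner_diff_right)
    also have "\<dots> = complex_of_real (c * gauss s (x - y))"
    proof -
      have "1 / (4 * q) = s" "pi / q = 4 * pi * s" using s by (simp_all add: q_def)
      then show ?thesis unfolding FT_gauss[OF q] by (simp add: c_def)
    qed
    finally show ?thesis .
  qed
  have "(\<integral>\<eta>. FT \<phi> \<eta> * h \<eta> \<partial>lborel) = (\<integral>x. complex_of_real c * (\<phi> x * complex_of_real (gauss s (x - y))) \<partial>lborel)"
    by (subst FT_multiplication[OF \<phi> hi]) (simp add: FTh mult_ac)
  also have "\<dots> = complex_of_real c * (\<integral>x. \<phi> x * complex_of_real (gauss s (x - y)) \<partial>lborel)"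
    by (rule integral_mult_right_zero)
  finally have "complex_of_real (1 / c) * (\<integral>\<eta>. FT \<phi> \<eta> * h \<eta> \<partial>lborel)
      = (\<integral>x. \<phi> x * complex_of_real (gauss s (x - y)) \<partial>lborel)"
    using c by simp
  then show ?thesis unfolding h_def q_def c_def by simp
qed

section \<open>The Fourier multiplier of the truncated kernel\<close>

definition trunc_mult :: "nat \<Rightarrow> R3 \<Rightarrow> real" where
  "trunc_mult n \<eta> = (\<integral>s. indicator (window n) s * (1 / s\<^sup>2 * gauss (1 / (4 * s)) \<eta>) \<partial>lborel)"

lemma window_inverse_square_integrable:
  "integrable lborel (\<lambda>s. indicator (window n) s * (1 / s\<^sup>2))"
proof (rule Bochner_Integration.integrable_bound)
  show "integrable lborel (\<lambda>s. (real (Suc n))\<^sup>2 * indicator (window n) s)"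
    by (intro integrable_mult_right window_indicator_integrable)
  have "1 / s\<^sup>2 \<le> (real (Suc n))\<^sup>2" if "s \<in> window n" for s
  proof -
    have "1 / s \<le> real (Suc n)"
      using that window_pos[OF that] by (auto simp: window_def field_simps)
    then have "(1 / s)\<^sup>2 \<le> (real (Suc n))\<^sup>2"
      using window_pos[OF that] by (intro power_mono) auto
    then show ?thesis by (simp add: power_divide)
  qed
  then show "AE s in lborel. norm (indicator (window n) s * (1 / s\<^sup>2)) \<le> norm ((real (Suc n))\<^sup>2 * indicator (window n) s)"
    by (intro AE_I2) (auto simp: indicator_def)
qed measurable

lemma trunc_mult_measurable [measurable]: "trunc_mult n \<in> borel_measurable borel"
  unfolding trunc_mult_def[abs_def] gauss_def by measurable

text \<open>The full integral over s > 0 would be 4/|\<eta>|^2, hence the third bound, which is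
  uniform in n. The second depends on n and serves only to establish integrability.\<close>

lemma trunc_mult_bounds:
  shows "0 \<le> trunc_mult n \<eta>" and "trunc_mult n \<eta> \<le> (\<integral>s. indicator (window n) s * (1 / s\<^sup>2) \<partial>lborel)"
    and "(norm \<eta>)\<^sup>2 * trunc_mult n \<eta> \<le> 4"
proof -
  show "0 \<le> trunc_mult n \<eta>"
    unfolding trunc_mult_def by (intro integral_nonneg_AE) auto
  have le: "norm (indicator (window n) s * (1 / s\<^sup>2 * gauss (1 / (4 * s)) \<eta>)) \<le> indicator (window n) s * (1 / s\<^sup>2)" for s
    using window_pos[of s n] by (auto simp: indicator_def intro!: divide_right_mono gauss_le_1)
  have i: "integrable lborel (\<lambda>s. indicator (window n) s * (1 / s\<^sup>2 * gauss (1 / (4 * s)) \<eta>))"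
    by (rule Bochner_Integration.integrable_bound[OF window_inverse_square_integrable[of n]])
       (measurable, intro AE_I2 order_trans[OF le], simp)
  show "trunc_mult n \<eta> \<le> (\<integral>s. indicator (window n) s * (1 / s\<^sup>2) \<partial>lborel)"
    unfolding trunc_mult_def
    by (intro integral_mono i window_inverse_square_integrable order_trans[OF abs_ge_self le[unfolded real_norm_def]])
  show "(norm \<eta>)\<^sup>2 * trunc_mult n \<eta> \<le> 4"
  proof (cases "\<eta> = 0")
    case False
    define a where "a = (norm \<eta>)\<^sup>2 / 4"
    have a: "0 < a" using False by (simp add: a_def)
    \<comment> \<open>Primitive of s^-2 exp(-a/s); its values lie between 0 and 1/a, so any
      increment is at most 1/a = 4/|\<eta>|^2.\<close>
    let ?F = "\<lambda>s. exp (- (a / s)) / a"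
    have le1: "inverse (real (Suc n)) \<le> real (Suc n)"
      by (rule order_trans[of _ 1]) (auto simp: inverse_le_1_iff)
    have "trunc_mult n \<eta> = (\<integral>s. indicator (window n) s *\<^sub>R (1 / s\<^sup>2 * exp (- (a / s))) \<partial>lborel)"
      unfolding trunc_mult_def by (simp add: gauss_def a_def mult.commute)
    also have "\<dots> = ?F (real (Suc n)) - ?F (inverse (real (Suc n)))"
      unfolding window_def
    proof (rule integral_FTC_Icc[OF le1])
      fix s assume s: "inverse (real (Suc n)) \<le> s" "s \<le> real (Suc n)"
      then have s0: "0 < s" by (intro window_pos[of s n]) (simp add: window_def)
      have "(?F has_real_derivative (1 / s\<^sup>2 * exp (- (a / s)))) (at s)"
        using a s0 by (auto intro!: derivative_eq_intros simp: power2_eq_square field_simps)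
      then show "(?F has_vector_derivative (1 / s\<^sup>2 * exp (- (a / s)))) (at s within {inverse (real (Suc n))..real (Suc n)})"
        by (simp add: has_real_derivative_iff_has_vector_derivative has_vector_derivative_at_within)
    next
      show "continuous_on {inverse (real (Suc n))..real (Suc n)} (\<lambda>s. 1 / s\<^sup>2 * exp (- (a / s)))"
        by (intro continuous_intros) (auto dest: window_pos[of _ n, unfolded window_def])
    qed
    also have "\<dots> \<le> 1 / a"
    proof -
      have "exp (- (a / real (Suc n))) \<le> 1" using a by simp
      then have "exp (- (a / real (Suc n))) - exp (- (a / inverse (real (Suc n)))) \<le> 1"
        using exp_ge_zero[of "- (a / inverse (real (Suc n)))"] by linarith
      then show ?thesis
        unfolding diff_divide_distrib[symmetric] using a by (intro divide_right_mono) auto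
    qed
    finally show ?thesis using False by (simp add: a_def field_simps)
  qed simp
qed

definition CZ_factor :: real where
  "CZ_factor = 1 / (2 * sqrt (4 * pi) ^ 3)"

text \<open>Once the linear factor has become a derivative and the Gaussian its transform, s occurs
  only in s^-2 times a Gaussian in \<eta>, which integrates to \<open>trunc_mult\<close>. What
  remains is a transform evaluated at -y, ready for Bessel in y.\<close>

lemma trunc_convolution_FT:
  fixes \<phi> :: "R3 \<Rightarrow> complex"
  assumes \<phi>: "test_function \<phi>"
  shows "(\<integral>x. complex_of_real (((x - y) \<bullet> e) * trunc_kernel n (x - y)) * \<phi> x \<partial>lborel)
    = complex_of_real CZ_factor * FT (\<lambda>\<eta>. FT (dd e \<phi>) \<eta> * complex_of_real (trunc_mult n \<eta>)) (- y)"
proof -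
  note d\<phi> = test_function_dd[OF \<phi>, of e]
  note [measurable] = test_function_measurable[OF \<phi>] test_function_measurable[OF d\<phi>]
  let ?I = "indicator (window n) :: real \<Rightarrow> real"
  have Ii: "integrable lborel ?I"
    by (rule window_indicator_integrable)
  define F where "F x s = complex_of_real (?I s * (sqrt s * gauss s (x - y))) * (complex_of_real ((x - y) \<bullet> e) * \<phi> x)" for x s
  have Fm: "(\<lambda>(x, s). F x s) \<in> borel_measurable (borel \<Otimes>\<^sub>M borel)"
    unfolding F_def by measurable
  \<comment> \<open>Removes the linear growth of the kernel from the majorant, by u <= 1 + u^2 <=
    exp(u^2) with u = sqrt(s)|w|.\<close>
  have sqrt_gauss: "sqrt s * norm w * gauss s w \<le> 1" if "0 \<le> s" for s and w :: R3
  proof -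
    have "sqrt s * norm w \<le> 1 + (sqrt s * norm w)\<^sup>2"
      using sum_squares_bound[of "sqrt s * norm w" "1/2"] by (simp add: power_divide)
    also have "(sqrt s * norm w)\<^sup>2 = s * (norm w)\<^sup>2" using that by (simp add: power_mult_distrib)
    also have "1 + s * (norm w)\<^sup>2 \<le> exp (s * (norm w)\<^sup>2)" by (rule exp_ge_add_one_self)
    finally show ?thesis by (simp add: gauss_def exp_minus field_simps)
  qed
  have FB: "norm (F x s) \<le> (norm e * norm (\<phi> x)) * ?I s" for x s
  proof (cases "s \<in> window n")
    case True
    then have s: "0 \<le> s" using window_pos by (simp add: less_imp_le)
    have "norm (F x s) = sqrt s * gauss s (x - y) * \<bar>(x - y) \<bullet> e\<bar> * norm (\<phi> x)"
      using True s by (simp add: F_def norm_mult abs_mult)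
    also have "\<dots> \<le> sqrt s * gauss s (x - y) * (norm (x - y) * norm e) * norm (\<phi> x)"
      using s by (intro mult_right_mono mult_left_mono Cauchy_Schwarz_ineq2) auto
    also have "\<dots> = (sqrt s * norm (x - y) * gauss s (x - y)) * (norm e * norm (\<phi> x))" by simp
    also have "\<dots> \<le> 1 * (norm e * norm (\<phi> x))" by (intro mult_right_mono sqrt_gauss s) auto
    finally show ?thesis using True by simp
  qed (simp add: F_def)
  have dom: "integrable lborel (\<lambda>x. norm e * norm (\<phi> x))"
    by (intro integrable_mult_right integrable_norm test_function_integrable \<phi>)
  have "(\<integral>x. complex_of_real (((x - y) \<bullet> e) * trunc_kernel n (x - y)) * \<phi> x \<partial>lborel)
      = (\<integral>x. \<integral>s. F x s \<partial>lborel \<partial>lborel)"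
  proof (rule Bochner_Integration.integral_cong[OF refl])
    fix x
    have "(\<integral>s. F x s \<partial>lborel) = complex_of_real (trunc_kernel n (x - y)) * (complex_of_real ((x - y) \<bullet> e) * \<phi> x)"
      unfolding F_def trunc_kernel_def by (simp del: of_real_mult)
    then show "complex_of_real (((x - y) \<bullet> e) * trunc_kernel n (x - y)) * \<phi> x = (\<integral>s. F x s \<partial>lborel)"
      by (simp add: mult_ac)
  qed
  also have "\<dots> = (\<integral>s. \<integral>x. F x s \<partial>lborel \<partial>lborel)"
    by (rule Fubini_dominated(2)[OF Fm dom Ii FB, symmetric])
  also have "\<dots> = (\<integral>s. \<integral>\<eta>. complex_of_real CZ_factor * (FT (dd e \<phi>) \<eta>
      * complex_of_real (?I s * (1 / s\<^sup>2 * gauss (1 / (4 * s)) \<eta>)) * cis (\<eta> \<bullet> y)) \<partial>lborel \<partial>lborel)"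
  proof (rule Bochner_Integration.integral_cong[OF refl])
    fix s :: real
    show "(\<integral>x. F x s \<partial>lborel) = (\<integral>\<eta>. complex_of_real CZ_factor * (FT (dd e \<phi>) \<eta>
      * complex_of_real (?I s * (1 / s\<^sup>2 * gauss (1 / (4 * s)) \<eta>)) * cis (\<eta> \<bullet> y)) \<partial>lborel)"
    proof (cases "s \<in> window n")
      case True
      then have s: "0 < s" by (rule window_pos)
      define J where "J = (\<integral>\<eta>. FT (dd e \<phi>) \<eta> * (complex_of_real (gauss (1 / (4 * s)) \<eta>) * cis (\<eta> \<bullet> y)) \<partial>lborel)"
      have "(\<integral>x. F x s \<partial>lborel) = (\<integral>x. complex_of_real (sqrt s) * (complex_of_real (((x - y) \<bullet> e) * gauss s (x - y)) * \<phi> x) \<partial>lborel)"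
        using True by (simp add: F_def mult_ac)
      also have "\<dots> = complex_of_real (sqrt s) * (complex_of_real (1 / (2 * s)) * (complex_of_real (1 / sqrt (4 * pi * s) ^ 3) * J))"
        by (simp only: integral_mult_right_zero gauss_moment_by_parts[OF \<phi> s] J_def
             gauss_convolution_FT[OF test_function_integrable[OF d\<phi>] s])
      also have "\<dots> = complex_of_real (sqrt s * (1 / (2 * s)) * (1 / sqrt (4 * pi * s) ^ 3)) * J"
        by (simp only: of_real_mult mult.assoc)
      \<comment> \<open>Powers of s: 1/2 from the superposition, -1 from integration by parts, -3/2
        from the Gaussian transform. Together they give the -2 in \<open>trunc_mult\<close>, and the
        constants give \<open>CZ_factor\<close>.\<close>
      also have "sqrt s * (1 / (2 * s)) * (1 / sqrt (4 * pi * s) ^ 3) = CZ_factor * (1 / s\<^sup>2)"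
      proof -
        have "sqrt s ^ 3 = s * sqrt s" using s by (simp add: power3_eq_cube)
        then show ?thesis
          using s by (simp add: CZ_factor_def real_sqrt_mult power_mult_distrib power2_eq_square)
      qed
      also have "complex_of_real (CZ_factor * (1 / s\<^sup>2)) * J = (\<integral>\<eta>. complex_of_real (CZ_factor * (1 / s\<^sup>2)) * (FT (dd e \<phi>) \<eta> * (complex_of_real (gauss (1 / (4 * s)) \<eta>) * cis (\<eta> \<bullet> y))) \<partial>lborel)"
        unfolding J_def by (rule integral_mult_right_zero[symmetric])
      finally show ?thesis using True by (simp add: mult_ac)
    qed (simp add: F_def)
  qed
  also have "\<dots> = (\<integral>\<eta>. \<integral>s. complex_of_real CZ_factor * (FT (dd e \<phi>) \<eta>
      * complex_of_real (?I s * (1 / s\<^sup>2 * gauss (1 / (4 * s)) \<eta>)) * cis (\<eta> \<bullet> y)) \<partial>lborel \<partial>lborel)"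
  proof -
    obtain C where C: "0 \<le> C" "\<And>\<eta>. norm (FT (dd e \<phi>) \<eta>) \<le> C * decay \<eta>"
      using FT_test_function_decay[OF d\<phi>] by metis
    show ?thesis
    proof (rule Fubini_dominated(2))
      show "(\<lambda>(\<eta>, s). complex_of_real CZ_factor * (FT (dd e \<phi>) \<eta>
        * complex_of_real (?I s * (1 / s\<^sup>2 * gauss (1 / (4 * s)) \<eta>)) * cis (\<eta> \<bullet> y))) \<in> borel_measurable (borel \<Otimes>\<^sub>M borel)"
        unfolding gauss_def by measurable
      show "integrable lborel (\<lambda>\<eta>. \<bar>CZ_factor\<bar> * (C * decay \<eta>))"
        by (intro integrable_mult_right decay_integrable)
      show "integrable lborel (\<lambda>s. ?I s * (1 / s\<^sup>2))" by (rule window_inverse_square_integrable)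
      fix \<eta> :: R3 and s :: real
      have le: "?I s * (1 / s\<^sup>2 * gauss (1 / (4 * s)) \<eta>) \<le> ?I s * (1 / s\<^sup>2)"
        using window_pos[of s n] by (auto simp: indicator_def intro!: divide_right_mono gauss_le_1)
      have "norm (FT (dd e \<phi>) \<eta>) * (?I s * (1 / s\<^sup>2 * gauss (1 / (4 * s)) \<eta>)) \<le> (C * decay \<eta>) * (?I s * (1 / s\<^sup>2))"
        by (rule mult_mono[OF C(2) le]) (use C(1) in auto)
      then show "norm (complex_of_real CZ_factor * (FT (dd e \<phi>) \<eta>
        * complex_of_real (?I s * (1 / s\<^sup>2 * gauss (1 / (4 * s)) \<eta>)) * cis (\<eta> \<bullet> y)))
        \<le> \<bar>CZ_factor\<bar> * (C * decay \<eta>) * (?I s * (1 / s\<^sup>2))"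
        unfolding norm_mult norm_of_real norm_cis mult_1_right mult.assoc[of "\<bar>CZ_factor\<bar>"]
        by (intro mult_left_mono) (auto simp: abs_mult)
    qed
  qed
  also have "\<dots> = complex_of_real CZ_factor * FT (\<lambda>\<eta>. FT (dd e \<phi>) \<eta> * complex_of_real (trunc_mult n \<eta>)) (- y)"
  proof -
    have pull: "(\<integral>s. A * (X * complex_of_real (k s) * Z) \<partial>lborel) = A * (X * complex_of_real (\<integral>s. k s \<partial>lborel) * Z)"
      for A X Z and k :: "real \<Rightarrow> real"
      by simp
    show ?thesis
      by (simp only: pull trunc_mult_def[symmetric], simp only: integral_mult_right_zero)
         (simp add: FT_def)
  qed
  finally show ?thesis .
qed


text \<open>4 bounds |\<eta>|^2 times the multiplier, (2 pi)^3 comes from two uses of Bessel at (2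
  pi)^(3/2) each, and Gamma(3/2) undoes the normalisation of the superposition.\<close>

definition CZ_const :: real where
  "CZ_const = 4 * (2 * pi) ^ 3 * CZ_factor / Gamma (3/2)"

lemma CZ_factor_pos: "0 < CZ_factor"
  by (simp add: CZ_factor_def)

lemma CZ_const_nonneg [simp]: "0 \<le> CZ_const"
  using CZ_factor_pos by (simp add: CZ_const_def Gamma_real_nonneg)

text \<open>One derivative comes from the linear factor of the kernel and one is already on \<phi>.
  Together they cost |\<eta>|^2 on the Fourier side, exactly what the multiplier compensates, so the
  bound does not depend on n.\<close>

lemma trunc_convolution_L2:
  fixes \<phi> :: "R3 \<Rightarrow> complex"
  assumes \<phi>: "test_function \<phi>" and e: "norm e = 1" and e': "norm e' = 1"
  shows "(\<integral>\<^sup>+y. ennreal ((norm (\<integral>x. complex_of_real (((x - y) \<bullet> e) * trunc_kernel n (x - y)) * dd e' \<phi> x \<partial>lborel))\<^sup>2) \<partial>lborel)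
    \<le> ennreal ((4 * (2 * pi) ^ 3 * CZ_factor * Lp_norm 2 \<phi>)\<^sup>2)"
proof -
  note d\<phi> = test_function_dd[OF \<phi>, of e']
  note dd\<phi> = test_function_dd[OF d\<phi>, of e]
  note [measurable] = test_function_measurable[OF \<phi>] test_function_measurable[OF dd\<phi>]
  have \<phi>2: "Lp_mem 2 \<phi>" by (rule test_function_Lp[OF \<phi>]) simp
  define h where "h \<eta> = FT (dd e (dd e' \<phi>)) \<eta> * complex_of_real (trunc_mult n \<eta>)" for \<eta>
  have [measurable]: "h \<in> borel_measurable borel" unfolding h_def[abs_def] by measurable
  obtain C where C: "0 \<le> C" "\<And>\<eta>. norm (FT (dd e (dd e' \<phi>)) \<eta>) \<le> C * decay \<eta>"
    using FT_test_function_decay[OF dd\<phi>] by metis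
  define M where "M = (\<integral>s. indicator (window n) s * (1 / s\<^sup>2) \<partial>lborel)"
  have M: "trunc_mult n \<eta> \<le> M" for \<eta> unfolding M_def by (rule trunc_mult_bounds(2))
  have hi: "integrable lborel h"
  proof (rule Bochner_Integration.integrable_bound)
    show "integrable lborel (\<lambda>\<eta>. C * decay \<eta> * M)" by (intro integrable_mult_left integrable_mult_right decay_integrable)
    have "norm (h \<eta>) \<le> C * decay \<eta> * M" for \<eta>
      unfolding h_def norm_mult using C(1) trunc_mult_bounds(1)[of n \<eta>] M[of \<eta>] by (intro mult_mono C(2)) auto
    then show "AE \<eta> in lborel. norm (h \<eta>) \<le> norm (C * decay \<eta> * M)"
      by (intro AE_I2) (auto intro: order_trans[OF _ abs_ge_self])
  qed measurable
  have hb: "norm (h \<eta>) \<le> 4 * norm (FT \<phi> \<eta>)" for \<eta>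
  proof -
    have "norm (h \<eta>) = \<bar>e \<bullet> \<eta>\<bar> * \<bar>e' \<bullet> \<eta>\<bar> * norm (FT \<phi> \<eta>) * trunc_mult n \<eta>"
      using trunc_mult_bounds(1)[of n \<eta>] by (simp add: h_def FT_dd[OF d\<phi>] FT_dd[OF \<phi>] norm_mult)
    also have "\<dots> \<le> (norm \<eta> * norm \<eta>) * norm (FT \<phi> \<eta>) * trunc_mult n \<eta>"
      using Cauchy_Schwarz_ineq2[of e \<eta>] Cauchy_Schwarz_ineq2[of e' \<eta>] e e' trunc_mult_bounds(1)[of n \<eta>]
      by (intro mult_right_mono mult_mono) auto
    also have "\<dots> = ((norm \<eta>)\<^sup>2 * trunc_mult n \<eta>) * norm (FT \<phi> \<eta>)"
      by (simp add: power2_eq_square)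
    also have "\<dots> \<le> 4 * norm (FT \<phi> \<eta>)" by (intro mult_right_mono trunc_mult_bounds(3)) auto
    finally show ?thesis .
  qed
  define p where "p = (2 * pi) ^ 3"
  have p: "0 < p" by (simp add: p_def)
  have "(\<integral>\<^sup>+\<eta>. ennreal ((norm (h \<eta>))\<^sup>2) \<partial>lborel) \<le> (\<integral>\<^sup>+\<eta>. ennreal 16 * ennreal ((norm (FT \<phi> \<eta>))\<^sup>2) \<partial>lborel)"
  proof (rule nn_integral_mono)
    fix \<eta>
    have "(norm (h \<eta>))\<^sup>2 \<le> (4 * norm (FT \<phi> \<eta>))\<^sup>2" by (intro power_mono hb) auto
    then show "ennreal ((norm (h \<eta>))\<^sup>2) \<le> ennreal 16 * ennreal ((norm (FT \<phi> \<eta>))\<^sup>2)"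
      by (subst ennreal_mult[symmetric]) (auto simp: power_mult_distrib intro!: ennreal_leI)
  qed
  also have "\<dots> = ennreal 16 * (\<integral>\<^sup>+\<eta>. ennreal ((norm (FT \<phi> \<eta>))\<^sup>2) \<partial>lborel)"
    by (rule nn_integral_cmult) measurable
  also have "\<dots> \<le> ennreal 16 * ennreal (p * (Lp_norm 2 \<phi>)\<^sup>2)"
    using Bessel[OF test_function_integrable[OF \<phi>] \<phi>2] by (intro mult_left_mono) (auto simp: p_def)
  also have "\<dots> = ennreal ((4 * sqrt p * Lp_norm 2 \<phi>)\<^sup>2)"
    using p by (subst ennreal_mult[symmetric]) (auto simp: power_mult_distrib)
  finally have le: "(\<integral>\<^sup>+\<eta>. ennreal ((norm (h \<eta>))\<^sup>2) \<partial>lborel) \<le> ennreal ((4 * sqrt p * Lp_norm 2 \<phi>)\<^sup>2)" .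
  have h2: "Lp_mem 2 h" "Lp_norm 2 h \<le> 4 * sqrt p * Lp_norm 2 \<phi>"
    using L2_nn_integral_le[OF _ _ le] p by auto
  have "(\<integral>\<^sup>+y. ennreal ((norm (\<integral>x. complex_of_real (((x - y) \<bullet> e) * trunc_kernel n (x - y)) * dd e' \<phi> x \<partial>lborel))\<^sup>2) \<partial>lborel)
      = (\<integral>\<^sup>+y. ennreal (CZ_factor\<^sup>2) * ennreal ((norm (FT h (0 + (-1) *\<^sub>R y)))\<^sup>2) \<partial>lborel)"
    unfolding trunc_convolution_FT[OF d\<phi>] h_def
    by (simp add: norm_mult power_mult_distrib ennreal_mult)
  also have "\<dots> = ennreal (CZ_factor\<^sup>2) * (\<integral>\<^sup>+y. ennreal ((norm (FT h (0 + (-1) *\<^sub>R y)))\<^sup>2) \<partial>lborel)"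
    by (rule nn_integral_cmult) measurable
  also have "(\<integral>\<^sup>+y. ennreal ((norm (FT h (0 + (-1) *\<^sub>R y)))\<^sup>2) \<partial>lborel) = (\<integral>\<^sup>+\<eta>. ennreal ((norm (FT h \<eta>))\<^sup>2) \<partial>lborel)"
    by (subst (2) nn_integral_lborel_affine[of _ "-1" 0]) auto
  also have "\<dots> \<le> ennreal (p * (Lp_norm 2 h)\<^sup>2)"
    using Bessel[OF hi h2(1)] by (simp add: p_def)
  also have "\<dots> \<le> ennreal (p * (4 * sqrt p * Lp_norm 2 \<phi>)\<^sup>2)"
    using p h2(2) by (intro ennreal_leI mult_left_mono power_mono) auto
  also have "ennreal (CZ_factor\<^sup>2) * \<dots> = ennreal ((4 * p * CZ_factor * Lp_norm 2 \<phi>)\<^sup>2)"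
    using p by (subst ennreal_mult[symmetric]) (auto simp: power_mult_distrib power2_eq_square[of p] mult_ac)
  finally show ?thesis by (simp add: p_def mult_left_mono)
qed

section \<open>The transposed Riesz operator and duality\<close>

definition riesz_adj :: "3 \<Rightarrow> (R3 \<Rightarrow> complex) \<Rightarrow> R3 \<Rightarrow> complex" where
  "riesz_adj j \<psi> y = (\<integral>x. complex_of_real ((x - y) $ j / norm (x - y) ^ 3) * \<psi> x \<partial>lborel)"

lemma vec_nth_measurable [measurable]: "(\<lambda>x::R3. x $ j) \<in> borel_measurable borel"
  by (intro borel_measurable_continuous_onI continuous_intros)

lemma riesz_adj_measurable [measurable]:
  assumes [measurable]: "\<psi> \<in> borel_measurable borel"
  shows "riesz_adj j \<psi> \<in> borel_measurable borel"
  unfolding riesz_adj_def[abs_def] by measurable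

lemma riesz_kernel_le: "\<bar>(w::R3) $ j / norm w ^ 3\<bar> \<le> 1 / (norm w)\<^sup>2"
proof (cases "w = 0")
  case False
  have "\<bar>w $ j\<bar> / norm w ^ 3 \<le> norm w / norm w ^ 3"
    using component_le_norm_cart[of w j] by (intro divide_right_mono) auto
  then show ?thesis using False by (simp add: power2_eq_square power3_eq_cube abs_divide)
qed simp

lemma riesz_maj_finite:
  assumes "Lp_mem (6/5) f"
  shows "AE x in lborel. riesz_maj f x < \<infinity>"
proof -
  have [measurable]: "f \<in> borel_measurable borel" using assms by (simp add: Lp_mem_def)
  have "(\<integral>\<^sup>+x. (riesz_maj f x)\<^sup>2 \<partial>lborel) \<noteq> \<infinity>"
    using Hardy_Littlewood_Sobolev[OF assms] by (auto simp: top_unique)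
  then have "AE x in lborel. (riesz_maj f x)\<^sup>2 \<noteq> \<infinity>"
    by (rule nn_integral_noteq_infinite[rotated]) measurable
  then show ?thesis
    by (rule eventually_mono) (auto simp: less_top[symmetric])
qed

text \<open>The truncated convolutions converge at almost every y to Gamma(3/2) times the operator,
  and their L2 bounds are uniform in n, so Fatou's lemma applies.\<close>

theorem riesz_adj_test_bound:
  fixes \<phi> :: "R3 \<Rightarrow> complex"
  assumes \<phi>: "test_function \<phi>"
  shows "Lp_mem 2 (riesz_adj j (dd (axis k 1) \<phi>))"
    and "Lp_norm 2 (riesz_adj j (dd (axis k 1) \<phi>)) \<le> CZ_const * Lp_norm 2 \<phi>"
proof -
  define \<psi> where "\<psi> = dd (axis k 1) \<phi>"
  have \<psi>: "test_function \<psi>" unfolding \<psi>_def by (rule test_function_dd[OF \<phi>])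
  note [measurable] = test_function_measurable[OF \<psi>]
  have \<psi>65: "Lp_mem (6/5) \<psi>" by (rule test_function_Lp[OF \<psi>]) simp
  define g where "g = (Gamma (3/2) :: real)"
  have g: "0 < g" by (simp add: g_def Gamma_real_pos)
  let ?e = "axis j 1 :: R3"
  define B where "B n y = (\<integral>x. complex_of_real (((x - y) \<bullet> ?e) * trunc_kernel n (x - y)) * \<psi> x \<partial>lborel)" for n y
  have [measurable]: "B n \<in> borel_measurable borel" for n
    unfolding B_def[abs_def] by measurable
  have lim: "(\<lambda>n. B n y) \<longlonglongrightarrow> complex_of_real g * riesz_adj j \<psi> y" if fin: "riesz_maj \<psi> y < \<infinity>" for y
  proof -
    \<comment> \<open>Finiteness of \<open>riesz_maj\<close> at y says precisely that this majorant
      is integrable; it holds for almost every y by Hardy-Littlewood-Sobolev.\<close>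
    have dom: "integrable lborel (\<lambda>x. norm (\<psi> x) / (norm (y - x))\<^sup>2)"
      using fin by (intro integrableI_bounded) (auto simp: riesz_maj_def)
    have "(\<lambda>n. B n y) \<longlonglongrightarrow> (\<integral>x. complex_of_real (((x - y) \<bullet> ?e) * (g / norm (x - y) ^ 3)) * \<psi> x \<partial>lborel)"
      unfolding B_def
    proof (rule integral_dominated_convergence[OF _ _ integrable_mult_right[OF dom, of g]])
      show "AE x in lborel. (\<lambda>n. complex_of_real (((x - y) \<bullet> ?e) * trunc_kernel n (x - y)) * \<psi> x)
          \<longlonglongrightarrow> complex_of_real (((x - y) \<bullet> ?e) * (g / norm (x - y) ^ 3)) * \<psi> x"
        by (rule eventually_mono[OF AE_lborel_singleton[of y]])
           (unfold g_def, intro tendsto_intros trunc_kernel_lim, simp)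
      show "AE x in lborel. norm (complex_of_real (((x - y) \<bullet> ?e) * trunc_kernel n (x - y)) * \<psi> x)
          \<le> g * (norm (\<psi> x) / (norm (y - x))\<^sup>2)" for n
      proof (rule eventually_mono[OF AE_lborel_singleton[of y]])
        fix x assume "x \<noteq> y"
        then have nz: "x - y \<noteq> 0" by simp
        have "\<bar>(x - y) \<bullet> ?e\<bar> * \<bar>trunc_kernel n (x - y)\<bar> \<le> norm (x - y) * (g / norm (x - y) ^ 3)"
          unfolding g_def using Cauchy_Schwarz_ineq2[of "x - y" ?e]
          by (intro mult_mono trunc_kernel_le nz) (auto simp: norm_axis_1)
        also have "\<dots> = g / (norm (y - x))\<^sup>2"
          using nz by (simp add: norm_minus_commute power2_eq_square power3_eq_cube)
        finally have "\<bar>(x - y) \<bullet> ?e\<bar> * \<bar>trunc_kernel n (x - y)\<bar> * norm (\<psi> x) \<le> g / (norm (y - x))\<^sup>2 * norm (\<psi> x)"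
          by (rule mult_right_mono) simp
        then show "norm (complex_of_real (((x - y) \<bullet> ?e) * trunc_kernel n (x - y)) * \<psi> x)
          \<le> g * (norm (\<psi> x) / (norm (y - x))\<^sup>2)" by (simp add: norm_mult abs_mult)
      qed
    qed measurable
    also have "(\<integral>x. complex_of_real (((x - y) \<bullet> ?e) * (g / norm (x - y) ^ 3)) * \<psi> x \<partial>lborel)
        = (\<integral>x. complex_of_real g * (complex_of_real ((x - y) $ j / norm (x - y) ^ 3) * \<psi> x) \<partial>lborel)"
      by (intro Bochner_Integration.integral_cong) (auto simp: inner_axis mult_ac)
    also have "\<dots> = complex_of_real g * riesz_adj j \<psi> y"
      unfolding riesz_adj_def by (rule integral_mult_right_zero)
    finally show ?thesis .
  qed
  let ?C = "4 * (2 * pi) ^ 3 * CZ_factor * Lp_norm 2 \<phi>"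
  have "(\<integral>\<^sup>+y. ennreal ((norm (complex_of_real g * riesz_adj j \<psi> y))\<^sup>2) \<partial>lborel) \<le> ennreal (?C\<^sup>2)"
  proof (rule nn_integral_Fatou_bound)
    show "AE y in lborel. (\<lambda>n. ennreal ((norm (B n y))\<^sup>2)) \<longlonglongrightarrow> ennreal ((norm (complex_of_real g * riesz_adj j \<psi> y))\<^sup>2)"
      using riesz_maj_finite[OF \<psi>65]
      by (rule eventually_mono) (intro tendsto_ennrealI tendsto_intros lim)
    show "(\<integral>\<^sup>+y. ennreal ((norm (B n y))\<^sup>2) \<partial>lborel) \<le> ennreal (?C\<^sup>2)" for n
      unfolding B_def \<psi>_def by (rule trunc_convolution_L2[OF \<phi>]) (auto simp: norm_axis_1)
  qed measurable
  from L2_nn_integral_le[OF _ _ this] CZ_factor_pos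
  have 1: "Lp_mem 2 (\<lambda>y. complex_of_real g * riesz_adj j \<psi> y)" "Lp_norm 2 (\<lambda>y. complex_of_real g * riesz_adj j \<psi> y) \<le> ?C"
    by auto
  have eq: "riesz_adj j \<psi> = (\<lambda>y. (1 / g) *\<^sub>R (complex_of_real g * riesz_adj j \<psi> y))"
    using g by (auto simp: fun_eq_iff scaleR_conv_of_real)
  show "Lp_mem 2 (riesz_adj j (dd (axis k 1) \<phi>))"
    unfolding \<psi>_def[symmetric] by (subst eq) (rule L2_scaleR[OF 1(1)])
  have "Lp_norm 2 (riesz_adj j \<psi>) = (1 / g) * Lp_norm 2 (\<lambda>y. complex_of_real g * riesz_adj j \<psi> y)"
    using g by (subst eq) (simp add: L2_scaleR(2)[OF 1(1)])
  also have "\<dots> \<le> (1 / g) * ?C" using g by (intro mult_left_mono 1) auto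
  also have "\<dots> = CZ_const * Lp_norm 2 \<phi>" by (simp add: CZ_const_def g_def)
  finally show "Lp_norm 2 (riesz_adj j (dd (axis k 1) \<phi>)) \<le> CZ_const * Lp_norm 2 \<phi>"
    unfolding \<psi>_def .
qed

text \<open>Fubini is justified by Hardy-Littlewood-Sobolev: \<open>riesz_maj \<psi>\<close> is
  square integrable for \<psi> in L^(6/5), and Cauchy-Schwarz against f makes the double integral
  absolutely convergent.\<close>

lemma riesz_conv_duality:
  fixes f \<psi> :: "R3 \<Rightarrow> complex"
  assumes f: "Lp_mem 2 f" and \<psi>: "Lp_mem (6/5) \<psi>"
  shows "(\<integral>x. riesz_conv j f x * \<psi> x \<partial>lborel) = (\<integral>y. f y * riesz_adj j \<psi> y \<partial>lborel)"
proof -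
  note [measurable] = L2_measurable[OF f]
  have [measurable]: "\<psi> \<in> borel_measurable borel" using \<psi> by (simp add: Lp_mem_def)
  define F where "F x y = (((x - y) $ j / norm (x - y) ^ 3) *\<^sub>R f y) * \<psi> x" for x y
  have [measurable]: "(\<lambda>(x, y). F x y) \<in> borel_measurable (borel \<Otimes>\<^sub>M borel)"
    unfolding F_def by measurable
  have int: "integrable (lborel \<Otimes>\<^sub>M lborel) (\<lambda>(x, y). F x y)"
  proof (rule integrableI_bounded)
    have "(\<integral>\<^sup>+p. ennreal (norm (case p of (x, y) \<Rightarrow> F x y)) \<partial>(lborel \<Otimes>\<^sub>M lborel))
        = (\<integral>\<^sup>+y. \<integral>\<^sup>+x. ennreal (norm (F x y)) \<partial>lborel \<partial>lborel)"
      by (subst lborel_pair.nn_integral_snd[symmetric]) (auto simp: case_prod_unfold)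
    also have "\<dots> \<le> (\<integral>\<^sup>+y. ennreal (norm (f y)) * riesz_maj \<psi> y \<partial>lborel)"
    proof (rule nn_integral_mono)
      fix y
      have "(\<integral>\<^sup>+x. ennreal (norm (F x y)) \<partial>lborel) \<le> (\<integral>\<^sup>+x. ennreal (norm (f y)) * ennreal (norm (\<psi> x) / (norm (y - x))\<^sup>2) \<partial>lborel)"
      proof (rule nn_integral_mono)
        fix x
        have "norm (F x y) \<le> 1 / (norm (x - y))\<^sup>2 * norm (f y) * norm (\<psi> x)"
          unfolding F_def norm_mult norm_scaleR by (intro mult_right_mono riesz_kernel_le) auto
        then show "ennreal (norm (F x y)) \<le> ennreal (norm (f y)) * ennreal (norm (\<psi> x) / (norm (y - x))\<^sup>2)"
          by (subst ennreal_mult[symmetric]) (auto simp: norm_minus_commute mult_ac intro!: ennreal_leI)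
      qed
      also have "\<dots> = ennreal (norm (f y)) * riesz_maj \<psi> y"
        unfolding riesz_maj_def by (rule nn_integral_cmult) measurable
      finally show "(\<integral>\<^sup>+x. ennreal (norm (F x y)) \<partial>lborel) \<le> ennreal (norm (f y)) * riesz_maj \<psi> y" .
    qed
    also have "\<dots> < \<infinity>"
    proof -
      have "(\<integral>\<^sup>+y. ennreal (norm (f y)) * riesz_maj \<psi> y \<partial>lborel)\<^sup>2
          \<le> (\<integral>\<^sup>+y. (ennreal (norm (f y)))\<^sup>2 \<partial>lborel) * (\<integral>\<^sup>+y. (riesz_maj \<psi> y)\<^sup>2 \<partial>lborel)"
        by (rule Cauchy_Schwarz_nn_integral) measurable
      also have "\<dots> \<le> ennreal ((Lp_norm 2 f)\<^sup>2) * ennreal ((HLS_const * Lp_norm (6/5) \<psi>)\<^sup>2)"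
        using L2_nn_integral[OF f] by (intro mult_mono Hardy_Littlewood_Sobolev[OF \<psi>]) (auto simp: ennreal_power)
      also have "\<dots> < \<infinity>" by (simp add: ennreal_mult[symmetric])
      finally show ?thesis by (simp add: power_less_top_ennreal)
    qed
    finally show "(\<integral>\<^sup>+p. ennreal (norm (case p of (x, y) \<Rightarrow> F x y)) \<partial>(lborel \<Otimes>\<^sub>M lborel)) < \<infinity>" .
  qed measurable
  have "(\<integral>x. riesz_conv j f x * \<psi> x \<partial>lborel) = (\<integral>x. \<integral>y. F x y \<partial>lborel \<partial>lborel)"
    unfolding riesz_conv_def F_def by (simp only: integral_mult_left_zero)
  also have "\<dots> = (\<integral>y. \<integral>x. F x y \<partial>lborel \<partial>lborel)"
    by (rule lborel_pair.Fubini_integral[OF int, symmetric])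
  also have "\<dots> = (\<integral>y. f y * riesz_adj j \<psi> y \<partial>lborel)"
  proof (rule Bochner_Integration.integral_cong[OF refl])
    fix y
    have "(\<integral>x. F x y \<partial>lborel) = (\<integral>x. f y * (complex_of_real ((x - y) $ j / norm (x - y) ^ 3) * \<psi> x) \<partial>lborel)"
      by (simp add: F_def scaleR_conv_of_real mult_ac)
    also have "\<dots> = f y * riesz_adj j \<psi> y"
      unfolding riesz_adj_def by (rule integral_mult_right_zero)
    finally show "(\<integral>x. F x y \<partial>lborel) = f y * riesz_adj j \<psi> y" .
  qed
  finally show ?thesis .
qed

lemma L2_pairing_le:
  fixes f g :: "'a::euclidean_space \<Rightarrow> complex"
  assumes f: "Lp_mem 2 f" and g: "Lp_mem 2 g"
  shows "norm (\<integral>x. f x * g x \<partial>lborel) \<le> Lp_norm 2 f * Lp_norm 2 g"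
proof -
  have "norm (\<integral>x. f x * g x \<partial>lborel) \<le> (\<integral>x. norm (f x * g x) \<partial>lborel)"
    by (rule integral_norm_bound)
  also have "\<dots> \<le> Lp_norm 2 f * Lp_norm 2 g"
    using L2_Cauchy_Schwarz(2)[OF f g] by (simp add: norm_mult)
  finally show ?thesis .
qed

text \<open>The weak derivative shifts the differentiation to \<phi>, and duality shifts the kernel
  as well. What remains is the transposed operator on a derivative of a test function, which is
  already bounded.\<close>

lemma dipole_conv_pairing:
  assumes d: "dipole_conv j k f g" and \<phi>: "test_function \<phi>"
  shows "norm (\<integral>x. g x * \<phi> x \<partial>lborel) \<le> CZ_const * Lp_norm 2 f * Lp_norm 2 \<phi>"
proof -
  have f: "Lp_mem 2 f" using d by (simp add: dipole_conv_def)
  define \<psi> where "\<psi> = dd (axis k 1) \<phi>"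
  have \<psi>: "Lp_mem (6/5) \<psi>"
    unfolding \<psi>_def by (rule test_function_Lp[OF test_function_dd[OF \<phi>]]) simp
  have "(\<integral>x. riesz_conv j f x * \<psi> x \<partial>lborel) = - (\<integral>x. g x * \<phi> x \<partial>lborel)"
    using d \<phi> unfolding dipole_conv_def weak_partial_def \<psi>_def dd_def by blast
  then have "norm (\<integral>x. g x * \<phi> x \<partial>lborel) = norm (\<integral>y. f y * riesz_adj j \<psi> y \<partial>lborel)"
    unfolding riesz_conv_duality[OF f \<psi>] by simp
  also have "\<dots> \<le> Lp_norm 2 f * Lp_norm 2 (riesz_adj j \<psi>)"
    unfolding \<psi>_def by (intro L2_pairing_le f riesz_adj_test_bound \<phi>)
  also have "\<dots> \<le> Lp_norm 2 f * (CZ_const * Lp_norm 2 \<phi>)"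
    unfolding \<psi>_def by (intro mult_left_mono riesz_adj_test_bound \<phi>) auto
  finally show ?thesis by (simp add: mult_ac)
qed


section \<open>Density of test functions and the dipole convolution\<close>

lemma Ck_Suc_iff:
  assumes "\<And>x. (f has_derivative f' x) (at x)"
  shows "Ck (Suc n) f \<longleftrightarrow> (\<forall>h. Ck n (\<lambda>x. f' x h))"
proof -
  have "frechet_derivative f (at x) = f' x" for x
    using frechet_derivative_at[OF assms] by simp
  moreover have "f differentiable (at x)" for x
    using assms differentiable_def by blast
  ultimately show ?thesis by simp
qed

lemma Ck_Suc_derivative:
  assumes "Ck (Suc n) f"
  shows "(f has_derivative (\<lambda>h. dd h f x)) (at x)" "Ck n (dd h f)"
  using assms by (simp_all add: dd_def[abs_def] frechet_derivative_works[symmetric])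

text \<open>\<open>Ck (Suc n)\<close> mentions only differentiability and the derivatives, so the
  lower orders have to be recovered by induction, continuity at the bottom.\<close>

lemma Ck_SucD: "Ck (Suc n) f \<Longrightarrow> Ck n f"
proof (induction n arbitrary: f)
  case 0
  then have "f differentiable (at x)" for x by simp
  then show ?case by (simp add: continuous_at_imp_continuous_on differentiable_imp_continuous_within)
next
  case (Suc n)
  have "Ck (Suc n) (dd h f)" for h by (rule Ck_Suc_derivative(2)[OF Suc.prems])
  then have "Ck n (dd h f)" for h by (rule Suc.IH)
  then show ?case unfolding Ck_Suc_iff[OF Ck_Suc_derivative(1)[OF Suc.prems]] by simp
qed

lemma Ck_const: "Ck n (\<lambda>x. c)"
  by (induction n arbitrary: c) (auto simp: frechet_derivative_const)

lemma Ck_add: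
  fixes f g :: "'a::euclidean_space \<Rightarrow> 'b::real_normed_vector"
  shows "Ck n f \<Longrightarrow> Ck n g \<Longrightarrow> Ck n (\<lambda>x. f x + g x)"
proof (induction n arbitrary: f g)
  case (Suc n)
  note df = Ck_Suc_derivative[OF Suc.prems(1)] and dg = Ck_Suc_derivative[OF Suc.prems(2)]
  show ?case unfolding Ck_Suc_iff[OF has_derivative_add[OF df(1) dg(1)]]
    using Suc.IH df(2) dg(2) by (simp add: dd_def[abs_def])
qed (auto intro: continuous_intros)

lemma Ck_mult:
  fixes f g :: "'a::euclidean_space \<Rightarrow> complex"
  shows "Ck n f \<Longrightarrow> Ck n g \<Longrightarrow> Ck n (\<lambda>x. f x * g x)"
proof (induction n arbitrary: f g)
  case (Suc n)
  note df = Ck_Suc_derivative[OF Suc.prems(1)] and dg = Ck_Suc_derivative[OF Suc.prems(2)]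
  have "Ck n (\<lambda>x. f x * dd h g x + dd h f x * g x)" for h
    by (intro Ck_add Suc.IH Ck_SucD[OF Suc.prems(1)] Ck_SucD[OF Suc.prems(2)] df(2) dg(2))
  then show ?case unfolding Ck_Suc_iff[OF has_derivative_mult[OF df(1) dg(1)]] by simp
qed (auto intro: continuous_intros)

lemma Ck_prod:
  fixes f :: "'i \<Rightarrow> 'a::euclidean_space \<Rightarrow> complex"
  assumes "finite I" "\<And>i. i \<in> I \<Longrightarrow> Ck n (f i)"
  shows "Ck n (\<lambda>x. \<Prod>i\<in>I. f i x)"
  using assms by (induction I rule: finite_induct) (auto intro!: Ck_mult Ck_const)

text \<open>The classical smooth function vanishing to infinite order at 0. The extra powers t^-m
  make the family closed under differentiation up to linear combinations, so smoothness follows by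
  induction with m arbitrary.\<close>

definition flat :: "nat \<Rightarrow> real \<Rightarrow> real" where
  "flat m t = (if 0 < t then (1 / t) ^ m * exp (- (1 / t)) else 0)"

lemma flat_lim_0: "(flat m \<longlongrightarrow> 0) (at_right 0)"
proof -
  have "((\<lambda>y::real. y ^ m / exp y) \<longlongrightarrow> 0) at_top" by (rule tendsto_power_div_exp_0)
  then have "((\<lambda>t::real. inverse t ^ m / exp (inverse t)) \<longlongrightarrow> 0) (at_right 0)"
    by (rule filterlim_compose[OF _ filterlim_inverse_at_top_right])
  then show ?thesis
  proof (rule Lim_transform_eventually)
    show "\<forall>\<^sub>F t in at_right 0. inverse t ^ m / exp (inverse t) = flat m t"
      using eventually_at_right_less[of 0]
      by (rule eventually_mono) (simp add: flat_def exp_minus divide_inverse)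
  qed
qed

lemma flat_has_derivative:
  "(flat m has_real_derivative (flat (m + 2) t - real m * flat (m + 1) t)) (at t)"
proof -
  consider "0 < t" | "t < 0" | "t = 0" by linarith
  then show ?thesis
  proof cases
    case 1
    have i: "((\<lambda>t. 1 / t) has_real_derivative (- ((1 / t)\<^sup>2))) (at t)"
      using 1 by (auto intro!: derivative_eq_intros simp: power2_eq_square)
    have p: "((\<lambda>t. (1 / t) ^ m) has_real_derivative (- (real m * (1 / t) ^ (m + 1)))) (at t)"
    proof -
      have "real m * (- ((1 / t)\<^sup>2) * (1 / t) ^ (m - Suc 0)) = - (real m * (1 / t) ^ (m + 1))"
        by (cases m) (simp_all add: power2_eq_square)
      then show ?thesis using DERIV_power[OF i, of m] by (simp only: of_nat_id)
    qed
    have e: "((\<lambda>t. exp (- (1 / t))) has_real_derivative (exp (- (1 / t)) * - (- ((1 / t)\<^sup>2)))) (at t)"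
      by (intro DERIV_fun_exp DERIV_minus i)
    have "((\<lambda>t. (1 / t) ^ m * exp (- (1 / t))) has_real_derivative (flat (m + 2) t - real m * flat (m + 1) t)) (at t)"
      by (rule DERIV_cong[OF DERIV_mult[OF p e]])
         (use 1 in \<open>simp add: flat_def power_add power2_eq_square algebra_simps\<close>)
    then show ?thesis
      by (rule DERIV_cong_ev[THEN iffD1, rotated 3])
         (use 1 in \<open>auto simp: flat_def eventually_nhds intro!: exI[of _ "{0<..}"]\<close>)
  next
    case 2
    have "((\<lambda>t. 0) has_real_derivative 0) (at t)" by simp
    then show ?thesis
      by (rule DERIV_cong_ev[THEN iffD1, rotated 3])
         (use 2 in \<open>auto simp: flat_def eventually_nhds intro!: exI[of _ "{..<0}"]\<close>)
  next
    case 3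
    \<comment> \<open>From the right, the difference quotient at 0 is the next member of the family,
      which tends to 0.\<close>
    have "((\<lambda>h. (flat m (0 + h) - flat m 0) / h) \<longlongrightarrow> 0) (at_right 0)"
    proof (rule Lim_transform_eventually[OF flat_lim_0[of "Suc m"]])
      show "\<forall>\<^sub>F h in at_right 0. flat (Suc m) h = (flat m (0 + h) - flat m 0) / h"
        using eventually_at_right_less[of 0] by (rule eventually_mono) (simp add: flat_def)
    qed
    moreover have "((\<lambda>h. (flat m (0 + h) - flat m 0) / h) \<longlongrightarrow> 0) (at_left 0)"
    proof (rule Lim_transform_eventually[OF tendsto_const[of 0]])
      show "\<forall>\<^sub>F h in at_left 0. 0 = (flat m (0 + h) - flat m 0) / h"
        using eventually_at_left_real[of "-1" 0] by (auto elim!: eventually_mono simp: flat_def)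
    qed
    ultimately have "((\<lambda>h. (flat m (0 + h) - flat m 0) / h) \<longlongrightarrow> 0) (at 0)"
      by (simp add: filterlim_split_at)
    then show ?thesis using 3 by (simp add: DERIV_def flat_def)
  qed
qed

lemma flat_affine_Ck:
  fixes a :: "'a::euclidean_space"
  shows "Ck n (\<lambda>x. complex_of_real (flat m (a \<bullet> x + d)))"
proof (induction n arbitrary: m)
  case 0
  have c: "continuous_on UNIV (flat m)"
    using flat_has_derivative DERIV_isCont continuous_at_imp_continuous_on by blast
  have "continuous_on UNIV (\<lambda>x. a \<bullet> x + d)" by (intro continuous_intros)
  then have "continuous_on UNIV (\<lambda>x. flat m (a \<bullet> x + d))"
    by (rule continuous_on_compose2[OF c]) simp
  then show ?case by (simp add: continuous_on_of_real)
next
  case (Suc n)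
  have d: "((\<lambda>x. complex_of_real (flat m (a \<bullet> x + d))) has_derivative
     (\<lambda>h. complex_of_real ((flat (m + 2) (a \<bullet> x + d) - real m * flat (m + 1) (a \<bullet> x + d)) * (a \<bullet> h)))) (at x)" for x
    by (intro has_derivative_of_real
        has_derivative_compose[OF _ flat_has_derivative[THEN has_field_derivative_imp_has_derivative]])
       (auto intro!: derivative_eq_intros)
  have "Ck n (\<lambda>x. complex_of_real (a \<bullet> h) * complex_of_real (flat (m + 2) (a \<bullet> x + d))
      + complex_of_real (- real m * (a \<bullet> h)) * complex_of_real (flat (m + 1) (a \<bullet> x + d)))" for h
    by (intro Ck_add Ck_mult Ck_const Suc.IH)
  then have "Ck n (\<lambda>x. complex_of_real ((flat (m + 2) (a \<bullet> x + d) - real m * flat (m + 1) (a \<bullet> x + d)) * (a \<bullet> h)))" for h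
    by (simp add: algebra_simps)
  then show ?case unfolding Ck_Suc_iff[OF d] by blast
qed

section \<open>Density of test functions in L2\<close>

lemma test_functionI:
  assumes "\<And>n. Ck n f" "bounded {x. f x \<noteq> 0}"
  shows "test_function f"
  using assms by (simp add: test_function_def)

lemma test_function_bounded_support: "test_function f \<Longrightarrow> bounded {x. f x \<noteq> 0}"
  by (simp add: test_function_def)

definition approximable :: "('a::euclidean_space \<Rightarrow> complex) \<Rightarrow> bool" where
  "approximable f \<longleftrightarrow> Lp_mem 2 f \<and> (\<forall>e>0. \<exists>\<phi>. test_function \<phi> \<and> Lp_norm 2 (\<lambda>x. \<phi> x - f x) < e)"

lemma test_function_L2: "test_function f \<Longrightarrow> Lp_mem 2 (f :: 'a::euclidean_space \<Rightarrow> complex)"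
  by (rule test_function_Lp) simp_all

lemma approximable_test: "test_function f \<Longrightarrow> approximable f"
  unfolding approximable_def by (auto intro!: exI[of _ f] test_function_L2 simp: L2_norm_eq)

lemma approximable_closed:
  assumes f: "Lp_mem 2 f" and ap: "\<And>e. 0 < e \<Longrightarrow> \<exists>g. approximable g \<and> Lp_norm 2 (\<lambda>x. g x - f x) < e"
  shows "approximable f"
  unfolding approximable_def
proof (intro conjI f allI impI)
  fix e :: real assume e: "0 < e"
  obtain g where g: "approximable g" "Lp_norm 2 (\<lambda>x. g x - f x) < e / 2"
    using ap[of "e / 2"] e by auto
  obtain \<phi> where \<phi>: "test_function \<phi>" "Lp_norm 2 (\<lambda>x. \<phi> x - g x) < e / 2"
    using g(1) e unfolding approximable_def by (meson half_gt_zero)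
  have g2: "Lp_mem 2 g" using g(1) by (simp add: approximable_def)
  have "Lp_norm 2 (\<lambda>x. (\<phi> x - g x) + (g x - f x)) \<le> Lp_norm 2 (\<lambda>x. \<phi> x - g x) + Lp_norm 2 (\<lambda>x. g x - f x)"
    by (intro L2_add(2) L2_diff(1) test_function_L2 \<phi> g2 f)
  then show "\<exists>\<phi>. test_function \<phi> \<and> Lp_norm 2 (\<lambda>x. \<phi> x - f x) < e"
    using \<phi> g(2) by (intro exI[of _ \<phi>]) simp
qed

lemma approximable_add:
  assumes f: "approximable f" and g: "approximable g"
  shows "approximable (\<lambda>x. f x + g x)"
  unfolding approximable_def
proof (intro conjI allI impI)
  have f2: "Lp_mem 2 f" and g2: "Lp_mem 2 g" using f g by (auto simp: approximable_def)
  then show "Lp_mem 2 (\<lambda>x. f x + g x)" by (rule L2_add(1))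
  fix e :: real assume e: "0 < e"
  obtain \<phi> where \<phi>: "test_function \<phi>" "Lp_norm 2 (\<lambda>x. \<phi> x - f x) < e / 2"
    using f e unfolding approximable_def by (meson half_gt_zero)
  obtain \<psi> where \<psi>: "test_function \<psi>" "Lp_norm 2 (\<lambda>x. \<psi> x - g x) < e / 2"
    using g e unfolding approximable_def by (meson half_gt_zero)
  have "test_function (\<lambda>x. \<phi> x + \<psi> x)"
  proof (rule test_functionI)
    show "Ck n (\<lambda>x. \<phi> x + \<psi> x)" for n
      using \<phi>(1) \<psi>(1) by (intro Ck_add) (auto simp: test_function_def)
    have "bounded ({x. \<phi> x \<noteq> 0} \<union> {x. \<psi> x \<noteq> 0})"
      using test_function_bounded_support[OF \<phi>(1)] test_function_bounded_support[OF \<psi>(1)] by simp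
    then show "bounded {x. \<phi> x + \<psi> x \<noteq> 0}"
      by (rule bounded_subset) auto
  qed
  moreover have "Lp_norm 2 (\<lambda>x. (\<phi> x - f x) + (\<psi> x - g x)) \<le> Lp_norm 2 (\<lambda>x. \<phi> x - f x) + Lp_norm 2 (\<lambda>x. \<psi> x - g x)"
    by (intro L2_add(2) L2_diff(1) test_function_L2 \<phi> \<psi> g2 f2)
  ultimately show "\<exists>\<phi>. test_function \<phi> \<and> Lp_norm 2 (\<lambda>x. \<phi> x - (f x + g x)) < e"
    using \<phi>(2) \<psi>(2) by (intro exI[of _ "\<lambda>x. \<phi> x + \<psi> x"]) (simp add: algebra_simps)
qed

lemma approximable_zero: "approximable (\<lambda>x. 0)"
  by (intro approximable_test test_functionI Ck_const) simp

lemma L2_cmult: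
  fixes f :: "'a::euclidean_space \<Rightarrow> complex"
  assumes f: "Lp_mem 2 f"
  shows "Lp_mem 2 (\<lambda>x. c * f x)" "Lp_norm 2 (\<lambda>x. c * f x) = norm c * Lp_norm 2 f"
proof -
  show "Lp_mem 2 (\<lambda>x. c * f x)" using f by (auto simp: L2_mem_iff norm_mult power_mult_distrib)
  show "Lp_norm 2 (\<lambda>x. c * f x) = norm c * Lp_norm 2 f"
    by (simp add: L2_norm_eq norm_mult power_mult_distrib real_sqrt_mult)
qed

lemma approximable_cmult:
  assumes f: "approximable f"
  shows "approximable (\<lambda>x. c * f x)"
proof (cases "c = 0")
  case True
  then show ?thesis by (simp add: approximable_zero)
next
  case False
  have f2: "Lp_mem 2 f" using f by (auto simp: approximable_def)
  show ?thesis unfolding approximable_def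
  proof (intro conjI allI impI)
    show "Lp_mem 2 (\<lambda>x. c * f x)" by (rule L2_cmult(1)[OF f2])
    fix e :: real assume e: "0 < e"
    obtain \<phi> where \<phi>: "test_function \<phi>" "Lp_norm 2 (\<lambda>x. \<phi> x - f x) < e / norm c"
      using f e False unfolding approximable_def by (meson divide_pos_pos zero_less_norm_iff)
    have "test_function (\<lambda>x. c * \<phi> x)"
      using \<phi>(1) test_function_bounded_support[OF \<phi>(1)] False
      by (intro test_functionI Ck_mult Ck_const) (auto simp: test_function_def)
    moreover have "norm c * Lp_norm 2 (\<lambda>x. \<phi> x - f x) < e"
      using \<phi>(2) False by (simp add: pos_less_divide_eq mult.commute)
    then have "Lp_norm 2 (\<lambda>x. c * (\<phi> x - f x)) < e"
      by (simp only: L2_cmult(2)[OF L2_diff(1)[OF test_function_L2[OF \<phi>(1)] f2]])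
    ultimately show "\<exists>\<phi>. test_function \<phi> \<and> Lp_norm 2 (\<lambda>x. \<phi> x - c * f x) < e"
      by (intro exI[of _ "\<lambda>x. c * \<phi> x"]) (simp add: algebra_simps)
  qed
qed

lemma approximable_sum:
  assumes "finite I" "\<And>i. i \<in> I \<Longrightarrow> approximable (f i)"
  shows "approximable (\<lambda>x. \<Sum>i\<in>I. f i x)"
  using assms
  by (induction I rule: finite_induct) (simp_all add: approximable_add approximable_zero)

lemma L2_dominated_convergence:
  fixes u :: "nat \<Rightarrow> 'a::euclidean_space \<Rightarrow> complex"
  assumes u: "\<And>n. u n \<in> borel_measurable borel" and f: "f \<in> borel_measurable borel"
    and h: "integrable lborel (\<lambda>x. (h x)\<^sup>2)"
    and lim: "\<And>x. (\<lambda>n. u n x) \<longlonglongrightarrow> f x" and le: "\<And>n x. norm (u n x) \<le> h x"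
  shows "Lp_mem 2 f" "(\<lambda>n. Lp_norm 2 (\<lambda>x. u n x - f x)) \<longlonglongrightarrow> 0"
proof -
  note [measurable] = u f
  have lef: "norm (f x) \<le> h x" for x
    by (rule Lim_bounded[OF tendsto_norm[OF lim[of x]], of 0]) (auto intro: le)
  have "integrable lborel (\<lambda>x. (norm (f x))\<^sup>2)"
    by (rule Bochner_Integration.integrable_bound[OF h]) (auto intro!: AE_I2 power_mono lef)
  then show "Lp_mem 2 f" using f by (simp add: L2_mem_iff)
  have "(\<lambda>n. \<integral>x. (norm (u n x - f x))\<^sup>2 \<partial>lborel) \<longlonglongrightarrow> (\<integral>x. 0 \<partial>(lborel :: 'a measure))"
  proof (rule integral_dominated_convergence[OF _ _ integrable_mult_right[OF h, of 4]])
    show "AE x in lborel. (\<lambda>n. (norm (u n x - f x))\<^sup>2) \<longlonglongrightarrow> 0"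
    proof (rule AE_I2)
      fix x
      have "(\<lambda>n. (norm (u n x - f x))\<^sup>2) \<longlonglongrightarrow> (norm (f x - f x))\<^sup>2"
        by (intro tendsto_intros lim)
      then show "(\<lambda>n. (norm (u n x - f x))\<^sup>2) \<longlonglongrightarrow> 0" by simp
    qed
    show "AE x in lborel. norm ((norm (u n x - f x))\<^sup>2) \<le> 4 * (h x)\<^sup>2" for n
    proof (rule AE_I2)
      fix x
      have "norm (u n x - f x) \<le> 2 * h x"
        using norm_triangle_ineq4[of "u n x" "f x"] le[of n x] lef[of x] by linarith
      then have "(norm (u n x - f x))\<^sup>2 \<le> (2 * h x)\<^sup>2" by (intro power_mono) auto
      then show "norm ((norm (u n x - f x))\<^sup>2) \<le> 4 * (h x)\<^sup>2" by (simp add: power_mult_distrib)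
    qed
  qed measurable
  then have "(\<lambda>n. sqrt (\<integral>x. (norm (u n x - f x))\<^sup>2 \<partial>lborel)) \<longlonglongrightarrow> sqrt 0"
    by (intro tendsto_real_sqrt) simp
  then show "(\<lambda>n. Lp_norm 2 (\<lambda>x. u n x - f x)) \<longlonglongrightarrow> 0" by (simp add: L2_norm_eq)
qed

lemma approximable_limit:
  fixes u :: "nat \<Rightarrow> 'a::euclidean_space \<Rightarrow> complex"
  assumes u: "\<And>n. approximable (u n)" and f: "f \<in> borel_measurable borel"
    and h: "integrable lborel (\<lambda>x. (h x)\<^sup>2)"
    and lim: "\<And>x. (\<lambda>n. u n x) \<longlonglongrightarrow> f x" and le: "\<And>n x. norm (u n x) \<le> h x"
  shows "approximable f"
proof -
  have um: "u n \<in> borel_measurable borel" for n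
    using u[of n] by (auto simp: approximable_def L2_mem_iff)
  note D = L2_dominated_convergence[OF um f h lim le]
  show ?thesis
  proof (rule approximable_closed[OF D(1)])
    fix e :: real assume "0 < e"
    then have "eventually (\<lambda>n. Lp_norm 2 (\<lambda>x. u n x - f x) < e) sequentially"
      using D(2) order_tendstoD(2) by blast
    then show "\<exists>g. approximable g \<and> Lp_norm 2 (\<lambda>x. g x - f x) < e"
      using u by (auto simp: eventually_sequentially)
  qed
qed

text \<open>Each coordinate contributes two cut-offs in the distances to the faces, dilated by n+1,
  so inside the box every factor tends to exp(0) = 1. The affine form of the arguments is the one
  for which smoothness has been shown.\<close>

definition box_bump :: "'a::euclidean_space \<Rightarrow> 'a \<Rightarrow> nat \<Rightarrow> 'a \<Rightarrow> complex" where
  "box_bump l u n x = (\<Prod>b\<in>Basis.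
     complex_of_real (flat 0 ((real (Suc n) *\<^sub>R b) \<bullet> x + - (real (Suc n) * (l \<bullet> b))))
     * complex_of_real (flat 0 ((- real (Suc n) *\<^sub>R b) \<bullet> x + real (Suc n) * (u \<bullet> b))))"

lemma flat_nonpos: "t \<le> 0 \<Longrightarrow> flat m t = 0"
  by (simp add: flat_def)

lemma flat_0_bounds: "0 \<le> flat 0 t" "flat 0 t \<le> 1"
  by (auto simp: flat_def)

lemma box_bump_outside: "x \<notin> box l u \<Longrightarrow> box_bump l u n x = 0"
proof -
  assume "x \<notin> box l u"
  then obtain b where b: "b \<in> Basis" "\<not> (l \<bullet> b < x \<bullet> b) \<or> \<not> (x \<bullet> b < u \<bullet> b)" by (auto simp: box_def)
  have le: "real (Suc n) * p \<le> real (Suc n) * q" if "p \<le> q" for p q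
    using that by (intro mult_left_mono) auto
  have "flat 0 ((real (Suc n) *\<^sub>R b) \<bullet> x + - (real (Suc n) * (l \<bullet> b))) = 0 \<or>
    flat 0 ((- real (Suc n) *\<^sub>R b) \<bullet> x + real (Suc n) * (u \<bullet> b)) = 0"
    using b(2) le[of "x \<bullet> b" "l \<bullet> b"] le[of "u \<bullet> b" "x \<bullet> b"]
    by (auto simp: inner_commute[of b x] simp del: of_nat_Suc intro!: flat_nonpos)
  then show ?thesis unfolding box_bump_def using b(1) by (intro prod_zero) auto
qed

lemma box_bump_test: "test_function (box_bump l u n)"
proof (rule test_functionI)
  show "Ck k (box_bump l u n)" for k
    unfolding box_bump_def[abs_def] by (intro Ck_prod Ck_mult flat_affine_Ck) auto
  show "bounded {x. box_bump l u n x \<noteq> 0}"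
    by (rule bounded_subset[OF bounded_box[of l u]]) (use box_bump_outside in auto)
qed

lemma box_bump_le: "norm (box_bump l u n x) \<le> indicator (box l u) x"
proof (cases "x \<in> box l u")
  case True
  have "norm (box_bump l u n x) \<le> (\<Prod>b\<in>(Basis::'a set). 1)"
    unfolding box_bump_def prod_norm[symmetric] norm_mult norm_of_real
    by (intro prod_mono) (auto simp: abs_of_nonneg flat_0_bounds intro!: mult_le_one)
  then show ?thesis using True by simp
qed (simp add: box_bump_outside)

lemma flat_0_dilate_lim:
  assumes "0 < c"
  shows "(\<lambda>n. flat 0 (real (Suc n) * c)) \<longlonglongrightarrow> 1"
proof -
  have "(\<lambda>n. exp (- (inverse (real (Suc n)) * (1 / c)))) \<longlonglongrightarrow> exp (- (0 * (1 / c)))"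
    by (intro tendsto_intros LIMSEQ_inverse_real_of_nat)
  moreover have "flat 0 (real (Suc n) * c) = exp (- (inverse (real (Suc n)) * (1 / c)))" for n
    using assms by (simp add: flat_def divide_inverse)
  ultimately show ?thesis by simp
qed

lemma box_bump_lim: "(\<lambda>n. box_bump l u n x) \<longlonglongrightarrow> indicator (box l u) x"
proof (cases "x \<in> box l u")
  case True
  have "(\<lambda>n. box_bump l u n x) \<longlonglongrightarrow> (\<Prod>b\<in>(Basis::'a set). complex_of_real 1 * complex_of_real 1)"
    unfolding box_bump_def
  proof (intro tendsto_prod tendsto_mult tendsto_of_real)
    fix b :: 'a assume b: "b \<in> Basis"
    have "0 < x \<bullet> b - l \<bullet> b" "0 < u \<bullet> b - x \<bullet> b" using True b by (auto simp: box_def)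
    from this[THEN flat_0_dilate_lim]
    show "(\<lambda>n. flat 0 ((real (Suc n) *\<^sub>R b) \<bullet> x + - (real (Suc n) * (l \<bullet> b)))) \<longlonglongrightarrow> 1"
      "(\<lambda>n. flat 0 ((- real (Suc n) *\<^sub>R b) \<bullet> x + real (Suc n) * (u \<bullet> b))) \<longlonglongrightarrow> 1"
      by (simp_all only: inner_scaleR_left inner_commute[of b x] right_diff_distrib)
         (simp_all add: algebra_simps)
  qed
  then show ?thesis using True by simp
qed (simp add: box_bump_outside)

lemma indicator_bounded_square_integrable:
  fixes A :: "'a::euclidean_space set"
  assumes "A \<in> sets borel" "bounded A"
  shows "integrable lborel (\<lambda>x. (indicator A x :: real)\<^sup>2)"
proof -
  have "(\<lambda>x. (indicator A x :: real)\<^sup>2) = indicator A" by (auto simp: indicator_def)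
  then show ?thesis using assms emeasure_bounded_finite[of A] by (auto intro!: integrable_real_indicator)
qed

lemma approximable_box: "approximable (indicator (box l u))"
  by (rule approximable_limit[OF approximable_test[OF box_bump_test] _ _ box_bump_lim box_bump_le])
     (auto intro: indicator_bounded_square_integrable)

text \<open>Induction over the intersection-stable generator of boxes. Intersecting with one fixed
  box keeps all measures finite, so complements can be formed and the box indicator dominates
  disjoint unions.\<close>

lemma approximable_indicator:
  fixes A :: "'a::euclidean_space set"
  assumes "A \<in> sets borel"
  shows "approximable (indicator (A \<inter> box l u) :: 'a \<Rightarrow> complex)"
proof -
  have bd: "integrable lborel (\<lambda>x. (indicator (box l u) x :: real)\<^sup>2)"
    by (rule indicator_bounded_square_integrable) auto
  have "Int_stable (range (\<lambda>(a, b). box a (b::'a)))"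
    by (auto simp: Int_stable_def box_Int_box)
  moreover have "range (\<lambda>(a, b). box a (b::'a)) \<subseteq> Pow UNIV" by simp
  moreover have "A \<in> sigma_sets UNIV (range (\<lambda>(a, b). box a (b::'a)))"
    using assms by (simp add: borel_eq_box)
  ultimately show ?thesis
  proof (induction A rule: sigma_sets_induct_disjoint)
    case (basic A)
    then show ?case by (auto simp: box_Int_box intro!: approximable_box)
  next
    case empty
    then show ?case using approximable_test[OF test_functionI[OF Ck_const[of _ 0]]] by (simp add: indicator_def[abs_def])
  next
    case (compl A)
    have "(indicator ((UNIV - A) \<inter> box l u) :: 'a \<Rightarrow> complex)
        = (\<lambda>x. indicator (box l u) x + (-1) * indicator (A \<inter> box l u) x)"
      by (auto simp: indicator_def)
    then show ?case using approximable_add[OF approximable_box approximable_cmult[OF compl(2)]] by (simp only:)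
  next
    case (union A)
    have Am: "A i \<in> sets borel" for i using union(2) by (auto simp: borel_eq_box)
    show ?case
    proof (rule approximable_limit[where h="indicator (box l u)"])
      show "approximable (\<lambda>x. \<Sum>i<n. indicator (A i \<inter> box l u) x :: complex)" for n
        by (intro approximable_sum union) auto
      have dj: "disjoint_family (\<lambda>i. A i \<inter> box l u)"
        using union(1) by (auto simp: disjoint_family_on_def)
      have sum_eq: "(\<Sum>i<n. indicator (A i \<inter> box l u) x) = (indicator (\<Union>i<n. A i \<inter> box l u) x :: complex)" for n x
        by (rule indicator_UN_disjoint[symmetric]) (auto intro: disjoint_family_on_mono[OF _ dj])
      show "norm (\<Sum>i<n. indicator (A i \<inter> box l u) x :: complex) \<le> indicator (box l u) x" for n x
        unfolding sum_eq by (auto simp: indicator_def)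
      show "(\<lambda>n. \<Sum>i<n. indicator (A i \<inter> box l u) x :: complex) \<longlonglongrightarrow> indicator (\<Union> (range A) \<inter> box l u) x" for x
      proof -
        have "(\<lambda>n. indicator (\<Union>i<n. A i \<inter> box l u) x :: complex) \<longlonglongrightarrow> indicator (\<Union>i. A i \<inter> box l u) x"
          by (rule LIMSEQ_indicator_UN)
        then show ?thesis unfolding sum_eq by simp
      qed
    qed (use Am bd in auto)
  qed
qed

theorem test_functions_dense:
  fixes f :: "'a::euclidean_space \<Rightarrow> complex"
  assumes f: "Lp_mem 2 f"
  shows "approximable f"
proof -
  have fm: "f \<in> borel_measurable borel" by (rule L2_measurable[OF f])
  obtain F where F: "\<And>i. simple_function lborel (F i)" "\<And>x. (\<lambda>i. F i x) \<longlonglongrightarrow> f x"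
    "\<And>i x. norm (F i x) \<le> 2 * norm (f x)"
    using borel_measurable_implies_sequence_metric[of f lborel 0] fm by auto
  \<comment> \<open>-w n and w n are the corners of the cube of side 2n; these cubes exhaust the
    space, and cutting the simple functions to them puts each level set inside a box.\<close>
  define w where "w n = real n *\<^sub>R (\<Sum>b\<in>Basis. b :: 'a)" for n :: nat
  have w: "w n \<bullet> b = real n" if "b \<in> Basis" for n b
    using that by (simp add: w_def inner_sum_left inner_Basis if_distrib cong: if_cong)
  define u where "u n x = F n x * indicator (box (- w n) (w n)) x" for n x
  show ?thesis
  proof (rule approximable_limit[where u=u and h="\<lambda>x. 2 * norm (f x)"])
    show "approximable (u n)" for n
    proof -
      have fin: "finite (range (F n))" using F(1)[of n] by (simp add: simple_function_def)
      have "u n x = (\<Sum>y\<in>range (F n). y * indicator ((F n -` {y}) \<inter> box (- w n) (w n)) x)" for x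
      proof -
        have "(\<Sum>y\<in>range (F n). y * indicator ((F n -` {y}) \<inter> box (- w n) (w n)) x)
          = (\<Sum>y\<in>range (F n). if y = F n x then y * indicator (box (- w n) (w n)) x else 0)"
          by (intro sum.cong) (auto simp: indicator_def)
        then show ?thesis using fin by (simp add: u_def)
      qed
      then have eq: "u n = (\<lambda>x. \<Sum>y\<in>range (F n). y * indicator ((F n -` {y}) \<inter> box (- w n) (w n)) x)" ..
      have "F n -` {y} \<in> sets borel" for y
        using simple_functionD(2)[OF F(1)[of n], of "{y}"] by simp
      then show ?thesis
        unfolding eq by (intro approximable_sum fin approximable_cmult approximable_indicator)
    qed
    show "f \<in> borel_measurable borel" by (rule fm)
    show "integrable lborel (\<lambda>x. (2 * norm (f x))\<^sup>2)"
      using f by (auto simp: power_mult_distrib L2_mem_iff)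
    show "norm (u n x) \<le> 2 * norm (f x)" for n x
      using F(3)[of n x] by (auto simp: u_def indicator_def)
    show "(\<lambda>n. u n x) \<longlonglongrightarrow> f x" for x
    proof (rule Lim_transform_eventually[OF F(2)])
      have "x \<in> box (- w n) (w n)" if "norm x < real n" for n
      proof -
        have "\<bar>x \<bullet> b\<bar> < real n" if "b \<in> Basis" for b
          using Basis_le_norm[OF that, of x] \<open>norm x < real n\<close> by simp
        then show ?thesis by (simp add: box_def w abs_less_iff minus_less_iff)
      qed
      moreover have "\<forall>\<^sub>F n in sequentially. norm x < real n"
        using filterlim_real_sequentially by (simp add: filterlim_at_top_dense)
      ultimately show "\<forall>\<^sub>F n in sequentially. F n x = u n x"
        by (auto elim!: eventually_mono simp: u_def)
    qed
  qed
qed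

text \<open>The pairing bound holds for test functions, which approximate the conjugate of g. Since
  g is already known to lie in L2, this gives N^2 <= A N, and N may be cancelled.\<close>

theorem dipole_conv_bound:
  assumes d: "dipole_conv j k f g"
  shows "Lp_norm 2 g \<le> CZ_const * Lp_norm 2 f"
proof -
  have g: "Lp_mem 2 g" using d by (simp add: dipole_conv_def)
  define h where "h x = cnj (g x)" for x
  have h: "Lp_mem 2 h" using g unfolding h_def by (auto simp: L2_mem_iff intro: measurable_compose[OF _ cnj_measurable])
  have hn: "Lp_norm 2 h = Lp_norm 2 g" by (simp add: L2_norm_eq h_def)
  let ?A = "CZ_const * Lp_norm 2 f" and ?N = "Lp_norm 2 g"
  \<comment> \<open>Replacing the conjugate h by \<phi> costs A e, because |\<phi>| has norm at most
    N + e, and N e for the remainder paired with g.\<close>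
  have le: "?N\<^sup>2 \<le> ?A * ?N + (?A + ?N) * e" if e: "0 < e" for e
  proof -
    obtain \<phi> where \<phi>: "test_function \<phi>" "Lp_norm 2 (\<lambda>x. \<phi> x - h x) < e"
      using test_functions_dense[OF h] e by (auto simp: approximable_def)
    note \<phi>2 = test_function_L2[OF \<phi>(1)]
    note \<delta> = L2_diff[OF \<phi>2 h]
    have int: "integrable lborel (\<lambda>x. g x * q x)" if "Lp_mem 2 q" for q :: "R3 \<Rightarrow> complex"
    proof -
      note [measurable] = L2_measurable[OF g] L2_measurable[OF that]
      show ?thesis
        by (rule Bochner_Integration.integrable_bound[OF L2_Cauchy_Schwarz(1)[OF g that]])
           (auto simp: norm_mult)
    qed
    have "(\<integral>x. g x * h x \<partial>lborel) = complex_of_real (\<integral>x. (norm (g x))\<^sup>2 \<partial>lborel)"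
      by (simp add: h_def complex_norm_square[symmetric] flip: of_real_power)
    then have "?N\<^sup>2 = norm (\<integral>x. g x * h x \<partial>lborel)" by (simp add: L2_norm_eq)
    also have "(\<integral>x. g x * h x \<partial>lborel) = (\<integral>x. g x * \<phi> x - g x * (\<phi> x - h x) \<partial>lborel)"
      by (simp add: algebra_simps)
    also have "\<dots> = (\<integral>x. g x * \<phi> x \<partial>lborel) - (\<integral>x. g x * (\<phi> x - h x) \<partial>lborel)"
      by (rule Bochner_Integration.integral_diff[OF int[OF \<phi>2] int[OF \<delta>(1)]])
    also have "norm \<dots> \<le> ?A * Lp_norm 2 \<phi> + ?N * Lp_norm 2 (\<lambda>x. \<phi> x - h x)"
      by (intro order_trans[OF norm_triangle_ineq4] add_mono dipole_conv_pairing[OF d \<phi>(1)] L2_pairing_le g \<delta>)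
    also have "\<dots> \<le> ?A * (?N + e) + ?N * e"
      using \<delta>(3) \<phi>(2) hn by (intro add_mono mult_left_mono) auto
    finally show ?thesis by (simp add: algebra_simps)
  qed
  have "?N\<^sup>2 \<le> ?A * ?N"
  proof (rule field_le_epsilon)
    fix e :: real assume e: "0 < e"
    define c where "c = e / (?A + ?N + 1)"
    have p: "0 < ?A + ?N + 1" by (simp add: add_nonneg_pos)
    have c: "0 < c" using e p by (simp add: c_def)
    have "(?A + ?N) * c \<le> (?A + ?N + 1) * c" using c by (intro mult_right_mono) auto
    also have "\<dots> = e" using p by (simp add: c_def)
    finally show "?N\<^sup>2 \<le> ?A * ?N + e" using le[OF c] by simp
  qed
  then show ?thesis
    using Lp_norm_nonneg[of 2 g]
    by (cases "?N = 0") (auto simp: power2_eq_square mult_le_cancel_right less_le)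
qed


section \<open>The field\<close>

lemma norm_vec_le_sum: "norm (x :: complex ^ 'n) \<le> (\<Sum>i\<in>UNIV. norm (x $ i))"
  unfolding norm_vec_def by (rule L2_set_le_sum) simp

lemma borel_measurable_vec_lambda:
  fixes f :: "'a \<Rightarrow> complex ^ 'n"
  assumes [measurable]: "\<And>i. (\<lambda>x. f x $ i) \<in> borel_measurable M"
  shows "f \<in> borel_measurable M"
proof (subst borel_measurable_euclidean_space, rule ballI)
  fix b :: "complex ^ 'n" assume "b \<in> Basis"
  then obtain i u where "b = axis i u" by (auto simp: Basis_vec_def)
  then show "(\<lambda>x. f x \<bullet> b) \<in> borel_measurable M" by (simp add: inner_axis)
qed

lemma norm_riesz_conv_le:
  assumes [measurable]: "f \<in> borel_measurable borel"
  shows "ennreal (norm (riesz_conv j f x)) \<le> riesz_maj f x"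
proof (cases "integrable lborel (\<lambda>y. ((x - y) $ j / norm (x - y) ^ 3) *\<^sub>R f y)")
  case True
  have "ennreal (norm (riesz_conv j f x)) \<le> (\<integral>\<^sup>+y. ennreal (norm (((x - y) $ j / norm (x - y) ^ 3) *\<^sub>R f y)) \<partial>lborel)"
    unfolding riesz_conv_def by (rule integral_norm_bound_ennreal[OF True])
  also have "\<dots> \<le> riesz_maj f x"
    unfolding riesz_maj_def
  proof (intro nn_integral_mono ennreal_leI)
    fix y
    have "\<bar>(x - y) $ j / norm (x - y) ^ 3\<bar> * norm (f y) \<le> 1 / (norm (x - y))\<^sup>2 * norm (f y)"
      by (intro mult_right_mono riesz_kernel_le) auto
    then show "norm (((x - y) $ j / norm (x - y) ^ 3) *\<^sub>R f y) \<le> norm (f y) / (norm (x - y))\<^sup>2" by simp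
  qed
  finally show ?thesis .
next
  case False
  then show ?thesis by (simp add: riesz_conv_def not_integrable_integral_eq)
qed

text \<open>The 3 comes from summing the components of the vector kernel; adding 1 ensures strict
  positivity.\<close>

definition E0_const :: real where
  "E0_const = 3 * \<bar>lam\<bar> * HLS_const + 1"

lemma E0_const_pos: "0 < E0_const"
  by (simp add: E0_const_def add_nonneg_pos)

theorem E0_field_bound:
  assumes \<rho>: "Lp_mem (6/5) (free_density w0 t)"
  shows "Lp_mem 2 (E0_field w0 t)"
    and "Lp_norm 2 (E0_field w0 t) \<le> E0_const * Lp_norm (6/5) (free_density w0 t)"
proof -
  let ?\<rho> = "free_density w0 t"
  have [measurable]: "?\<rho> \<in> borel_measurable borel" using \<rho> by (simp add: Lp_mem_def)
  have m: "E0_field w0 t \<in> borel_measurable borel"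
    by (rule borel_measurable_vec_lambda) (simp add: E0_field_def riesz_conv_def)
  let ?c = "3 * \<bar>lam\<bar>"
  have pw: "ennreal ((norm (E0_field w0 t x))\<^sup>2) \<le> ennreal (?c\<^sup>2) * (riesz_maj ?\<rho> x)\<^sup>2" for x
  proof -
    have "norm (E0_field w0 t x) \<le> (\<Sum>j\<in>UNIV. norm (E0_field w0 t x $ j))" by (rule norm_vec_le_sum)
    also have "\<dots> = \<bar>lam\<bar> * (\<Sum>j\<in>UNIV. norm (riesz_conv j ?\<rho> x))"
      by (simp add: E0_field_def sum_distrib_left)
    finally have "ennreal (norm (E0_field w0 t x)) \<le> ennreal \<bar>lam\<bar> * (\<Sum>j\<in>UNIV. ennreal (norm (riesz_conv j ?\<rho> x)))"
      by (subst sum_ennreal) (auto simp: ennreal_mult'[symmetric] intro!: ennreal_leI)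
    also have "\<dots> \<le> ennreal \<bar>lam\<bar> * (\<Sum>j\<in>(UNIV::3 set). riesz_maj ?\<rho> x)"
      by (intro mult_left_mono sum_mono norm_riesz_conv_le) auto
    also have "\<dots> = ennreal ?c * riesz_maj ?\<rho> x" by (simp add: ennreal_mult' mult_ac)
    finally have "(ennreal (norm (E0_field w0 t x)))\<^sup>2 \<le> (ennreal ?c * riesz_maj ?\<rho> x)\<^sup>2"
      by (rule power_mono) simp
    then show ?thesis by (simp add: ennreal_power power_mult_distrib)
  qed
  have "(\<integral>\<^sup>+x. ennreal ((norm (E0_field w0 t x))\<^sup>2) \<partial>lborel) \<le> (\<integral>\<^sup>+x. ennreal (?c\<^sup>2) * (riesz_maj ?\<rho> x)\<^sup>2 \<partial>lborel)"
    by (intro nn_integral_mono pw)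
  also have "\<dots> = ennreal (?c\<^sup>2) * (\<integral>\<^sup>+x. (riesz_maj ?\<rho> x)\<^sup>2 \<partial>lborel)"
    by (rule nn_integral_cmult) measurable
  also have "\<dots> \<le> ennreal (?c\<^sup>2) * ennreal ((HLS_const * Lp_norm (6/5) ?\<rho>)\<^sup>2)"
    by (intro mult_left_mono Hardy_Littlewood_Sobolev[OF \<rho>]) auto
  also have "\<dots> = ennreal ((?c * HLS_const * Lp_norm (6/5) ?\<rho>)\<^sup>2)"
    by (subst ennreal_mult[symmetric]) (auto simp: power_mult_distrib)
  finally have le: "(\<integral>\<^sup>+x. ennreal ((norm (E0_field w0 t x))\<^sup>2) \<partial>lborel) \<le> ennreal ((?c * HLS_const * Lp_norm (6/5) ?\<rho>)\<^sup>2)" .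
  show "Lp_mem 2 (E0_field w0 t)" by (rule L2_nn_integral_le(1)[OF m _ le]) simp
  have "Lp_norm 2 (E0_field w0 t) \<le> ?c * HLS_const * Lp_norm (6/5) ?\<rho>"
    by (rule L2_nn_integral_le(2)[OF m _ le]) simp
  also have "\<dots> \<le> E0_const * Lp_norm (6/5) ?\<rho>"
    by (intro mult_right_mono) (auto simp: E0_const_def)
  finally show "Lp_norm 2 (E0_field w0 t) \<le> E0_const * Lp_norm (6/5) ?\<rho>" .
qed

section \<open>From the integral equation to a scalar inequality for E1\<close>

lemma L2_integral_bound:
  assumes I: "L2_integral t g F" and le: "\<And>s. s \<in> {0<..<t} \<Longrightarrow> Lp_norm 2 (g s) \<le> m s"
    and m: "set_integrable lborel {0<..<t} m"
  shows "Lp_norm 2 F \<le> (LINT s:{0<..<t}|lborel. m s)"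
proof -
  have F: "Lp_mem 2 F" and g: "\<And>s. s \<in> {0<..<t} \<Longrightarrow> Lp_mem 2 (g s)"
    using I by (auto simp: L2_integral_def)
  \<comment> \<open>Minkowski's inequality by duality: pairing F with its conjugate gives the
    squared norm, and each slice is bounded by Cauchy-Schwarz. The majorant m stands in for the
    slice norms, whose measurability in s is not part of \<open>L2_integral\<close>.\<close>
  define h where "h x = cnj (F x)" for x
  have h: "Lp_mem 2 h" using F unfolding h_def by (auto simp: L2_mem_iff intro: measurable_compose[OF _ cnj_measurable])
  have hn: "Lp_norm 2 h = Lp_norm 2 F" by (simp add: L2_norm_eq h_def)
  let ?N = "Lp_norm 2 F"
  have si: "set_integrable lborel {0<..<t} (\<lambda>s. \<integral>x. g s x * h x \<partial>lborel)"
    and eq: "(\<integral>x. F x * h x \<partial>lborel) = (LINT s:{0<..<t}|lborel. (\<integral>x. g s x * h x \<partial>lborel))"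
    using I h unfolding L2_integral_def by blast+
  have "(\<integral>x. F x * h x \<partial>lborel) = complex_of_real (\<integral>x. (norm (F x))\<^sup>2 \<partial>lborel)"
    by (simp add: h_def complex_norm_square[symmetric] flip: of_real_power)
  then have "?N\<^sup>2 = norm (\<integral>x. F x * h x \<partial>lborel)" by (simp add: L2_norm_eq)
  also have "\<dots> \<le> (LINT s:{0<..<t}|lborel. norm (\<integral>x. g s x * h x \<partial>lborel))"
    unfolding eq by (rule set_integral_norm_bound[OF si])
  also have "\<dots> \<le> (LINT s:{0<..<t}|lborel. m s * ?N)"
  proof (rule set_integral_mono)
    show "set_integrable lborel {0<..<t} (\<lambda>s. norm (\<integral>x. g s x * h x \<partial>lborel))"
      by (rule set_integrable_norm[OF si])
    show "set_integrable lborel {0<..<t} (\<lambda>s. m s * ?N)"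
      by (rule set_integrable_mult_left) (rule m)
    fix s assume s: "s \<in> {0<..<t}"
    have "norm (\<integral>x. g s x * h x \<partial>lborel) \<le> Lp_norm 2 (g s) * Lp_norm 2 h"
      by (rule L2_pairing_le[OF g[OF s] h])
    also have "\<dots> \<le> m s * ?N" unfolding hn by (intro mult_right_mono le s) simp
    finally show "norm (\<integral>x. g s x * h x \<partial>lborel) \<le> m s * ?N" .
  qed
  also have "\<dots> = (LINT s:{0<..<t}|lborel. m s) * ?N" by simp
  finally have "?N\<^sup>2 \<le> (LINT s:{0<..<t}|lborel. m s) * ?N" .
  moreover have "0 \<le> m s" if "s \<in> {0<..<t}" for s
    by (rule order_trans[OF Lp_norm_nonneg le[OF that]])
  then have "0 \<le> (LINT s:{0<..<t}|lborel. m s)"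
    unfolding set_lebesgue_integral_def by (intro integral_nonneg_AE AE_I2) (auto simp: indicator_def)
  ultimately show ?thesis
    using Lp_norm_nonneg[of 2 F]
    by (cases "?N = 0") (auto simp: power2_eq_square mult_le_cancel_right less_le)
qed

lemma L2_sum:
  fixes f :: "'i \<Rightarrow> 'a::euclidean_space \<Rightarrow> complex"
  assumes "finite I" "\<And>i. i \<in> I \<Longrightarrow> Lp_mem 2 (f i)"
  shows "Lp_mem 2 (\<lambda>x. \<Sum>i\<in>I. f i x) \<and> Lp_norm 2 (\<lambda>x. \<Sum>i\<in>I. f i x) \<le> (\<Sum>i\<in>I. Lp_norm 2 (f i))"
  using assms
proof (induction I rule: finite_induct)
  case empty
  show ?case by (simp add: L2_mem_iff L2_norm_eq)
next
  case (insert i I)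
  then have IH: "Lp_mem 2 (\<lambda>x. \<Sum>i\<in>I. f i x)" "Lp_norm 2 (\<lambda>x. \<Sum>i\<in>I. f i x) \<le> (\<Sum>i\<in>I. Lp_norm 2 (f i))"
    and fi: "Lp_mem 2 (f i)" by auto
  show ?case using L2_add[OF fi IH(1)] IH(2) insert.hyps by simp
qed

lemma L2_vec_norm_le:
  fixes E :: "'a::euclidean_space \<Rightarrow> complex ^ 'n"
  assumes E: "Lp_mem 2 E"
  shows "Lp_norm 2 E \<le> (\<Sum>j\<in>UNIV. Lp_norm 2 (\<lambda>x. E x $ j))"
proof -
  have nE: "Lp_mem 2 (\<lambda>x. complex_of_real (norm (E x $ j)))" "Lp_norm 2 (\<lambda>x. complex_of_real (norm (E x $ j))) = Lp_norm 2 (\<lambda>x. E x $ j)" for j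
    using vec_nth_L2(1)[OF E, of j] by (auto simp: L2_mem_iff L2_norm_eq)
  define S where "S x = (\<Sum>j\<in>UNIV. complex_of_real (norm (E x $ j)))" for x
  have S: "Lp_mem 2 S" "Lp_norm 2 S \<le> (\<Sum>j\<in>UNIV. Lp_norm 2 (\<lambda>x. E x $ j))"
    using L2_sum[of UNIV "\<lambda>j x. complex_of_real (norm (E x $ j))"] nE by (auto simp: S_def[abs_def])
  have "norm (E x) \<le> norm (S x)" for x
  proof -
    have "S x = complex_of_real (\<Sum>j\<in>UNIV. norm (E x $ j))" by (simp add: S_def)
    then have "norm (S x) = (\<Sum>j\<in>UNIV. norm (E x $ j))" by (simp only: norm_of_real) (simp add: sum_nonneg)
    then show ?thesis using norm_vec_le_sum[of "E x"] by simp
  qed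
  then have "(\<integral>\<^sup>+x. ennreal ((norm (E x))\<^sup>2) \<partial>lborel) \<le> (\<integral>\<^sup>+x. ennreal ((norm (S x))\<^sup>2) \<partial>lborel)"
    by (intro nn_integral_mono ennreal_leI power_mono) auto
  then have "Lp_norm 2 E \<le> Lp_norm 2 S"
    unfolding L2_nn_integral[OF S(1)]
    by (rule L2_nn_integral_le(2)[OF L2_measurable[OF E] Lp_norm_nonneg])
  with S(2) show ?thesis by simp
qed

text \<open>Three components j times three summands k, each bounded through the dipole
  convolution.\<close>

definition E1_factor :: real where
  "E1_factor = 9 * \<bar>lam\<bar> * CZ_const"

lemma E1_factor_nonneg [simp]: "0 \<le> E1_factor"
  by (simp add: E1_factor_def)

text \<open>The weight s in the moment improves the dispersive factor s^(-3/2) to s^(-1/2), which is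
  integrable at s = 0.\<close>

lemma Gamma_moment_bound:
  assumes G: "Gamma_moment E w t k F"
    and m: "set_integrable lborel {0<..<t} m"
    and le: "\<And>s. s \<in> {0<..<t} \<Longrightarrow> s powr (-1/2) * Lp_norm 2 (E (t - s)) * Lp_norm 2 (w (t - s)) \<le> m s"
  shows "Lp_norm 2 F \<le> (LINT s:{0<..<t}|lborel. m s)"
proof -
  obtain G where G: "\<And>s. s \<in> {0<..<t} \<Longrightarrow> Gamma_average_L2 s (E (t - s)) (w (t - s)) k (G s)"
    and I: "L2_integral t (\<lambda>s x. s *\<^sub>R G s x) F"
    using G unfolding Gamma_moment_def by blast
  show ?thesis
  proof (rule L2_integral_bound[OF I _ m])
    fix s assume s: "s \<in> {0<..<t}"
    then have s0: "0 < s" by simp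
    note b = Gamma_average_L2_bound[OF s0 G[OF s]]
    have "Lp_norm 2 (\<lambda>x. s *\<^sub>R G s x) = s * Lp_norm 2 (G s)"
      using s0 by (simp add: L2_scaleR(2)[OF b(1)])
    also have "\<dots> \<le> s * (s powr (-3/2) * Lp_norm 2 (E (t - s)) * Lp_norm 2 (w (t - s)))"
      using s0 b(2) by (intro mult_left_mono) auto
    also have "\<dots> = (s powr 1 * s powr (-3/2)) * Lp_norm 2 (E (t - s)) * Lp_norm 2 (w (t - s))"
      using s0 by simp
    also have "s powr 1 * s powr (-3/2) = s powr (-1/2)"
      by (subst powr_add[symmetric]) simp
    also have "s powr (-1/2) * Lp_norm 2 (E (t - s)) * Lp_norm 2 (w (t - s)) \<le> m s" by (rule le[OF s])
    finally show "Lp_norm 2 (\<lambda>x. s *\<^sub>R G s x) \<le> m s" .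
  qed
qed

lemma E1_step:
  assumes eq: "E1_equation T w0 w E1" and t: "t \<in> {0<..T}" and E1: "Lp_mem 2 (E1 t)"
    and m: "set_integrable lborel {0<..<t} m"
    and le: "\<And>s. s \<in> {0<..<t} \<Longrightarrow>
      s powr (-1/2) * Lp_norm 2 (\<lambda>x. E0_field w0 (t - s) x + E1 (t - s) x) * Lp_norm 2 (w (t - s)) \<le> m s"
  shows "Lp_norm 2 (E1 t) \<le> E1_factor * (LINT s:{0<..<t}|lborel. m s)"
proof -
  let ?I = "LINT s:{0<..<t}|lborel. m s"
  obtain F H where F: "\<And>k. Gamma_moment (\<lambda>\<tau> x. E0_field w0 \<tau> x + E1 \<tau> x) w t k (F k)"
    and H: "\<And>j k. dipole_conv j k (F k) (H j k)"
    and ae: "\<And>j. AE x in lborel. E1 t x $ j = lam *\<^sub>R (\<Sum>k\<in>UNIV. H j k x)"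
    using eq t unfolding E1_equation_def by blast
  have H2: "Lp_mem 2 (H j k)" for j k using H by (simp add: dipole_conv_def)
  have Hn: "Lp_norm 2 (H j k) \<le> CZ_const * ?I" for j k
    by (rule order_trans[OF dipole_conv_bound[OF H]])
       (intro mult_left_mono Gamma_moment_bound[OF F m le], auto)
  have S: "Lp_mem 2 (\<lambda>x. \<Sum>k\<in>UNIV. H j k x)" "Lp_norm 2 (\<lambda>x. \<Sum>k\<in>UNIV. H j k x) \<le> (\<Sum>k\<in>UNIV. Lp_norm 2 (H j k))" for j
    using L2_sum[of UNIV "H j"] H2 by auto
  have comp: "Lp_norm 2 (\<lambda>x. E1 t x $ j) \<le> 3 * \<bar>lam\<bar> * CZ_const * ?I" for j
  proof -
    note Ej = L2_measurable[OF vec_nth_L2(1)[OF E1, of j]]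
    have "AE x in lborel. lam *\<^sub>R (\<Sum>k\<in>UNIV. H j k x) = E1 t x $ j"
      using ae[of j] by (rule eventually_mono) simp
    from L2_cong_AE(2)[OF L2_scaleR(1)[OF S(1)] Ej this]
    have "Lp_norm 2 (\<lambda>x. E1 t x $ j) = \<bar>lam\<bar> * Lp_norm 2 (\<lambda>x. \<Sum>k\<in>UNIV. H j k x)"
      by (simp only: L2_scaleR(2)[OF S(1)])
    also have "\<dots> \<le> \<bar>lam\<bar> * (\<Sum>k\<in>UNIV. Lp_norm 2 (H j k))"
      by (intro mult_left_mono S) auto
    also have "\<dots> \<le> \<bar>lam\<bar> * (\<Sum>k\<in>(UNIV::3 set). CZ_const * ?I)"
      by (intro mult_left_mono sum_mono Hn) auto
    finally show ?thesis by simp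
  qed
  have "Lp_norm 2 (E1 t) \<le> (\<Sum>j\<in>UNIV. Lp_norm 2 (\<lambda>x. E1 t x $ j))" by (rule L2_vec_norm_le[OF E1])
  also have "\<dots> \<le> (\<Sum>j\<in>(UNIV::3 set). 3 * \<bar>lam\<bar> * CZ_const * ?I)" by (intro sum_mono comp)
  finally show ?thesis by (simp add: E1_factor_def)
qed

section \<open>The Volterra inequality\<close>

lemma Beta_scaled:
  fixes p q t :: real
  assumes p: "0 < p" and q: "0 < q" and t: "0 < t"
  shows "set_integrable lborel {0<..<t} (\<lambda>s. s powr (p - 1) * (t - s) powr (q - 1))"
    and "(LINT s:{0<..<t}|lborel. s powr (p - 1) * (t - s) powr (q - 1)) = t powr (p + q - 1) * Beta p q"
proof -
  define h where "h s = indicator {0<..<t} s *\<^sub>R (s powr (p - 1) * (t - s) powr (q - 1))" for s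
  define b where "b x = indicator {0..1} x *\<^sub>R (x powr (p - 1) * (1 - x) powr (q - 1))" for x :: real
  have bi: "integrable lborel b"
    using integrable_Beta[OF p q] by (simp add: set_integrable_def b_def[abs_def])
  have bI: "(\<integral>x. b x \<partial>lborel) = Beta p q"
    using set_borel_integral_eq_integral(2)[OF integrable_Beta[OF p q]] has_integral_Beta_real[OF p q]
    by (simp add: b_def set_lebesgue_integral_def integral_unique)
  have eq: "h (0 + t * x) = t powr (p + q - 2) * b x" for x
  proof (cases "x \<in> {0<..<1}")
    case True
    have "t - t * x = t * (1 - x)" by (simp add: algebra_simps)
    moreover have "t powr (p + q - 2) = t powr (p - 1) * t powr (q - 1)"
      by (simp add: powr_add[symmetric])
    ultimately show ?thesis using True t by (simp add: h_def b_def powr_mult)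
  next
    \<comment> \<open>At the endpoints \<open>0 powr _ = 0\<close>, so the closed interval in b and
      the open one in h agree at every x.\<close>
    case False
    then consider "x < 0" | "x = 0" | "x = 1" | "x > 1" by fastforce
    then show ?thesis using t by cases (auto simp: h_def b_def indicator_def zero_less_mult_iff)
  qed
  have "integrable lborel (\<lambda>x. h (0 + t * x))"
    unfolding eq by (intro integrable_mult_right bi)
  then have hi: "integrable lborel h"
    using t by (subst (asm) lborel_integrable_real_affine_iff) auto
  then show "set_integrable lborel {0<..<t} (\<lambda>s. s powr (p - 1) * (t - s) powr (q - 1))"
    by (simp add: set_integrable_def h_def[abs_def])
  have "(\<integral>s. h s \<partial>lborel) = \<bar>t\<bar> *\<^sub>R (\<integral>x. h (0 + t * x) \<partial>lborel)"
    using t by (intro lborel_integral_real_affine) simp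
  also have "\<dots> = (t powr 1 * t powr (p + q - 2)) * Beta p q"
    unfolding eq using t by (simp add: bI)
  also have "t powr 1 * t powr (p + q - 2) = t powr (p + q - 1)"
    by (subst powr_add[symmetric]) (simp add: algebra_simps)
  finally show "(LINT s:{0<..<t}|lborel. s powr (p - 1) * (t - s) powr (q - 1)) = t powr (p + q - 1) * Beta p q"
    by (simp add: set_lebesgue_integral_def h_def)
qed

text \<open>A consequence of ln x <= x - 1. The exponent 1/4 lies strictly between 0 and 1/2: it
  must yield a negative power of \<mu>, yet leave s^(-1/2) s^(-1/4) integrable at 0.\<close>

lemma exp_minus_le_powr:
  fixes x :: real
  assumes "0 < x"
  shows "exp (- x) \<le> x powr (-1/4)"
proof -
  have "ln x / 4 \<le> x" using ln_le_minus_one[OF assms] assms by simp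
  then show ?thesis using assms by (simp add: powr_def)
qed

text \<open>In the norm weighted by \<open>exp (- \<mu> t)\<close> the Volterra operator has norm at most \<open>1/2\<close>; the
  bound \<open>exp (- \<mu> s) \<le> (\<mu> s) powr (-1/4)\<close> produces the small factor while keeping a Beta integral.\<close>

theorem E1_bound:
  fixes T \<omega> a b :: real
  assumes T: "0 < T" and \<omega>: "0 \<le> \<omega>" "\<omega> < 1" and a: "0 \<le> a" and b: "0 \<le> b"
    and w: "\<And>\<tau>. \<tau> \<in> {0<..T} \<Longrightarrow> Lp_norm 2 (w \<tau>) = a"
    and \<rho>: "\<And>\<tau>. \<tau> \<in> {0<..T} \<Longrightarrow> Lp_mem (6/5) (free_density w0 \<tau>)"
    and \<rho>b: "\<And>\<tau>. \<tau> \<in> {0<..T} \<Longrightarrow> \<tau> powr \<omega> * Lp_norm (6/5) (free_density w0 \<tau>) \<le> b"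
    and V: "V_space T (\<omega> - 1/2) E1" and eq: "E1_equation T w0 w E1" and t: "t \<in> {0<..T}"
  defines "L \<equiv> 2 * E1_factor * a * Beta (1/4) (3/2 - \<omega>)"
    and "K \<equiv> E1_factor * a * E0_const * b * Beta (1/2) (1 - \<omega>)"
  shows "Lp_norm 2 (E1 t) \<le> 2 * K * exp (T * (T * (L ^ 4 + 1))) * t powr (1/2 - \<omega>)"
proof -
  define B1 where "B1 = Beta (1/2) (1 - \<omega>)"
  define B2 where "B2 = Beta (1/4) (3/2 - \<omega>)"
  have B: "0 \<le> B1" "0 \<le> B2"
    unfolding B1_def B2_def Beta_def using \<omega> by (simp_all add: Gamma_real_nonneg)
  have L0: "0 \<le> L" using a B by (simp add: L_def B2_def[symmetric])
  have K0: "0 \<le> K" using a b B E0_const_pos by (simp add: K_def B1_def[symmetric])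
  \<comment> \<open>With this choice L (T/\<mu>)^(1/4) = L / (L^4 + 1)^(1/4) <= 1, for every T and
    every L >= 0.\<close>
  define \<mu> where "\<mu> = T * (L ^ 4 + 1)"
  have \<mu>: "0 < \<mu>" using T by (simp add: \<mu>_def add_nonneg_pos)
  define \<Phi> where "\<Phi> \<tau> = exp (- (\<mu> * \<tau>)) * (\<tau> powr (\<omega> - 1/2) * Lp_norm 2 (E1 \<tau>))" for \<tau>
  define M where "M = (SUP \<tau>\<in>{0<..T}. \<Phi> \<tau>)"
  have E1m: "Lp_mem 2 (E1 \<tau>)" if "\<tau> \<in> {0<..T}" for \<tau>
    using V that by (auto simp: V_space_def L2_continuous_on_def)
  obtain N where N: "\<And>\<tau>. \<tau> \<in> {0<..T} \<Longrightarrow> \<tau> powr (\<omega> - 1/2) * Lp_norm 2 (E1 \<tau>) \<le> N"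
    using V unfolding V_space_def bdd_above_def by (meson imageI)
  \<comment> \<open>The a priori information from \<open>V_space\<close>: without boundedness M
    would not be a genuine supremum, and absorbing M/2 at the end would be meaningless.\<close>
  have bdd: "bdd_above (\<Phi> ` {0<..T})"
  proof (rule bdd_aboveI2)
    fix \<tau> assume \<tau>: "\<tau> \<in> {0<..T}"
    have "\<Phi> \<tau> \<le> 1 * (\<tau> powr (\<omega> - 1/2) * Lp_norm 2 (E1 \<tau>))"
      unfolding \<Phi>_def using \<tau> \<mu> by (intro mult_right_mono) auto
    then show "\<Phi> \<tau> \<le> N" using N[OF \<tau>] by simp
  qed
  have \<Phi>M: "\<Phi> \<tau> \<le> M" if "\<tau> \<in> {0<..T}" for \<tau>
    unfolding M_def by (rule cSUP_upper[OF that bdd])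
  have \<Phi>0: "0 \<le> \<Phi> \<tau>" for \<tau> by (simp add: \<Phi>_def)
  have M0: "0 \<le> M" using \<Phi>0[of T] \<Phi>M[of T] T by simp
  have E1M: "Lp_norm 2 (E1 \<tau>) = exp (\<mu> * \<tau>) * \<Phi> \<tau> * \<tau> powr (1/2 - \<omega>)" if "\<tau> \<in> {0<..T}" for \<tau>
  proof -
    have "\<tau> powr (1/2 - \<omega>) * \<tau> powr (\<omega> - 1/2) = 1"
      using that by (subst powr_add[symmetric]) simp
    moreover have "exp (\<mu> * \<tau>) * exp (- (\<mu> * \<tau>)) = 1" by (simp flip: exp_add)
    ultimately have "(exp (\<mu> * \<tau>) * exp (- (\<mu> * \<tau>))) * (\<tau> powr (1/2 - \<omega>) * \<tau> powr (\<omega> - 1/2)) * Lp_norm 2 (E1 \<tau>) = Lp_norm 2 (E1 \<tau>)"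
      by simp
    then show ?thesis by (simp add: \<Phi>_def mult_ac)
  qed
  have E0b: "Lp_norm 2 (E0_field w0 \<tau>) \<le> E0_const * b * \<tau> powr (- \<omega>)" if \<tau>: "\<tau> \<in> {0<..T}" for \<tau>
  proof -
    have "Lp_norm (6/5) (free_density w0 \<tau>) = (\<tau> powr \<omega> * Lp_norm (6/5) (free_density w0 \<tau>)) * \<tau> powr (- \<omega>)"
      using \<tau> by (simp add: powr_minus field_simps)
    also have "\<dots> \<le> b * \<tau> powr (- \<omega>)" by (intro mult_right_mono \<rho>b \<tau>) auto
    finally have "E0_const * Lp_norm (6/5) (free_density w0 \<tau>) \<le> E0_const * (b * \<tau> powr (- \<omega>))"
      using E0_const_pos by (intro mult_left_mono) auto
    then show ?thesis using E0_field_bound(2)[OF \<rho>[OF \<tau>]] by simp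
  qed
  have small: "L * (T / \<mu>) powr (1/4) \<le> 1"
  proof -
    have "T / \<mu> = 1 / (L ^ 4 + 1)" using T by (simp add: \<mu>_def)
    moreover have "L \<le> (L ^ 4 + 1) powr (1/4)"
    proof -
      have "L powr 4 = L ^ 4" using L0 by simp
      moreover have "(L powr 4) powr (1/4) = L" unfolding powr_powr using L0 by simp
      ultimately have "L = (L ^ 4) powr (1/4)" by (simp only:)
      also have "\<dots> \<le> (L ^ 4 + 1) powr (1/4)" by (intro powr_mono2) auto
      finally show ?thesis .
    qed
    moreover have "0 < (L ^ 4 + 1) powr (1/4)" by (simp add: add_nonneg_eq_0_iff)
    ultimately show ?thesis by (simp add: powr_divide)
  qed
  have step: "\<Phi> t \<le> K + M / 2" if t: "t \<in> {0<..T}" for t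
  proof -
    have t0: "0 < t" "t \<le> T" using t by auto
    define c1 where "c1 = a * (E0_const * b)"
    define c2 where "c2 = a * (M * exp (\<mu> * t) * \<mu> powr (-1/4))"
    \<comment> \<open>The first summand comes from E0 and the second from E1 with the weight
      inserted. The exponents are written as p - 1 and q - 1 so that the integrals are Beta(1/2,
      1-\<omega>) and Beta(1/4, 3/2-\<omega>), both convergent since \<omega> < 1.\<close>
    define m where "m s = c1 * (s powr (1/2 - 1) * (t - s) powr ((1 - \<omega>) - 1))
       + c2 * (s powr (1/4 - 1) * (t - s) powr ((3/2 - \<omega>) - 1))" for s
    have p: "(0::real) < 1/2" "(0::real) < 1/4" "0 < 1 - \<omega>" "0 < 3/2 - \<omega>" using \<omega> by auto
    note BI1 = Beta_scaled[OF p(1) p(3) t0(1)] and BI2 = Beta_scaled[OF p(2) p(4) t0(1)]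
    have mi: "set_integrable lborel {0<..<t} m"
      unfolding m_def by (intro set_integral_add set_integrable_mult_right BI1 BI2)
    have mI: "(LINT s:{0<..<t}|lborel. m s) = c1 * (t powr (1/2 - \<omega>) * B1) + c2 * (t powr (3/4 - \<omega>) * B2)"
    proof -
      have "(LINT s:{0<..<t}|lborel. m s) = c1 * (LINT s:{0<..<t}|lborel. s powr (1/2 - 1) * (t - s) powr ((1 - \<omega>) - 1))
          + c2 * (LINT s:{0<..<t}|lborel. s powr (1/4 - 1) * (t - s) powr ((3/2 - \<omega>) - 1))"
        unfolding m_def
        by (subst set_integral_add(2)) (intro set_integrable_mult_right BI1 BI2, intro set_integrable_mult_right BI1 BI2, simp)
      also have "\<dots> = c1 * (t powr (1/2 - \<omega>) * B1) + c2 * (t powr (3/4 - \<omega>) * B2)"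
        unfolding BI1(2) BI2(2) B1_def B2_def by simp
      finally show ?thesis .
    qed
    have "Lp_norm 2 (E1 t) \<le> E1_factor * (LINT s:{0<..<t}|lborel. m s)"
    proof (rule E1_step[OF eq t E1m[OF t] mi])
      fix s assume s: "s \<in> {0<..<t}"
      define \<tau> where "\<tau> = t - s"
      have \<tau>: "\<tau> \<in> {0<..T}" and s0: "0 < s" using s t0 by (auto simp: \<tau>_def)
      have "Lp_norm 2 (\<lambda>x. E0_field w0 \<tau> x + E1 \<tau> x) \<le> Lp_norm 2 (E0_field w0 \<tau>) + Lp_norm 2 (E1 \<tau>)"
        by (rule L2_add(2)[OF E0_field_bound(1)[OF \<rho>[OF \<tau>]] E1m[OF \<tau>]])
      also have "\<dots> \<le> E0_const * b * \<tau> powr (- \<omega>) + exp (\<mu> * \<tau>) * M * \<tau> powr (1/2 - \<omega>)"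
        unfolding E1M[OF \<tau>] by (intro add_mono E0b \<tau> mult_right_mono mult_left_mono \<Phi>M) auto
      also have "exp (\<mu> * \<tau>) * M * \<tau> powr (1/2 - \<omega>) \<le> (exp (\<mu> * t) * (\<mu> powr (-1/4) * s powr (-1/4))) * M * \<tau> powr (1/2 - \<omega>)"
      proof -
        have "exp (\<mu> * \<tau>) = exp (\<mu> * t) * exp (- (\<mu> * s))" by (simp add: \<tau>_def algebra_simps flip: exp_add)
        also have "\<dots> \<le> exp (\<mu> * t) * (\<mu> powr (-1/4) * s powr (-1/4))"
          using exp_minus_le_powr[of "\<mu> * s"] \<mu> s0 by (intro mult_left_mono) (auto simp: powr_mult)
        finally show ?thesis using M0 by (intro mult_right_mono) auto
      qed
      finally have "s powr (-1/2) * Lp_norm 2 (\<lambda>x. E0_field w0 \<tau> x + E1 \<tau> x) * a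
         \<le> s powr (-1/2) * (E0_const * b * \<tau> powr (- \<omega>) + (exp (\<mu> * t) * (\<mu> powr (-1/4) * s powr (-1/4))) * M * \<tau> powr (1/2 - \<omega>)) * a"
        using a by (intro mult_right_mono mult_left_mono) auto
      also have "\<dots> = c1 * (s powr (-1/2) * \<tau> powr (- \<omega>)) + c2 * ((s powr (-1/2) * s powr (-1/4)) * \<tau> powr (1/2 - \<omega>))"
        by (simp add: c1_def c2_def algebra_simps)
      also have "s powr (-1/2) * s powr (-1/4) = s powr (-3/4)"
        by (subst powr_add[symmetric]) simp
      also have "c1 * (s powr (-1/2) * \<tau> powr (- \<omega>)) + c2 * (s powr (-3/4) * \<tau> powr (1/2 - \<omega>)) = m s"
        by (simp add: m_def \<tau>_def)
      finally show "s powr (-1/2) * Lp_norm 2 (\<lambda>x. E0_field w0 (t - s) x + E1 (t - s) x) * Lp_norm 2 (w (t - s)) \<le> m s"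
        using w[OF \<tau>] by (simp add: \<tau>_def)
    qed
    also have "E1_factor * (LINT s:{0<..<t}|lborel. m s)
        = K * t powr (1/2 - \<omega>) + E1_factor * c2 * B2 * t powr (3/4 - \<omega>)"
      unfolding mI by (simp add: K_def B1_def c1_def algebra_simps)
    also have "t powr (3/4 - \<omega>) = t powr (1/4) * t powr (1/2 - \<omega>)"
      by (subst powr_add[symmetric]) simp
    finally have le: "Lp_norm 2 (E1 t) \<le> (K + E1_factor * c2 * B2 * t powr (1/4)) * t powr (1/2 - \<omega>)"
      by (simp add: algebra_simps)
    have "\<Phi> t = (exp (- (\<mu> * t)) * t powr (\<omega> - 1/2)) * Lp_norm 2 (E1 t)"
      by (simp add: \<Phi>_def mult.assoc)
    also have "\<dots> \<le> (exp (- (\<mu> * t)) * t powr (\<omega> - 1/2)) * ((K + E1_factor * c2 * B2 * t powr (1/4)) * t powr (1/2 - \<omega>))"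
      by (intro mult_left_mono le) auto
    also have "\<dots> = exp (- (\<mu> * t)) * (K + E1_factor * c2 * B2 * t powr (1/4)) * (t powr (\<omega> - 1/2) * t powr (1/2 - \<omega>))"
      by (simp add: mult_ac)
    also have "t powr (\<omega> - 1/2) * t powr (1/2 - \<omega>) = 1"
      using t0 by (subst powr_add[symmetric]) simp
    \<comment> \<open>The factor exp(\<mu> t) hidden in c2 cancels the weight, and E1_factor * a *
      B2 is L/2; this is the origin of the 2 in L and of the M/2.\<close>
    also have "exp (- (\<mu> * t)) * (K + E1_factor * c2 * B2 * t powr (1/4)) * 1
        = exp (- (\<mu> * t)) * K + (exp (- (\<mu> * t)) * exp (\<mu> * t)) * (M / 2) * (L * (t powr (1/4) * \<mu> powr (-1/4)))"
      by (simp add: c2_def L_def B2_def algebra_simps)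
    also have "exp (- (\<mu> * t)) * exp (\<mu> * t) = 1" by (simp flip: exp_add)
    also have "exp (- (\<mu> * t)) * K + 1 * (M / 2) * (L * (t powr (1/4) * \<mu> powr (-1/4))) \<le> 1 * K + 1 * (M / 2) * 1"
    proof (intro add_mono mult_right_mono mult_left_mono K0)
      show "exp (- (\<mu> * t)) \<le> 1" using \<mu> t0 by simp
      have "t powr (1/4) * \<mu> powr (-1/4) = (t / \<mu>) powr (1/4)"
        using powr_minus_divide[of \<mu> "1/4"] t0 \<mu> by (simp add: powr_divide)
      also have "\<dots> \<le> (T / \<mu>) powr (1/4)"
        using t0 \<mu> by (intro powr_mono2 divide_right_mono) auto
      finally have "L * (t powr (1/4) * \<mu> powr (-1/4)) \<le> L * (T / \<mu>) powr (1/4)"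
        using L0 by (rule mult_left_mono)
      then show "L * (t powr (1/4) * \<mu> powr (-1/4)) \<le> 1" using small by simp
    qed (use M0 in auto)
    finally show ?thesis by simp
  qed
  \<comment> \<open>Taking the supremum in \<open>step\<close> gives M <= K + M/2, and since M is a
    real number half of it can be subtracted.\<close>
  have "(SUP \<tau>\<in>{0<..T}. \<Phi> \<tau>) \<le> K + M / 2"
    by (rule cSUP_least[OF _ step]) (use T in auto)
  then have "M \<le> 2 * K" unfolding M_def[symmetric] by simp
  then have "\<Phi> t \<le> 2 * K" using \<Phi>M[OF t] by simp
  moreover have "exp (\<mu> * t) \<le> exp (T * \<mu>)" using t \<mu> by (simp add: mult.commute)
  ultimately have "exp (\<mu> * t) * \<Phi> t \<le> exp (T * \<mu>) * (2 * K)"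
    by (intro mult_mono) (auto simp: \<Phi>0)
  then have "exp (\<mu> * t) * \<Phi> t * t powr (1/2 - \<omega>) \<le> exp (T * \<mu>) * (2 * K) * t powr (1/2 - \<omega>)"
    by (rule mult_right_mono) simp
  then show ?thesis unfolding E1M[OF t] by (simp add: \<mu>_def mult_ac)
qed

theorem proposition4p9:
  shows "\<exists>C0>0. \<forall>\<omega>::real. 0 \<le> \<omega> \<and> \<omega> < 1 \<longrightarrow>
    (\<exists>C1 :: real \<Rightarrow> real \<Rightarrow> real \<Rightarrow> real.
      (\<forall>a\<ge>0. \<forall>b\<ge>0. continuous_on {0<..} (C1 a b)) \<and>
      (\<forall>(T::real) (C_T::real) (w0::phase_fun) (w::real \<Rightarrow> phase_fun) (E1::real \<Rightarrow> vfield).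
        0 < T \<longrightarrow>
        Lp_mem 2 w0 \<longrightarrow>
        L2_continuous_on {0..T} w \<longrightarrow>
        mild_solution_WP T w0 w (\<lambda>t x. E0_field w0 t x + E1 t x) \<longrightarrow>
        (\<forall>t\<in>{0..T}. Lp_norm 2 (w t) = Lp_norm 2 w0) \<longrightarrow>
        (\<forall>t\<in>{0<..T}. (AE x in lborel. integrable lborel (\<lambda>v. w0 (x - t *\<^sub>R v, v))) \<and>
           Lp_mem (6/5) (free_density w0 t) \<and>
           Lp_norm (6/5) (free_density w0 t) \<le> C_T * t powr (- \<omega>)) \<longrightarrow>
        V_space T (\<omega> - 1/2) E1 \<longrightarrow>
        E1_equation T w0 w E1 \<longrightarrow>
        (\<forall>t\<in>{0<..T}.
           Lp_mem 2 (E0_field w0 t) \<and>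
           Lp_norm 2 (E0_field w0 t) \<le> C0 * Lp_norm (6/5) (free_density w0 t) \<and>
           C0 * Lp_norm (6/5) (free_density w0 t) \<le> C0 * C_T * t powr (- \<omega>) \<and>
           Lp_norm 2 (E1 t) \<le>
             C1 (Lp_norm 2 w0)
                (SUP s\<in>{0<..T}. s powr \<omega> * Lp_norm (6/5) (free_density w0 s))
                T * t powr (1/2 - \<omega>))))"
  proof (rule exI[of _ E0_const], intro conjI E0_const_pos allI impI, goal_cases)
  case \<omega>: (1 \<omega>)
  define L where "L a = 2 * E1_factor * a * Beta (1/4) (3/2 - \<omega>)" for a
  define K where "K a b = E1_factor * a * E0_const * b * Beta (1/2) (1 - \<omega>)" for a b
  \<comment> \<open>The bound of \<open>E1_bound\<close> read as a function of T with a and b fixed;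
    it is composed of polynomials and an exponential in T, hence continuous.\<close>
  define C1 where "C1 a b T = 2 * K a b * exp (T * (T * (L a ^ 4 + 1)))" for a b T
  have cont: "continuous_on {0<..} (C1 a b)" for a b
    unfolding C1_def[abs_def] by (intro continuous_intros)
  have E0: "Lp_mem 2 (E0_field w0 t) \<and> Lp_norm 2 (E0_field w0 t) \<le> E0_const * Lp_norm (6/5) (free_density w0 t)
      \<and> E0_const * Lp_norm (6/5) (free_density w0 t) \<le> E0_const * C_T * t powr (- \<omega>)"
    if "Lp_mem (6/5) (free_density w0 t)" "Lp_norm (6/5) (free_density w0 t) \<le> C_T * t powr (- \<omega>)" for w0 t C_T
    using E0_field_bound[OF that(1)] mult_left_mono[OF that(2) less_imp_le[OF E0_const_pos]] by (simp add: mult.assoc)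
  have E1: "Lp_norm 2 (E1 t) \<le> C1 (Lp_norm 2 w0) (SUP s\<in>{0<..T}. s powr \<omega> * Lp_norm (6/5) (free_density w0 s)) T * t powr (1/2 - \<omega>)"
    if T: "0 < T" and w: "\<forall>t\<in>{0..T}. Lp_norm 2 (w t) = Lp_norm 2 w0"
      and d: "\<forall>t\<in>{0<..T}. (AE x in lborel. integrable lborel (\<lambda>v. w0 (x - t *\<^sub>R v, v))) \<and>
           Lp_mem (6/5) (free_density w0 t) \<and> Lp_norm (6/5) (free_density w0 t) \<le> C_T * t powr (- \<omega>)"
      and V: "V_space T (\<omega> - 1/2) E1" and eq: "E1_equation T w0 w E1" and t: "t \<in> {0<..T}"
    for T C_T t :: real and w0 w E1
  proof -
    let ?f = "\<lambda>s. s powr \<omega> * Lp_norm (6/5) (free_density w0 s)"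
    \<comment> \<open>The assumed decay enters here only to make the supremum a genuine upper bound,
      so that the constant depends on the supremum itself and not on C_T.\<close>
    have "?f s \<le> C_T" if s: "s \<in> {0<..T}" for s
    proof -
      have "?f s \<le> s powr \<omega> * (C_T * s powr (- \<omega>))" using d s by (intro mult_left_mono) auto
      also have "\<dots> = C_T" using s by (simp add: powr_minus)
      finally show ?thesis .
    qed
    then have up: "?f s \<le> (SUP s\<in>{0<..T}. ?f s)" if "s \<in> {0<..T}" for s
      using that by (intro cSUP_upper bdd_aboveI2)
    have "0 \<le> ?f T" by simp
    also have "\<dots> \<le> (SUP s\<in>{0<..T}. ?f s)" using T by (intro up) simp
    finally have b: "0 \<le> (SUP s\<in>{0<..T}. ?f s)" .
    have wa: "Lp_norm 2 (w \<tau>) = Lp_norm 2 w0" if "\<tau> \<in> {0<..T}" for \<tau> using w that by simp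
    have \<rho>: "Lp_mem (6/5) (free_density w0 \<tau>)" if "\<tau> \<in> {0<..T}" for \<tau> using d that by blast
    show ?thesis
      unfolding C1_def K_def L_def
      by (rule E1_bound[OF T conjunct1[OF \<omega>] conjunct2[OF \<omega>] Lp_norm_nonneg b wa \<rho> up V eq t])
  qed
  show ?case
  proof (rule exI[of _ C1], intro conjI allI impI ballI, goal_cases)
    case 1 show ?case by (rule cont)
  next
    case prems: (2 T C_T w0 w E1 t)
    then show ?case using E0[of w0 t C_T] by blast
  next
    case prems: (3 T C_T w0 w E1 t)
    then show ?case using E0[of w0 t C_T] by blast
  next
    case prems: (4 T C_T w0 w E1 t)
    then show ?case using E0[of w0 t C_T] by blast
  next
    case prems: (5 T C_T w0 w E1 t)
    show ?case by (rule E1[OF prems(1,5-9)])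
  qed
qed

end
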